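(* Let $F$ be a field; all groups are affine group schemes over $F$. Let $G=K\rtimes H$ be a semi-direct product and consider a homomorphism $P\to K$. Suppose that $P$ is pro-unipotent and that the natural maps $$R^i\Gamma(K,-)\circ\mathrm{Res}^G_K\;\longrightarrow\;R^i\Gamma(P,-)\circ\mathrm{Res}^G_P$$ between functors from $\mathrm{Rep}\,G$ to $F$-vector spaces are isomorphisms for $i=0,1$. Then $P\to K$ is an isomorphism.
   Context: $\mathrm{Rep}\,G$ is the category of finite-dimensional $F$-linear representations of $G$; $\mathrm{Res}^G_K$ and $\mathrm{Res}^G_P$ are restriction along $K\hookrightarrow G$ and $P\to K\hookrightarrow G$. $\Gamma(K,-)$ and $\Gamma(P,-)$ are the functors of invariants, and $R^i$ denotes right derived functors computed in the ind-category (all, possibly infinite-dimensional, algebraic representations); so $R^i\Gamma(K,V)=H^i(K,V)$ is rational cohomology and the natural maps are the restriction maps $H^i(K,V)\to H^i(P,V)$. An affine group scheme is pro-unipotent if each of its finite-dimensional representations is an iterated extension of trivial representations. *)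

theory Defs
  imports Complex_Main "HOL-Library.Function_Algebras"
begin

section \<open>Tensor products over a field\<close>

definition fscale :: "'f::field \<Rightarrow> ('i \<Rightarrow> 'f) \<Rightarrow> 'i \<Rightarrow> 'f" where
  "fscale c f = (\<lambda>i. c * f i)"

definition bilinear_map ::
  "('f::field \<Rightarrow> 'v::ab_group_add \<Rightarrow> 'v) \<Rightarrow> ('f \<Rightarrow> 'w::ab_group_add \<Rightarrow> 'w)
    \<Rightarrow> ('f \<Rightarrow> 'u::ab_group_add \<Rightarrow> 'u) \<Rightarrow> ('v \<Rightarrow> 'w \<Rightarrow> 'u) \<Rightarrow> bool" where
  "bilinear_map sV sW sU b \<longleftrightarrow>
     (\<forall>w. Vector_Spaces.linear sV sU (\<lambda>v. b v w)) \<and> (\<forall>v. Vector_Spaces.linear sW sU (b v))"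

text \<open>
  The tensor product of \<open>V\<close> and \<open>W\<close> is realised inside the dual of the space of bilinear forms
  on \<open>V \<times> W\<close>: the pure tensor of \<open>v\<close> and \<open>w\<close> is evaluation at \<open>(v, w)\<close>, and the tensor product
  is the linear span of the pure tensors. The lemmas \<open>tens_bilinear\<close>, \<open>tlift_linear\<close>,
  \<open>tlift_tens\<close> and \<open>tensor_eqI\<close> below are its universal property. Elements are functions on all
  of \<open>'v \<Rightarrow> 'w \<Rightarrow> 'f\<close>; off the bilinear forms they vanish.
\<close>

type_synonym ('f, 'v, 'w) tensor = "('v \<Rightarrow> 'w \<Rightarrow> 'f) \<Rightarrow> 'f"

definition tens ::
  "('f::field \<Rightarrow> 'v::ab_group_add \<Rightarrow> 'v) \<Rightarrow> ('f \<Rightarrow> 'w::ab_group_add \<Rightarrow> 'w)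
    \<Rightarrow> 'v \<Rightarrow> 'w \<Rightarrow> ('f, 'v, 'w) tensor" where
  "tens sV sW v w = (\<lambda>\<beta>. if bilinear_map sV sW (*) \<beta> then \<beta> v w else 0)"

definition tensor_space ::
  "('f::field \<Rightarrow> 'v::ab_group_add \<Rightarrow> 'v) \<Rightarrow> ('f \<Rightarrow> 'w::ab_group_add \<Rightarrow> 'w)
    \<Rightarrow> 'v set \<Rightarrow> 'w set \<Rightarrow> ('f, 'v, 'w) tensor set" where
  "tensor_space sV sW V W = module.span fscale {tens sV sW v w | v w. v \<in> V \<and> w \<in> W}"

text \<open>
  The linear map induced by a bilinear map \<open>b\<close>. It is determined on the span of the pure tensors
  only, and is used only there.
\<close>

definition tlift ::
  "('f::field \<Rightarrow> 'v::ab_group_add \<Rightarrow> 'v) \<Rightarrow> ('f \<Rightarrow> 'w::ab_group_add \<Rightarrow> 'w)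
    \<Rightarrow> ('f \<Rightarrow> 'u::ab_group_add \<Rightarrow> 'u) \<Rightarrow> ('v \<Rightarrow> 'w \<Rightarrow> 'u) \<Rightarrow> ('f, 'v, 'w) tensor \<Rightarrow> 'u" where
  "tlift sV sW sU b =
     (SOME f. Vector_Spaces.linear fscale sU f \<and> (\<forall>v w. f (tens sV sW v w) = b v w))"

definition tmap ::
  "('f::field \<Rightarrow> 'v::ab_group_add \<Rightarrow> 'v) \<Rightarrow> ('f \<Rightarrow> 'w::ab_group_add \<Rightarrow> 'w)
    \<Rightarrow> ('f \<Rightarrow> 'x::ab_group_add \<Rightarrow> 'x) \<Rightarrow> ('f \<Rightarrow> 'y::ab_group_add \<Rightarrow> 'y)
    \<Rightarrow> ('v \<Rightarrow> 'x) \<Rightarrow> ('w \<Rightarrow> 'y) \<Rightarrow> ('f, 'v, 'w) tensor \<Rightarrow> ('f, 'x, 'y) tensor" where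
  "tmap sV sW sX sY f g = tlift sV sW fscale (\<lambda>v w. tens sX sY (f v) (g w))"

lemma vector_space_fscale: "vector_space (fscale :: 'f::field \<Rightarrow> ('i \<Rightarrow> 'f) \<Rightarrow> _)"
  by unfold_locales (auto simp: fscale_def fun_eq_iff algebra_simps)

interpretation fs: vector_space "fscale :: 'f::field \<Rightarrow> ('i \<Rightarrow> 'f) \<Rightarrow> _"
  by (rule vector_space_fscale)

lemma vector_space_mult: "vector_space ((*) :: 'f::field \<Rightarrow> 'f \<Rightarrow> 'f)"
  by unfold_locales (auto simp: algebra_simps)

lemma tens_bilinear:
  assumes "vector_space sV" "vector_space sW"
  shows "bilinear_map sV sW fscale (tens sV sW)"
  using assms vector_space_fscale
  unfolding bilinear_map_def Vector_Spaces.linear_iff tens_def fscale_def fun_eq_iff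
  by (simp add: plus_fun_def)

lemma separating_functional:
  assumes "vector_space sU" "u \<noteq> 0"
  obtains l where "Vector_Spaces.linear sU ((*) :: 'f::field \<Rightarrow> 'f \<Rightarrow> 'f) l" "l u \<noteq> 0"
proof -
  interpret U: vector_space sU by fact
  interpret vector_space_pair sU "(*) :: 'f \<Rightarrow> 'f \<Rightarrow> 'f"
    by (intro vector_space_pair.intro assms vector_space_mult)
  have i: "U.independent {u}" using assms(2) by simp
  have "construct {u} (\<lambda>_. 1) u = 1" by (rule construct_basis[OF i]) simp
  thus ?thesis using that[OF linear_construct[OF i, of "\<lambda>_. 1"]] by simp
qed

lemma tlift_exists:
  fixes sV :: "'f::field \<Rightarrow> 'v::ab_group_add \<Rightarrow> 'v" and sW :: "'f \<Rightarrow> 'w::ab_group_add \<Rightarrow> 'w"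
    and sU :: "'f \<Rightarrow> 'u::ab_group_add \<Rightarrow> 'u"
  assumes V: "vector_space sV" and W: "vector_space sW" and U: "vector_space sU"
    and b: "bilinear_map sV sW sU b"
  shows "\<exists>f. Vector_Spaces.linear fscale sU f \<and> (\<forall>v w. f (tens sV sW v w) = b v w)"
proof -
  interpret U: vector_space sU by fact
  interpret vector_space_pair "fscale :: 'f \<Rightarrow> ('f, 'v, 'w) tensor \<Rightarrow> _" sU
    by (intro vector_space_pair.intro U vector_space_fscale)
  let ?T = "{tens sV sW v w | v w. True}"
  obtain B where B: "B \<subseteq> ?T" "fs.independent B" "?T \<subseteq> fs.span B"
    using fs.maximal_independent_subset[of ?T] by blast
  have "\<forall>t\<in>?T. \<exists>p. t = tens sV sW (fst p) (snd p)" by auto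
  from bchoice[OF this]
  obtain p where p: "\<And>t. t \<in> ?T \<Longrightarrow> t = tens sV sW (fst (p t)) (snd (p t))" by blast
  define f where "f = construct B (\<lambda>t. b (fst (p t)) (snd (p t)))"
  have lf: "Vector_Spaces.linear fscale sU f" unfolding f_def by (rule linear_construct[OF B(2)])
  have fB: "f t = b (fst (p t)) (snd (p t))" if "t \<in> B" for t
    unfolding f_def by (rule construct_basis[OF B(2) that])
  have key: "l (f t) = t (\<lambda>v w. l (b v w))"
    if l: "Vector_Spaces.linear sU (*) l" and t: "t \<in> fs.span B" for l t
  proof -
    interpret l: Vector_Spaces.linear sU "(*)" l by fact
    interpret f: Vector_Spaces.linear fscale sU f by fact
    have bl: "bilinear_map sV sW (*) (\<lambda>v w. l (b v w))"
      using b V W vector_space_mult unfolding bilinear_map_def Vector_Spaces.linear_iff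
      by (simp add: l.add l.scale)
    show ?thesis using t
    proof (induction rule: fs.span_induct_alt)
      case base show ?case unfolding f.zero l.zero by simp
    next
      case (step c x y)
      have "x (\<lambda>v w. l (b v w)) = l (b (fst (p x)) (snd (p x)))"
        using fun_cong[OF p[of x], of "\<lambda>v w. l (b v w)"] B(1) step(1) bl
        by (auto simp: tens_def subset_iff)
      hence "l (f (fscale c x + y)) = c * x (\<lambda>v w. l (b v w)) + y (\<lambda>v w. l (b v w))"
        unfolding f.add f.scale l.add l.scale step(2) fB[OF step(1)] by simp
      thus ?case unfolding plus_fun_apply fscale_def .
    qed
  qed
  have "f (tens sV sW v w) = b v w" for v w
  proof (rule ccontr)
    assume "f (tens sV sW v w) \<noteq> b v w"
    then obtain l where l: "Vector_Spaces.linear sU (*) l" "l (f (tens sV sW v w) - b v w) \<noteq> 0"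
      using separating_functional[OF U, of "f (tens sV sW v w) - b v w"] by auto
    interpret l: Vector_Spaces.linear sU "(*)" l by fact
    have bl: "bilinear_map sV sW (*) (\<lambda>v w. l (b v w))"
      using b V W vector_space_mult unfolding bilinear_map_def Vector_Spaces.linear_iff
      by (simp add: l.add l.scale)
    have "l (f (tens sV sW v w)) = l (b v w)"
      using key[OF l(1), of "tens sV sW v w"] B(3) bl by (auto simp: tens_def)
    with l(2) show False by (simp add: l.diff)
  qed
  with lf show ?thesis by blast
qed

lemma
  assumes "vector_space sV" "vector_space sW" "vector_space sU" "bilinear_map sV sW sU b"
  shows tlift_linear: "Vector_Spaces.linear fscale sU (tlift sV sW sU b)"
    and tlift_tens: "tlift sV sW sU b (tens sV sW v w) = b v w"
  using someI_ex[OF tlift_exists[OF assms]] unfolding tlift_def by blast+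

lemma tens_in: "v \<in> V \<Longrightarrow> w \<in> W \<Longrightarrow> tens sV sW v w \<in> tensor_space sV sW V W"
  unfolding tensor_space_def by (rule fs.span_base) blast

lemma tensor_eqI:
  assumes "Vector_Spaces.linear fscale sU f" "Vector_Spaces.linear fscale sU g"
    and "\<And>v w. v \<in> V \<Longrightarrow> w \<in> W \<Longrightarrow> f (tens sV sW v w) = g (tens sV sW v w)"
    and "t \<in> tensor_space sV sW V W"
  shows "f t = g t"
proof -
  interpret f: Vector_Spaces.linear fscale sU f by fact
  interpret g: Vector_Spaces.linear fscale sU g by fact
  show ?thesis using assms(4) unfolding tensor_space_def
    by (induction rule: fs.span_induct_alt)
      (use assms(3) in \<open>auto simp only: f.zero g.zero f.add g.add f.scale g.scale\<close>)
qed


section \<open>Affine group schemes\<close>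

text \<open>
  An affine group scheme over the field \<open>'f\<close> is represented by its coordinate ring, a commutative
  Hopf algebra on the type \<open>'a\<close>, with no finiteness condition.
\<close>

record ('f, 'a) hopf =
  fsmul :: "'f \<Rightarrow> 'a \<Rightarrow> 'a"
  comult :: "'a \<Rightarrow> ('f, 'a, 'a) tensor"
  counit :: "'a \<Rightarrow> 'f"
  antipode :: "'a \<Rightarrow> 'a"

definition tensor_mult ::
  "('f::field, 'a::comm_ring_1) hopf \<Rightarrow> ('f, 'a, 'a) tensor \<Rightarrow> ('f, 'a, 'a) tensor
    \<Rightarrow> ('f, 'a, 'a) tensor" where
  "tensor_mult A t u =
     tlift (fsmul A) (fsmul A) fscale
       (\<lambda>a b. tlift (fsmul A) (fsmul A) fscale
         (\<lambda>c d. tens (fsmul A) (fsmul A) (a * c) (b * d)) u) t"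

definition tensor_counit ::
  "('f::field, 'a::comm_ring_1) hopf \<Rightarrow> ('f \<Rightarrow> 'v::ab_group_add \<Rightarrow> 'v) \<Rightarrow> ('f, 'v, 'a) tensor \<Rightarrow> 'v"
where
  "tensor_counit A sV = tlift sV (fsmul A) sV (\<lambda>v a. sV (counit A a) v)"

text \<open>Comultiplication of the right-hand factor, followed by reassociation.\<close>

definition tensor_comult ::
  "('f::field, 'a::comm_ring_1) hopf \<Rightarrow> ('f \<Rightarrow> 'v::ab_group_add \<Rightarrow> 'v)
    \<Rightarrow> ('f, 'v, 'a) tensor \<Rightarrow> ('f, ('f, 'v, 'a) tensor, 'a) tensor" where
  "tensor_comult A sV =
     tlift sV (fsmul A) fscale
       (\<lambda>v a. tlift (fsmul A) (fsmul A) fscale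
         (\<lambda>a1 a2. tens fscale (fsmul A) (tens sV (fsmul A) v a1) a2) (comult A a))"

locale affine_group =
  fixes A :: "('f::field, 'a::comm_ring_1) hopf"
  assumes vector_space_A: "vector_space (fsmul A)"
    and fsmul_mult: "fsmul A c (a * b) = fsmul A c a * b"
    and comult_linear: "Vector_Spaces.linear (fsmul A) fscale (comult A)"
    and comult_in: "comult A a \<in> tensor_space (fsmul A) (fsmul A) UNIV UNIV"
    and comult_one: "comult A 1 = tens (fsmul A) (fsmul A) 1 1"
    and comult_mult: "comult A (a * b) = tensor_mult A (comult A a) (comult A b)"
    and counit_linear: "Vector_Spaces.linear (fsmul A) (*) (counit A)"
    and counit_one: "counit A 1 = 1"
    and counit_mult: "counit A (a * b) = counit A a * counit A b"
    and antipode_linear: "Vector_Spaces.linear (fsmul A) (fsmul A) (antipode A)"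
    and coassoc:
      "tmap (fsmul A) (fsmul A) fscale (fsmul A) (comult A) id (comult A a) =
       tensor_comult A (fsmul A) (comult A a)"
    and counit_left:
      "tlift (fsmul A) (fsmul A) (fsmul A) (\<lambda>x y. fsmul A (counit A x) y) (comult A a) = a"
    and counit_right: "tensor_counit A (fsmul A) (comult A a) = a"
    and antipode_left:
      "tlift (fsmul A) (fsmul A) (fsmul A) (\<lambda>x y. antipode A x * y) (comult A a) = fsmul A (counit A a) 1"
    and antipode_right:
      "tlift (fsmul A) (fsmul A) (fsmul A) (\<lambda>x y. x * antipode A y) (comult A a) = fsmul A (counit A a) 1"

text \<open>
  A homomorphism of group schemes from \<open>X\<close> to \<open>Y\<close> is given by its comorphism \<open>\<phi>\<close>, which maps the
  coordinate ring of \<open>Y\<close> to that of \<open>X\<close>.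
\<close>

definition group_hom ::
  "('f::field, 'x::comm_ring_1) hopf \<Rightarrow> ('f, 'y::comm_ring_1) hopf \<Rightarrow> ('y \<Rightarrow> 'x) \<Rightarrow> bool" where
  "group_hom X Y \<phi> \<longleftrightarrow>
     Vector_Spaces.linear (fsmul Y) (fsmul X) \<phi> \<and> \<phi> 1 = 1 \<and> (\<forall>a b. \<phi> (a * b) = \<phi> a * \<phi> b) \<and>
     (\<forall>a. counit X (\<phi> a) = counit Y a) \<and>
     (\<forall>a. comult X (\<phi> a) = tmap (fsmul Y) (fsmul Y) (fsmul X) (fsmul X) \<phi> \<phi> (comult Y a))"

definition group_iso ::
  "('f::field, 'x::comm_ring_1) hopf \<Rightarrow> ('f, 'y::comm_ring_1) hopf \<Rightarrow> ('y \<Rightarrow> 'x) \<Rightarrow> bool" where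
  "group_iso X Y \<phi> \<longleftrightarrow>
     group_hom X Y \<phi> \<and> (\<exists>\<psi>. group_hom Y X \<psi> \<and> \<psi> \<circ> \<phi> = id \<and> \<phi> \<circ> \<psi> = id)"

text \<open>
  \<open>K\<close> is the kernel of \<open>p : G \<rightarrow> H\<close>, i.e. the scheme-theoretic fibre over the unit of \<open>H\<close>: the closed
  subscheme of \<open>G\<close> cut out by the ideal which \<open>p\<close> generates from the augmentation ideal of \<open>H\<close>.
\<close>

definition is_group_kernel ::
  "('f::field, 'k::comm_ring_1) hopf \<Rightarrow> ('f, 'g::comm_ring_1) hopf \<Rightarrow> ('f, 'h::comm_ring_1) hopf
    \<Rightarrow> ('g \<Rightarrow> 'k) \<Rightarrow> ('h \<Rightarrow> 'g) \<Rightarrow> bool" where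
  "is_group_kernel K G H i p \<longleftrightarrow>
     group_hom K G i \<and> group_hom G H p \<and> surj i \<and>
     {x. i x = 0} = module.span (*) (p ` {y. counit H y = 0})"

text \<open>
  \<open>G = K \<rtimes> H\<close>, with inclusions \<open>i : K \<rightarrow> G\<close>, \<open>s : H \<rightarrow> G\<close> and projection \<open>p : G \<rightarrow> H\<close>:
  \<open>1 \<rightarrow> K \<rightarrow> G \<rightarrow> H \<rightarrow> 1\<close> is exact and \<open>s\<close> splits \<open>p\<close>.
\<close>

definition semidirect_product ::
  "('f::field, 'g::comm_ring_1) hopf \<Rightarrow> ('f, 'k::comm_ring_1) hopf \<Rightarrow> ('f, 'h::comm_ring_1) hopf
    \<Rightarrow> ('g \<Rightarrow> 'k) \<Rightarrow> ('g \<Rightarrow> 'h) \<Rightarrow> ('h \<Rightarrow> 'g) \<Rightarrow> bool" where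
  "semidirect_product G K H i s p \<longleftrightarrow>
     is_group_kernel K G H i p \<and> group_hom H G s \<and> s \<circ> p = id"


section \<open>Representations\<close>

text \<open>
  A representation, i.e. a right comodule over the coordinate ring, lives on a linear subspace \<open>vec\<close>
  of an ambient vector space. Linear maps out of it, in particular the coaction, are total linear
  maps of the ambient space; only their restriction to \<open>vec\<close> matters.
\<close>

record ('f, 'v, 'a) comod =
  vec :: "'v set"
  smul :: "'f \<Rightarrow> 'v \<Rightarrow> 'v"
  coact :: "'v \<Rightarrow> ('f, 'v, 'a) tensor"

locale representation = affine_group A for A :: "('f::field, 'a::comm_ring_1) hopf" +
  fixes V :: "('f, 'v::ab_group_add, 'a) comod"
  assumes vector_space_V: "vector_space (smul V)"
    and subspace_vec: "module.subspace (smul V) (vec V)"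
    and coact_linear: "Vector_Spaces.linear (smul V) fscale (coact V)"
    and coact_in: "v \<in> vec V \<Longrightarrow> coact V v \<in> tensor_space (smul V) (fsmul A) (vec V) UNIV"
    and coact_coassoc: "v \<in> vec V \<Longrightarrow>
       tmap (smul V) (fsmul A) fscale (fsmul A) (coact V) id (coact V v) =
       tensor_comult A (smul V) (coact V v)"
    and coact_counit: "v \<in> vec V \<Longrightarrow> tensor_counit A (smul V) (coact V v) = v"

definition finite_dimensional :: "('f::field, 'v::ab_group_add, 'a) comod \<Rightarrow> bool" where
  "finite_dimensional V \<longleftrightarrow> (\<exists>B. finite B \<and> module.span (smul V) B = vec V)"

definition rep_hom ::
  "('f::field, 'a::comm_ring_1) hopf \<Rightarrow> ('f, 'v::ab_group_add, 'a) comod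
    \<Rightarrow> ('f, 'w::ab_group_add, 'a) comod \<Rightarrow> ('v \<Rightarrow> 'w) \<Rightarrow> bool" where
  "rep_hom A V W f \<longleftrightarrow>
     Vector_Spaces.linear (smul V) (smul W) f \<and> f ` vec V \<subseteq> vec W \<and>
     (\<forall>v\<in>vec V. coact W (f v) = tmap (smul V) (fsmul A) (smul W) (fsmul A) f id (coact V v))"

definition invariants ::
  "('f::field, 'a::comm_ring_1) hopf \<Rightarrow> ('f, 'v::ab_group_add, 'a) comod \<Rightarrow> 'v set" where
  "invariants A V = {v \<in> vec V. coact V v = tens (smul V) (fsmul A) v 1}"

text \<open>Restriction along a homomorphism \<open>X \<rightarrow> Y\<close> with comorphism \<open>\<phi>\<close>.\<close>

definition restrict_rep ::
  "('f::field, 'x::comm_ring_1) hopf \<Rightarrow> ('f, 'y::comm_ring_1) hopf \<Rightarrow> ('y \<Rightarrow> 'x)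
    \<Rightarrow> ('f, 'v::ab_group_add, 'y) comod \<Rightarrow> ('f, 'v, 'x) comod" where
  "restrict_rep X Y \<phi> V =
     \<lparr> vec = vec V, smul = smul V,
       coact = (\<lambda>v. tmap (smul V) (fsmul Y) (smul V) (fsmul X) id \<phi> (coact V v)) \<rparr>"

text \<open>
  \<open>Rep\<close> is modelled by the finite-dimensional representations on subspaces of vector space structures
  on \<open>nat \<Rightarrow> 'f\<close>; up to isomorphism these are all finite-dimensional representations.
\<close>

definition Rep :: "('f::field, 'a::comm_ring_1) hopf \<Rightarrow> ('f, nat \<Rightarrow> 'f, 'a) comod set" where
  "Rep A = {V. representation A V \<and> finite_dimensional V}"

definition short_exact ::
  "('f::field, 'a::comm_ring_1) hopf \<Rightarrow> ('f, 'u::ab_group_add, 'a) comod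
    \<Rightarrow> ('f, 'v::ab_group_add, 'a) comod \<Rightarrow> ('f, 'w::ab_group_add, 'a) comod
    \<Rightarrow> ('u \<Rightarrow> 'v) \<Rightarrow> ('v \<Rightarrow> 'w) \<Rightarrow> bool" where
  "short_exact A U V W f g \<longleftrightarrow>
     rep_hom A U V f \<and> rep_hom A V W g \<and> inj_on f (vec U) \<and>
     f ` vec U = {v \<in> vec V. g v = 0} \<and> g ` vec V = vec W"

inductive iterated_extension_of_trivial ::
  "('f::field, 'a::comm_ring_1) hopf \<Rightarrow> ('f, nat \<Rightarrow> 'f, 'a) comod \<Rightarrow> bool"
  for A :: "('f, 'a) hopf" where
  trivial: "V \<in> Rep A \<Longrightarrow> invariants A V = vec V \<Longrightarrow> iterated_extension_of_trivial A V"
| extension: "V \<in> Rep A \<Longrightarrow> short_exact A U V W f g \<Longrightarrow> iterated_extension_of_trivial A U \<Longrightarrow>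
    iterated_extension_of_trivial A W \<Longrightarrow> iterated_extension_of_trivial A V"

definition pro_unipotent :: "('f::field, 'a::comm_ring_1) hopf \<Rightarrow> bool" where
  "pro_unipotent A \<longleftrightarrow> (\<forall>V\<in>Rep A. iterated_extension_of_trivial A V)"


section \<open>Derived functors of invariants\<close>

text \<open>
  Derived functors are computed in the category of all, possibly infinite-dimensional,
  representations from the functorial injective resolution
  \<open>0 \<rightarrow> V \<rightarrow> E V \<rightarrow> E (E V) \<rightarrow> E (E (E V)) \<rightarrow> \<dots>\<close>, where \<open>E V\<close> is the tensor product of the vector
  space \<open>V\<close> with the coordinate ring \<open>A\<close>, on which the group acts through the regular
  representation \<open>A\<close>, the first map is the coaction of \<open>V\<close>, and the differentials are the
  alternating sums of the coface maps.
  \<open>cofree_injective\<close> and \<open>resolution_exact\<close> below show that the \<open>E V\<close> are injective and that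
  the sequence is an exact sequence of representations. Only its terms up to \<open>E (E (E V))\<close> are
  needed for the derived functors of degree 0 and 1.
\<close>

definition cofree ::
  "('f::field, 'a::comm_ring_1) hopf \<Rightarrow> ('f, 'v::ab_group_add, 'a) comod
    \<Rightarrow> ('f, ('f, 'v, 'a) tensor, 'a) comod" where
  "cofree A V =
     \<lparr> vec = tensor_space (smul V) (fsmul A) (vec V) UNIV, smul = fscale,
       coact = tensor_comult A (smul V) \<rparr>"

definition res_d0 ::
  "('f::field, 'a::comm_ring_1) hopf \<Rightarrow> ('f, 'v::ab_group_add, 'a) comod
    \<Rightarrow> ('f, 'v, 'a) tensor \<Rightarrow> ('f, ('f, 'v, 'a) tensor, 'a) tensor" where
  "res_d0 A V t = coact (cofree A V) t - tmap (smul V) (fsmul A) fscale (fsmul A) (coact V) id t"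

definition res_d1 ::
  "('f::field, 'a::comm_ring_1) hopf \<Rightarrow> ('f, 'v::ab_group_add, 'a) comod
    \<Rightarrow> ('f, ('f, 'v, 'a) tensor, 'a) tensor
    \<Rightarrow> ('f, ('f, ('f, 'v, 'a) tensor, 'a) tensor, 'a) tensor" where
  "res_d1 A V t =
     coact (cofree A (cofree A V)) t
     - tmap fscale (fsmul A) fscale (fsmul A) (coact (cofree A V)) id t
     + tmap fscale (fsmul A) fscale (fsmul A)
         (tmap (smul V) (fsmul A) fscale (fsmul A) (coact V) id) id t"

definition R0_Gamma ::
  "('f::field, 'a::comm_ring_1) hopf \<Rightarrow> ('f, 'v::ab_group_add, 'a) comod
    \<Rightarrow> ('f, 'v, 'a) tensor set" where
  "R0_Gamma A V = {t \<in> invariants A (cofree A V). res_d0 A V t = 0}"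

definition coboundary_rel ::
  "('f::field, 'a::comm_ring_1) hopf \<Rightarrow> ('f, 'v::ab_group_add, 'a) comod
    \<Rightarrow> (('f, ('f, 'v, 'a) tensor, 'a) tensor \<times> ('f, ('f, 'v, 'a) tensor, 'a) tensor) set" where
  "coboundary_rel A V =
     {(x, y). x - y \<in> res_d0 A V ` invariants A (cofree A V)}"

definition R1_Gamma ::
  "('f::field, 'a::comm_ring_1) hopf \<Rightarrow> ('f, 'v::ab_group_add, 'a) comod
    \<Rightarrow> ('f, ('f, 'v, 'a) tensor, 'a) tensor set set" where
  "R1_Gamma A V =
     {t \<in> invariants A (cofree A (cofree A V)). res_d1 A V t = 0} // coboundary_rel A V"

text \<open>
  For a homomorphism \<open>X \<rightarrow> Y\<close> with comorphism \<open>\<phi>\<close> and a representation \<open>V\<close> of \<open>Y\<close>, the natural map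
  from \<open>R\<^sup>i\<Gamma>(Y, V)\<close> to \<open>R\<^sup>i\<Gamma>(X, V)\<close> is induced by the \<open>X\<close>-equivariant map from the resolution of
  \<open>V\<close> over \<open>Y\<close> to the one over \<open>X\<close> which applies \<open>\<phi>\<close> to every factor. It depends on \<open>V\<close> only
  through the scalar multiplication.
\<close>

definition res_map0 ::
  "('f::field, 'x::comm_ring_1) hopf \<Rightarrow> ('f, 'y::comm_ring_1) hopf \<Rightarrow> ('y \<Rightarrow> 'x)
    \<Rightarrow> ('f, 'v::ab_group_add, 'y) comod \<Rightarrow> ('f, 'v, 'y) tensor \<Rightarrow> ('f, 'v, 'x) tensor" where
  "res_map0 X Y \<phi> V = tmap (smul V) (fsmul Y) (smul V) (fsmul X) id \<phi>"

definition res_map1 ::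
  "('f::field, 'x::comm_ring_1) hopf \<Rightarrow> ('f, 'y::comm_ring_1) hopf \<Rightarrow> ('y \<Rightarrow> 'x)
    \<Rightarrow> ('f, 'v::ab_group_add, 'y) comod \<Rightarrow> ('f, ('f, 'v, 'y) tensor, 'y) tensor
    \<Rightarrow> ('f, ('f, 'v, 'x) tensor, 'x) tensor" where
  "res_map1 X Y \<phi> V = tmap fscale (fsmul Y) fscale (fsmul X) (res_map0 X Y \<phi> V) \<phi>"

definition R0_map ::
  "('f::field, 'x::comm_ring_1) hopf \<Rightarrow> ('f, 'y::comm_ring_1) hopf \<Rightarrow> ('y \<Rightarrow> 'x)
    \<Rightarrow> ('f, 'v::ab_group_add, 'y) comod \<Rightarrow> ('f, 'v, 'y) tensor \<Rightarrow> ('f, 'v, 'x) tensor" where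
  "R0_map X Y \<phi> V = res_map0 X Y \<phi> V"

definition R1_map ::
  "('f::field, 'x::comm_ring_1) hopf \<Rightarrow> ('f, 'y::comm_ring_1) hopf \<Rightarrow> ('y \<Rightarrow> 'x)
    \<Rightarrow> ('f, 'v::ab_group_add, 'y) comod \<Rightarrow> ('f, ('f, 'v, 'y) tensor, 'y) tensor set
    \<Rightarrow> ('f, ('f, 'v, 'x) tensor, 'x) tensor set" where
  "R1_map X Y \<phi> V c = coboundary_rel X (restrict_rep X Y \<phi> V) `` (res_map1 X Y \<phi> V ` c)"


section \<open>Injectivity and exactness of the resolution\<close>

lemma linear_vs:
  assumes "Vector_Spaces.linear s1 s2 f"
  shows "vector_space s1" "vector_space s2"
  using assms unfolding Vector_Spaces.linear_iff by auto

lemma linear_compose':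
  assumes "Vector_Spaces.linear s1 s2 f" "Vector_Spaces.linear s2 s3 g"
  shows "Vector_Spaces.linear s1 s3 (\<lambda>x. g (f x))"
  using Vector_Spaces.linear_compose[OF assms] by (simp add: comp_def)

lemma linear_id': "vector_space s \<Longrightarrow> Vector_Spaces.linear s s id"
  by (simp add: Vector_Spaces.linear_iff)

lemma
  assumes "vector_space sV" "vector_space sW"
  shows tens_add_left: "tens sV sW (u + v) w = tens sV sW u w + tens sV sW v w"
    and tens_scale_left: "tens sV sW (sV c v) w = fscale c (tens sV sW v w)"
  using tens_bilinear[OF assms] unfolding bilinear_map_def Vector_Spaces.linear_iff by blast+

lemma bilinear_compose:
  assumes "bilinear_map sX sY sU b" "Vector_Spaces.linear sV sX f" "Vector_Spaces.linear sW sY g"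
    "Vector_Spaces.linear sU sZ h"
  shows "bilinear_map sV sW sZ (\<lambda>v w. h (b (f v) (g w)))"
proof -
  have "Vector_Spaces.linear sX sU (\<lambda>v. b v w)" "Vector_Spaces.linear sY sU (b v)" for v w
    using assms(1) unfolding bilinear_map_def by auto
  thus ?thesis unfolding bilinear_map_def
    by (intro allI conjI linear_compose'[OF _ assms(4)] linear_compose'[OF assms(2)]
        linear_compose'[OF assms(3)])
qed

lemma
  assumes f: "Vector_Spaces.linear sV sX f" and g: "Vector_Spaces.linear sW sY g"
  shows tmap_linear: "Vector_Spaces.linear fscale fscale (tmap sV sW sX sY f g)"
    and tmap_tens: "tmap sV sW sX sY f g (tens sV sW v w) = tens sX sY (f v) (g w)"
proof -
  note vs = linear_vs[OF f] linear_vs[OF g]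
  have "bilinear_map sV sW fscale (\<lambda>v w. tens sX sY (f v) (g w))"
    by (rule bilinear_compose[OF tens_bilinear f g linear_id'[OF vector_space_fscale], simplified])
      (use vs in auto)
  note * = vs(1) vs(3) vector_space_fscale this
  show "Vector_Spaces.linear fscale fscale (tmap sV sW sX sY f g)"
    "tmap sV sW sX sY f g (tens sV sW v w) = tens sX sY (f v) (g w)"
    unfolding tmap_def by (rule tlift_linear[OF *] tlift_tens[OF *])+
qed

lemma tensor_space_map:
  assumes "Vector_Spaces.linear fscale sU f" "module.subspace sU S"
    "\<And>v w. v \<in> V \<Longrightarrow> w \<in> W \<Longrightarrow> f (tens sV sW v w) \<in> S" "t \<in> tensor_space sV sW V W"
  shows "f t \<in> S"
proof -
  interpret f: Vector_Spaces.linear fscale sU f by fact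
  have "f ` tensor_space sV sW V W \<subseteq> S"
    unfolding tensor_space_def f.span_image[symmetric]
    by (rule f.vs2.span_minimal) (use assms in auto)
  with assms(4) show ?thesis by blast
qed

lemma subspace_tensor_space: "fs.subspace (tensor_space sV sW V W)"
  unfolding tensor_space_def by (rule fs.subspace_span)

lemma tensor_space_mono: "V \<subseteq> V' \<Longrightarrow> tensor_space sV sW V W \<subseteq> tensor_space sV sW V' W"
  unfolding tensor_space_def by (rule fs.span_mono) auto

lemma tmap_in:
  assumes "Vector_Spaces.linear sV sX f" "Vector_Spaces.linear sW sY g"
    "\<And>v. v \<in> V \<Longrightarrow> f v \<in> X" "\<And>w. w \<in> W \<Longrightarrow> g w \<in> Y" "t \<in> tensor_space sV sW V W"
  shows "tmap sV sW sX sY f g t \<in> tensor_space sX sY X Y"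
  by (rule tensor_space_map[OF tmap_linear[OF assms(1,2)] subspace_tensor_space _ assms(5)])
    (auto simp: tmap_tens[OF assms(1,2)] intro: tens_in assms)

lemma tmap_tmap:
  assumes "Vector_Spaces.linear sV sX f" "Vector_Spaces.linear sW sY g"
    "Vector_Spaces.linear sX sX' f'" "Vector_Spaces.linear sY sY' g'"
    "t \<in> tensor_space sV sW V W"
  shows "tmap sX sY sX' sY' f' g' (tmap sV sW sX sY f g t) =
    tmap sV sW sX' sY' (\<lambda>x. f' (f x)) (\<lambda>x. g' (g x)) t"
  by (rule tensor_eqI[OF linear_compose'[OF tmap_linear[OF assms(1,2)] tmap_linear[OF assms(3,4)]]
        tmap_linear[OF linear_compose'[OF assms(1,3)] linear_compose'[OF assms(2,4)]] _ assms(5)])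
    (simp add: tmap_tens[OF assms(1,2)] tmap_tens[OF assms(3,4)]
      tmap_tens[OF linear_compose'[OF assms(1,3)] linear_compose'[OF assms(2,4)]])

lemma tmap_cong:
  assumes "Vector_Spaces.linear sV sX f" "Vector_Spaces.linear sV sX f'"
    "Vector_Spaces.linear sW sY g"
    "\<And>v. v \<in> V \<Longrightarrow> f v = f' v" "t \<in> tensor_space sV sW V W"
  shows "tmap sV sW sX sY f g t = tmap sV sW sX sY f' g t"
  by (rule tensor_eqI[OF tmap_linear[OF assms(1,3)] tmap_linear[OF assms(2,3)] _ assms(5)])
    (simp add: tmap_tens[OF assms(1,3)] tmap_tens[OF assms(2,3)] assms(4))

lemma tmap_id:
  assumes "vector_space sV" "vector_space sW" "t \<in> tensor_space sV sW V W"
  shows "tmap sV sW sV sW id id t = t"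
  using tensor_eqI[OF tmap_linear[OF linear_id'[OF assms(1)] linear_id'[OF assms(2)]]
      linear_id'[OF vector_space_fscale] _ assms(3)]
  by (simp add: tmap_tens[OF linear_id'[OF assms(1)] linear_id'[OF assms(2)]])

context affine_group
begin

abbreviation "sA \<equiv> fsmul A"
abbreviation "C \<equiv> tensor_comult A"
abbreviation "h \<equiv> tensor_counit A"
abbreviation "E sV V \<equiv> tensor_space sV sA V UNIV"
abbreviation "T sV sX f \<equiv> tmap sV sA sX sA f id"

lemmas linear_idA = linear_id'[OF vector_space_A]

lemma linear_tens1: "vector_space sV \<Longrightarrow> Vector_Spaces.linear sA fscale (tens sV sA v)"
  using tens_bilinear[OF _ vector_space_A] unfolding bilinear_map_def by blast

lemma
  assumes V: "vector_space sV"
  shows C_linear: "Vector_Spaces.linear fscale fscale (C sV)"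
    and C_tens: "C sV (tens sV sA v a) = T sA fscale (tens sV sA v) (comult A a)"
proof -
  have lin: "Vector_Spaces.linear sA fscale (\<lambda>a. T sA fscale (tens sV sA v) (comult A a))" for v
    by (rule linear_compose'[OF comult_linear tmap_linear[OF linear_tens1[OF V] linear_idA]])
  have key: "T sA fscale (tens sV sA (u + v)) t = T sA fscale (tens sV sA u) t + T sA fscale (tens sV sA v) t"
    "T sA fscale (tens sV sA (sV c v)) t = fscale c (T sA fscale (tens sV sA v) t)"
    if t: "t \<in> tensor_space sA sA UNIV UNIV" for u v c t
  proof -
    note L = tmap_linear[OF linear_tens1[OF V] linear_idA]
    note M = tmap_tens[OF linear_tens1[OF V] linear_idA]
    interpret VP: vector_space_pair fscale fscale by (intro vector_space_pair.intro vector_space_fscale)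
    note b1 = tens_add_left[OF V vector_space_A] tens_scale_left[OF V vector_space_A]
    note b2 = tens_add_left[OF vector_space_fscale vector_space_A]
      tens_scale_left[OF vector_space_fscale vector_space_A]
    show "T sA fscale (tens sV sA (u + v)) t = T sA fscale (tens sV sA u) t + T sA fscale (tens sV sA v) t"
      by (rule tensor_eqI[OF L VP.linear_compose_add[OF L L] _ t]) (unfold M id_apply b1 b2, rule refl)
    show "T sA fscale (tens sV sA (sV c v)) t = fscale c (T sA fscale (tens sV sA v) t)"
      by (rule tensor_eqI[OF L VP.module_hom_scale[OF L] _ t]) (unfold M id_apply b1 b2, rule refl)
  qed
  have "bilinear_map sV sA fscale (\<lambda>v a. T sA fscale (tens sV sA v) (comult A a))"
    unfolding bilinear_map_def using lin key comult_in V vector_space_fscale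
    by (simp add: Vector_Spaces.linear_iff)
  note * = V vector_space_A vector_space_fscale this
  have eq: "C sV = tlift sV sA fscale (\<lambda>v a. T sA fscale (tens sV sA v) (comult A a))"
    unfolding tensor_comult_def tmap_def by simp
  show "Vector_Spaces.linear fscale fscale (C sV)"
    "C sV (tens sV sA v a) = T sA fscale (tens sV sA v) (comult A a)"
    unfolding eq by (rule tlift_linear[OF *] tlift_tens[OF *])+
qed

lemma
  assumes V: "vector_space sV"
  shows h_linear: "Vector_Spaces.linear fscale sV (h sV)"
    and h_tens: "h sV (tens sV sA v a) = sV (counit A a) v"
proof -
  interpret e: Vector_Spaces.linear sA "(*)" "counit A" by (rule counit_linear)
  interpret V: vector_space sV by fact
  have "bilinear_map sV sA sV (\<lambda>v a. sV (counit A a) v)"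
    using V vector_space_A unfolding bilinear_map_def Vector_Spaces.linear_iff
    by (auto simp: e.add e.scale V.scale_left_distrib V.scale_right_distrib mult.commute)
  note * = V vector_space_A V this
  show "Vector_Spaces.linear fscale sV (h sV)" "h sV (tens sV sA v a) = sV (counit A a) v"
    unfolding tensor_counit_def by (rule tlift_linear[OF *] tlift_tens[OF *])+
qed

lemma T_linear: "Vector_Spaces.linear sV sW f \<Longrightarrow> Vector_Spaces.linear fscale fscale (T sV sW f)"
  by (rule tmap_linear[OF _ linear_idA])

lemma T_tens: "Vector_Spaces.linear sV sW f \<Longrightarrow> T sV sW f (tens sV sA v a) = tens sW sA (f v) a"
  by (simp add: tmap_tens[OF _ linear_idA])

lemma T_T:
  assumes "Vector_Spaces.linear sV sW f" "Vector_Spaces.linear sW sX g" "t \<in> E sV V"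
  shows "T sW sX g (T sV sW f t) = T sV sX (\<lambda>x. g (f x)) t"
  using tmap_tmap[OF assms(1) linear_idA assms(2) linear_idA assms(3)] by (simp add: id_def)

lemma T_in:
  "\<lbrakk>Vector_Spaces.linear sV sW f; \<And>v. v \<in> V \<Longrightarrow> f v \<in> W; t \<in> E sV V\<rbrakk> \<Longrightarrow> T sV sW f t \<in> E sW W"
  by (rule tmap_in[OF _ linear_idA]) auto

lemmas fscale_vs = vector_space_fscale

lemma C_in:
  assumes V: "vector_space sV" and t: "t \<in> E sV V"
  shows "C sV t \<in> E fscale (E sV V)"
  by (rule tensor_space_map[OF C_linear[OF V] subspace_tensor_space _ t])
    (auto simp: C_tens[OF V] intro!: T_in[OF linear_tens1[OF V] _ comult_in] tens_in)

lemma h_in: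
  assumes V: "vector_space sV" "module.subspace sV V" and t: "t \<in> E sV V"
  shows "h sV t \<in> V"
proof -
  interpret V: vector_space sV by (rule V)
  show ?thesis
    by (rule tensor_space_map[OF h_linear[OF V(1)] V(2) _ t])
      (auto simp: h_tens[OF V(1)] intro: V.subspace_scale V(2))
qed

lemma C_T:
  assumes f: "Vector_Spaces.linear sV sW f" and t: "t \<in> E sV V"
  shows "C sW (T sV sW f t) = T fscale fscale (T sV sW f) (C sV t)"
proof (rule tensor_eqI[OF _ _ _ t])
  note vs = linear_vs[OF f]
  show "Vector_Spaces.linear fscale fscale (\<lambda>t. C sW (T sV sW f t))"
    by (rule linear_compose'[OF T_linear[OF f] C_linear[OF vs(2)]])
  show "Vector_Spaces.linear fscale fscale (\<lambda>t. T fscale fscale (T sV sW f) (C sV t))"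
    by (rule linear_compose'[OF C_linear[OF vs(1)] T_linear[OF T_linear[OF f]]])
  show "C sW (T sV sW f (tens sV sA v a)) = T fscale fscale (T sV sW f) (C sV (tens sV sA v a))" for v a
    unfolding C_tens[OF vs(1)] T_tens[OF f] C_tens[OF vs(2)]
      T_T[OF linear_tens1[OF vs(1)] T_linear[OF f] comult_in] ..
qed

lemma C_C:
  assumes V: "vector_space sV" and t: "t \<in> E sV V"
  shows "T fscale fscale (C sV) (C sV t) = C fscale (C sV t)"
proof (rule tensor_eqI[where f = "\<lambda>t. T fscale fscale (C sV) (C sV t)" and
      g = "\<lambda>t. C fscale (C sV t)" and sU = fscale, OF _ _ _ t])
  note l = linear_tens1[OF V] and CV = C_linear[OF V]
  show "Vector_Spaces.linear fscale fscale (\<lambda>t. T fscale fscale (C sV) (C sV t))"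
    by (rule linear_compose'[OF CV T_linear[OF CV]])
  show "Vector_Spaces.linear fscale fscale (\<lambda>t. C fscale (C sV t))"
    by (rule linear_compose'[OF CV C_linear[OF fscale_vs]])
  fix v a
  have "T fscale fscale (C sV) (C sV (tens sV sA v a)) =
      T sA fscale (\<lambda>x. T sA fscale (tens sV sA v) (comult A x)) (comult A a)"
    unfolding C_tens[OF V] T_T[OF l CV comult_in] ..
  also have "\<dots> = T fscale fscale (T sA fscale (tens sV sA v)) (T sA fscale (comult A) (comult A a))"
    by (rule T_T[OF comult_linear T_linear[OF l] comult_in, symmetric])
  also have "\<dots> = C fscale (T sA fscale (tens sV sA v) (comult A a))"
    unfolding coassoc by (rule C_T[OF l comult_in, symmetric])
  finally show "T fscale fscale (C sV) (C sV (tens sV sA v a)) = C fscale (C sV (tens sV sA v a))"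
    unfolding C_tens[OF V] .
qed

lemma h_T:
  assumes f: "Vector_Spaces.linear sV sW f" and t: "t \<in> E sV V"
  shows "h sW (T sV sW f t) = f (h sV t)"
proof (rule tensor_eqI[OF _ _ _ t])
  note vs = linear_vs[OF f]
  interpret f: Vector_Spaces.linear sV sW f by fact
  show "Vector_Spaces.linear fscale sW (\<lambda>t. h sW (T sV sW f t))"
    by (rule linear_compose'[OF T_linear[OF f] h_linear[OF vs(2)]])
  show "Vector_Spaces.linear fscale sW (\<lambda>t. f (h sV t))"
    by (rule linear_compose'[OF h_linear[OF vs(1)] f])
  show "h sW (T sV sW f (tens sV sA v a)) = f (h sV (tens sV sA v a))" for v a
    unfolding T_tens[OF f] h_tens[OF vs(1)] h_tens[OF vs(2)] f.scale ..
qed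

lemma h_C:
  assumes V: "vector_space sV" and t: "t \<in> E sV V"
  shows "h fscale (C sV t) = t"
proof -
  have "h fscale (C sV t) = id t"
  proof (rule tensor_eqI[OF _ linear_id'[OF fscale_vs] _ t])
    show "Vector_Spaces.linear fscale fscale (\<lambda>t. h fscale (C sV t))"
      by (rule linear_compose'[OF C_linear[OF V] h_linear[OF fscale_vs]])
    show "h fscale (C sV (tens sV sA v a)) = id (tens sV sA v a)" for v a
      unfolding C_tens[OF V] h_T[OF linear_tens1[OF V] comult_in] counit_right by simp
  qed
  thus ?thesis by simp
qed

lemma T_h_C:
  assumes V: "vector_space sV" and t: "t \<in> E sV V"
  shows "T fscale sV (h sV) (C sV t) = t"
proof -
  interpret A: vector_space sA by (rule vector_space_A)
  interpret e: Vector_Spaces.linear sA "(*)" "counit A" by (rule counit_linear)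
  interpret V: vector_space sV by fact
  have "T fscale sV (h sV) (C sV t) = id t"
  proof (rule tensor_eqI[OF _ linear_id'[OF fscale_vs] _ t])
    show "Vector_Spaces.linear fscale fscale (\<lambda>t. T fscale sV (h sV) (C sV t))"
      by (rule linear_compose'[OF C_linear[OF V] T_linear[OF h_linear[OF V]]])
    fix v a
    let ?e = "\<lambda>x. sV (counit A x) v"
    have e: "Vector_Spaces.linear sA sV ?e"
      using V vector_space_A unfolding Vector_Spaces.linear_iff
      by (auto simp: e.add e.scale V.scale_left_distrib)
    have "bilinear_map sA sA sA (\<lambda>x y. sA (counit A x) y)"
      using vector_space_A unfolding bilinear_map_def Vector_Spaces.linear_iff
      by (auto simp: e.add e.scale A.scale_left_distrib A.scale_right_distrib mult.commute)
    note b = vector_space_A vector_space_A vector_space_A this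
    have tr: "tens sV sA v (sA c y) = fscale c (tens sV sA v y)" for c y
      using linear_tens1[OF V] unfolding Vector_Spaces.linear_iff by blast
    have "T sA sV ?e (comult A a) =
        tens sV sA v (tlift sA sA sA (\<lambda>x y. sA (counit A x) y) (comult A a))"
      by (rule tensor_eqI[OF T_linear[OF e] linear_compose'[OF tlift_linear[OF b] linear_tens1[OF V]]
            _ comult_in])
        (unfold T_tens[OF e] tlift_tens[OF b] tr tens_scale_left[OF V vector_space_A], rule refl)
    thus "T fscale sV (h sV) (C sV (tens sV sA v a)) = id (tens sV sA v a)"
      unfolding C_tens[OF V] T_T[OF linear_tens1[OF V] h_linear[OF V] comult_in] h_tens[OF V]
        counit_left by simp
  qed
  thus ?thesis by simp
qed

lemma cofree_simps:
  "vec (cofree A V) = E (smul V) (vec V)" "smul (cofree A V) = fscale"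
  "coact (cofree A V) = C (smul V)"
  by (simp_all add: cofree_def)

lemma representation_cofree:
  assumes "vector_space (smul V)"
  shows "representation A (cofree A V)"
  by (intro representation.intro representation_axioms.intro affine_group_axioms;
      unfold cofree_simps, fact fscale_vs subspace_tensor_space C_linear[OF assms] C_in[OF assms]
    C_C[OF assms] h_C[OF assms])

lemma cofree_map_hom:
  assumes "Vector_Spaces.linear (smul V) (smul W) f" "f ` vec V \<subseteq> vec W"
  shows "rep_hom A (cofree A V) (cofree A W) (T (smul V) (smul W) f)"
  unfolding rep_hom_def cofree_simps
  using assms(2) T_linear[OF assms(1)] C_T[OF assms(1), where V = "vec V"]
  by (auto intro!: T_in[OF assms(1), where V = "vec V"])

lemma rep_hom_add_diff:
  assumes V: "representation A V" and W: "representation A W"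
    and f: "rep_hom A V W f" and g: "rep_hom A V W g"
  shows rep_hom_add: "rep_hom A V W (\<lambda>x. f x + g x)"
    and rep_hom_diff: "rep_hom A V W (\<lambda>x. f x - g x)"
proof -
  interpret V: representation A V by fact
  interpret W: representation A W by fact
  interpret VW: vector_space_pair "smul V" "smul W"
    by (intro vector_space_pair.intro V.vector_space_V W.vector_space_V)
  interpret FF: vector_space_pair fscale fscale by (intro vector_space_pair.intro fscale_vs)
  interpret c: Vector_Spaces.linear "smul W" fscale "coact W" by (rule W.coact_linear)
  have lf: "Vector_Spaces.linear (smul V) (smul W) f" and lg: "Vector_Spaces.linear (smul V) (smul W) g"
    using f g unfolding rep_hom_def by auto
  note la = VW.linear_compose_add[OF lf lg] and ld = VW.linear_compose_sub[OF lf lg]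
  have l2: "Vector_Spaces.linear (smul W) fscale (\<lambda>w. tens (smul W) sA w a)" for a
    using tens_bilinear[OF W.vector_space_V vector_space_A] unfolding bilinear_map_def by blast
  have tens_diff: "tens (smul W) sA (x - y) a = tens (smul W) sA x a - tens (smul W) sA y a" for x y a
    by (rule module_hom.diff[OF module_hom_linearI[OF l2]])
  have a: "T (smul V) (smul W) (\<lambda>x. f x + g x) t = T (smul V) (smul W) f t + T (smul V) (smul W) g t"
    if "t \<in> E (smul V) (vec V)" for t
    by (rule tensor_eqI[OF T_linear[OF la] FF.linear_compose_add[OF T_linear[OF lf] T_linear[OF lg]] _ that])
      (unfold T_tens[OF la] T_tens[OF lf] T_tens[OF lg]
        tens_add_left[OF W.vector_space_V vector_space_A], rule refl)
  have d: "T (smul V) (smul W) (\<lambda>x. f x - g x) t = T (smul V) (smul W) f t - T (smul V) (smul W) g t"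
    if "t \<in> E (smul V) (vec V)" for t
    by (rule tensor_eqI[OF T_linear[OF ld] FF.linear_compose_sub[OF T_linear[OF lf] T_linear[OF lg]] _ that])
      (unfold T_tens[OF ld] T_tens[OF lf] T_tens[OF lg] tens_diff, rule refl)
  have inW: "f v \<in> vec W" "g v \<in> vec W" if "v \<in> vec V" for v
    using f g that unfolding rep_hom_def by auto
  have eq: "coact W (f v) = T (smul V) (smul W) f (coact V v)"
    "coact W (g v) = T (smul V) (smul W) g (coact V v)" if "v \<in> vec V" for v
    using f g that unfolding rep_hom_def by auto
  show "rep_hom A V W (\<lambda>x. f x + g x)" unfolding rep_hom_def
    using la inW eq a[OF V.coact_in]
    by (auto simp: c.add intro!: VW.vs2.subspace_add[OF W.subspace_vec])
  show "rep_hom A V W (\<lambda>x. f x - g x)" unfolding rep_hom_def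
    using ld inW eq d[OF V.coact_in]
    by (auto simp: c.diff intro!: VW.vs2.subspace_diff[OF W.subspace_vec])
qed

end

text \<open>
  The representations \<open>cofree A V\<close> are injective. The types of the test objects \<open>W\<close> and \<open>X\<close> are
  arbitrary.
\<close>

theorem cofree_injective:
  fixes A :: "('f::field, 'a::comm_ring_1) hopf"
    and V :: "('f, 'v::ab_group_add, 'a) comod"
    and W :: "('f, 'w::ab_group_add, 'a) comod" and X :: "('f, 'x::ab_group_add, 'a) comod"
  assumes V: "representation A V" and W: "representation A W" and X: "representation A X"
    and j: "rep_hom A W X j" "inj_on j (vec W)"
    and f: "rep_hom A W (cofree A V) f"
  shows "\<exists>g. rep_hom A X (cofree A V) g \<and> (\<forall>w\<in>vec W. g (j w) = f w)"
proof -
  interpret V: representation A V by fact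
  interpret W: representation A W by fact
  interpret X: representation A X by fact
  interpret WX: vector_space_pair "smul W" "smul X"
    by (intro vector_space_pair.intro W.vector_space_V X.vector_space_V)
  note jl = j(1)[unfolded rep_hom_def, THEN conjunct1]
  note jc = j(1)[unfolded rep_hom_def, THEN conjunct2, THEN conjunct2, THEN bspec]
  note f' = f[unfolded rep_hom_def V.cofree_simps]
  note fl = f'[THEN conjunct1] and fin = f'[THEN conjunct2, THEN conjunct1]
    and fc = f'[THEN conjunct2, THEN conjunct2, THEN bspec]
  obtain r where r: "range r \<subseteq> vec W" "Vector_Spaces.linear (smul X) (smul W) r"
    "\<And>w. w \<in> vec W \<Longrightarrow> r (j w) = w"
    using WX.linear_exists_left_inverse_on[OF jl W.subspace_vec j(2)] by blast
  define f0 where "f0 w = V.h (smul V) (f w)" for w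
  have f0: "Vector_Spaces.linear (smul W) (smul V) f0"
    unfolding f0_def by (rule linear_compose'[OF fl V.h_linear[OF V.vector_space_V]])
  have f0_in: "f0 w \<in> vec V" if "w \<in> vec W" for w
    unfolding f0_def by (rule V.h_in[OF V.vector_space_V V.subspace_vec subsetD[OF fin imageI[OF that]]])
  define u where "u x = f0 (r x)" for x
  have u: "Vector_Spaces.linear (smul X) (smul V) u"
    unfolding u_def by (rule linear_compose'[OF r(2) f0])
  have u_in: "u x \<in> vec V" for x unfolding u_def by (rule f0_in[OF subsetD[OF r(1) rangeI]])
  define g where "g x = V.T (smul X) (smul V) u (coact X x)" for x
  have g: "Vector_Spaces.linear (smul X) fscale g"
    unfolding g_def by (rule linear_compose'[OF X.coact_linear V.T_linear[OF u]])
  have "rep_hom A X (cofree A V) g"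
    unfolding rep_hom_def V.cofree_simps
  proof (intro conjI ballI g)
    show "g ` vec X \<subseteq> V.E (smul V) (vec V)"
      unfolding g_def by (rule image_subsetI) (rule V.T_in[OF u u_in X.coact_in])
    fix x assume x: "x \<in> vec X"
    have "V.C (smul V) (g x) =
        V.T fscale fscale (V.T (smul X) (smul V) u) (V.T (smul X) fscale (coact X) (coact X x))"
      unfolding g_def V.C_T[OF u X.coact_in[OF x]] X.coact_coassoc[OF x] ..
    also have "\<dots> = V.T (smul X) fscale g (coact X x)"
      unfolding V.T_T[OF X.coact_linear V.T_linear[OF u] X.coact_in[OF x]] g_def ..
    finally show "V.C (smul V) (g x) = V.T (smul X) fscale g (coact X x)" .
  qed
  moreover have "g (j w) = f w" if w: "w \<in> vec W" for w
  proof -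
    note jw = jc[OF w] and fw = subsetD[OF fin imageI[OF w]]
    have "g (j w) = V.T (smul W) (smul V) (\<lambda>x. u (j x)) (coact W w)"
      unfolding g_def jw by (rule V.T_T[OF jl u W.coact_in[OF w]])
    also have "\<dots> = V.T (smul W) (smul V) f0 (coact W w)"
      by (rule tmap_cong[OF linear_compose'[OF jl u] f0 V.linear_idA _ W.coact_in[OF w]])
        (simp add: u_def r(3))
    also have "\<dots> = V.T fscale (smul V) (V.h (smul V)) (V.T (smul W) fscale f (coact W w))"
      unfolding f0_def
      by (rule V.T_T[OF fl V.h_linear[OF V.vector_space_V] W.coact_in[OF w], symmetric])
    also have "\<dots> = f w" unfolding fc[OF w, symmetric] by (rule V.T_h_C[OF V.vector_space_V fw])
    finally show ?thesis .
  qed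
  ultimately show ?thesis by blast
qed

theorem resolution_exact:
  assumes V: "representation A V"
  shows "rep_hom A V (cofree A V) (coact V)" "inj_on (coact V) (vec V)"
    and "rep_hom A (cofree A V) (cofree A (cofree A V)) (res_d0 A V)"
    and "{t \<in> vec (cofree A V). res_d0 A V t = 0} = coact V ` vec V"
    and "rep_hom A (cofree A (cofree A V)) (cofree A (cofree A (cofree A V))) (res_d1 A V)"
    and "{t \<in> vec (cofree A (cofree A V)). res_d1 A V t = 0} = res_d0 A V ` vec (cofree A V)"
proof -
  interpret representation A V by fact
  note sV = vector_space_V
  let ?s = "smul V" and ?E1 = "E (smul V) (vec V)" and ?r = "coact V"
  let ?E2 = "E fscale ?E1"
  note cf = cofree_simps
  have r1: "representation A (cofree A V)" by (rule representation_cofree[OF sV])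
  have r2: "representation A (cofree A (cofree A V))"
    by (rule representation_cofree) (simp add: cf fscale_vs)
  have r3: "representation A (cofree A (cofree A (cofree A V)))"
    by (rule representation_cofree) (simp add: cf fscale_vs)
  have ch: "rep_hom A W (cofree A W) (coact W)" if "representation A W"
    for W :: "('a, 'x::ab_group_add, 'b) comod"
  proof -
    interpret W: representation A W by fact
    show ?thesis unfolding rep_hom_def cf
      by (intro conjI ballI image_subsetI W.coact_linear W.coact_in W.coact_coassoc[symmetric])
  qed
  show "rep_hom A V (cofree A V) ?r" by (rule ch[OF V])
  show "inj_on ?r (vec V)" by (rule inj_on_inverseI[of _ "h ?s"]) (rule coact_counit)
  note c = coact_linear and Tc = T_linear[OF coact_linear]
  have m1: "rep_hom A (cofree A V) (cofree A (cofree A V)) (T ?s fscale ?r)"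
    using cofree_map_hom[of V "cofree A V" ?r] c coact_in by (auto simp: cf)
  have d0: "res_d0 A V = (\<lambda>t. C ?s t - T ?s fscale ?r t)"
    unfolding res_d0_def fun_eq_iff cf by blast
  have d1: "res_d1 A V = (\<lambda>t. C fscale t - T fscale fscale (C ?s) t + T fscale fscale (T ?s fscale ?r) t)"
    unfolding res_d1_def fun_eq_iff cf by blast
  show hd0: "rep_hom A (cofree A V) (cofree A (cofree A V)) (res_d0 A V)"
    unfolding d0 using rep_hom_diff[OF r1 r2 ch[OF r1] m1] by (simp add: cf)
  have m2: "rep_hom A (cofree A (cofree A V)) (cofree A (cofree A (cofree A V))) (T fscale fscale (C ?s))"
    using cofree_map_hom[of "cofree A V" "cofree A (cofree A V)" "C ?s"] C_linear[OF sV] C_in[OF sV]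
    by (auto simp: cf)
  have m3: "rep_hom A (cofree A (cofree A V)) (cofree A (cofree A (cofree A V)))
      (T fscale fscale (T ?s fscale ?r))"
    using cofree_map_hom[of "cofree A V" "cofree A (cofree A V)" "T ?s fscale ?r"] Tc T_in[OF c coact_in]
    by (auto simp: cf)
  show hd1: "rep_hom A (cofree A (cofree A V)) (cofree A (cofree A (cofree A V))) (res_d1 A V)"
    unfolding d1 using rep_hom_add[OF r2 r3 rep_hom_diff[OF r2 r3 ch[OF r2] m2] m3] by (simp add: cf)
  show "{t \<in> vec (cofree A V). res_d0 A V t = 0} = ?r ` vec V"
  proof safe
    fix t assume t: "t \<in> vec (cofree A V)" "res_d0 A V t = 0"
    have t': "t \<in> ?E1" using t(1) by (simp only: cf)
    have "C ?s t = T ?s fscale ?r t" using t(2) unfolding d0 right_minus_eq .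
    hence "t = ?r (h ?s t)" using h_C[OF sV t'] h_T[OF c t'] by metis
    thus "t \<in> ?r ` vec V" using h_in[OF sV subspace_vec t'] by blast
  next
    fix v assume v: "v \<in> vec V"
    show "?r v \<in> vec (cofree A V)" unfolding cf by (rule coact_in[OF v])
    show "res_d0 A V (?r v) = 0" unfolding d0 coact_coassoc[OF v] by (rule diff_self)
  qed
  show "{t \<in> vec (cofree A (cofree A V)). res_d1 A V t = 0} = res_d0 A V ` vec (cofree A V)"
  proof safe
    fix t assume t: "t \<in> vec (cofree A (cofree A V))" "res_d1 A V t = 0"
    have t': "t \<in> ?E2" using t(1) by (simp only: cf)
    interpret h: Vector_Spaces.linear fscale fscale "h fscale :: _ \<Rightarrow> ('a, ('a, 'c, 'b) tensor, 'b) tensor"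
      by (rule h_linear[OF fscale_vs])
    have "h fscale (C fscale t) - h fscale (T fscale fscale (C ?s) t)
        + h fscale (T fscale fscale (T ?s fscale ?r) t) = 0"
      using arg_cong[OF t(2)[unfolded d1], of "h fscale"] unfolding h.add h.diff h.zero .
    hence "t - C ?s (h fscale t) + T ?s fscale ?r (h fscale t) = 0"
      unfolding h_C[OF fscale_vs t'] h_T[OF C_linear[OF sV] t'] h_T[OF Tc t'] .
    moreover have "x - y + z = 0 \<Longrightarrow> x = y - z" for x y z :: "'q::ab_group_add"
      by (simp add: eq_diff_eq diff_add_eq)
    ultimately have "t = res_d0 A V (h fscale t)" unfolding d0 by blast
    moreover have "h fscale t \<in> vec (cofree A V)"
      unfolding cf by (rule h_in[OF fscale_vs subspace_tensor_space t'])
    ultimately show "t \<in> res_d0 A V ` vec (cofree A V)" by blast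
  next
    fix t assume t: "t \<in> vec (cofree A V)"
    have t': "t \<in> ?E1" using t by (simp only: cf)
    show "res_d0 A V t \<in> vec (cofree A (cofree A V))" using hd0 t unfolding rep_hom_def by blast
    interpret c1: Vector_Spaces.linear fscale fscale "C fscale :: ('a, ('a, 'c, 'b) tensor, 'b) tensor \<Rightarrow> _"
      by (rule C_linear[OF fscale_vs])
    interpret c2: Vector_Spaces.linear fscale fscale "T fscale fscale (C ?s)"
      by (rule T_linear[OF C_linear[OF sV]])
    interpret c3: Vector_Spaces.linear fscale fscale "T fscale fscale (T ?s fscale ?r)"
      by (rule T_linear[OF Tc])
    have 1: "T fscale fscale (C ?s) (C ?s t) = C fscale (C ?s t)" by (rule C_C[OF sV t'])
    have 2: "C fscale (T ?s fscale ?r t) = T fscale fscale (T ?s fscale ?r) (C ?s t)"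
      by (rule C_T[OF c t'])
    have "T fscale fscale (C ?s) (T ?s fscale ?r t) = T ?s fscale (\<lambda>x. C ?s (?r x)) t"
      by (rule T_T[OF c C_linear[OF sV] t'])
    also have "\<dots> = T ?s fscale (\<lambda>x. T ?s fscale ?r (?r x)) t"
      by (rule tmap_cong[OF linear_compose'[OF c C_linear[OF sV]] linear_compose'[OF c Tc] linear_idA _ t'])
        (rule coact_coassoc[symmetric])
    also have "\<dots> = T fscale fscale (T ?s fscale ?r) (T ?s fscale ?r t)"
      by (rule T_T[OF c Tc t', symmetric])
    finally have 3: "T fscale fscale (C ?s) (T ?s fscale ?r t) =
      T fscale fscale (T ?s fscale ?r) (T ?s fscale ?r t)" .
    have g: "x - y - (x - z) + (y - z) = 0" for x y z :: "'q::ab_group_add" by simp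
    show "res_d1 A V (res_d0 A V t) = 0"
      unfolding d0 d1 c1.diff c2.diff c3.diff 1 2 3 by (rule g)
  qed
qed

end

theory Submission
  imports Defs
begin

text \<open>
  The functions on \<open>G\<close> which are invariant under left translation by \<open>H\<close> form a representation
  of \<open>G\<close> which restricts to the regular representation \<open>O(K)\<close> of \<open>K\<close>, and it is the union of its
  finite-dimensional subrepresentations. Hence the hypotheses give \<open>O(K)\<^sup>P = O(K)\<^sup>K = F\<close> and
  \<open>H\<^sup>1(P, O(K)) = H\<^sup>1(K, O(K)) = 0\<close>. The kernel \<open>N\<close> of the comorphism \<open>\<phi> : O(K) \<rightarrow> O(P)\<close> satisfies
  \<open>N\<^sup>P = N \<inter> F = 0\<close>, so \<open>N = 0\<close> because \<open>P\<close> is pro-unipotent. For the cokernel \<open>Q\<close>, the sequence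
  \<open>O(K)\<^sup>P = O(P)\<^sup>P \<rightarrow> Q\<^sup>P \<rightarrow> H\<^sup>1(P, O(K)) = 0\<close> gives \<open>Q\<^sup>P = 0\<close>, so \<open>Q = 0\<close> as well.
\<close>

section \<open>Slices of tensors\<close>

text \<open>The hypotheses speak only of finite-dimensional representations of \<open>G\<close>,
  whereas \<open>O(K)\<close> is in general infinite-dimensional, and as a representation of
  \<open>K\<close> alone it would be out of their reach. The semidirect structure bridges this:
  \<open>K\<close> is the space of cosets of \<open>H\<close> in \<open>G\<close>, so
  \<open>G\<close> acts on its functions. No limit of cohomology groups is formed. A single
  invariant or 1-cocycle involves only finitely many functions, hence lives in one
  finite-dimensional piece, where the hypothesis applies; the result is then pushed forward into
  \<open>O(K)\<close>. The vanishing of the first cohomology of \<open>K\<close> in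
  \<open>O(K)\<close> is made explicit by contracting a cocycle with the counit. Pro-unipotence is
  used in the form that a representation without nonzero invariants is zero. The cokernel
  \<open>Q\<close> is never built: being invariant modulo a subspace \<open>I\<close> is expressed
  as membership of a tensor in \<open>I \<otimes> A\<close>, and such memberships are tested by
  contracting the right factor with linear functionals.\<close>

lemma bilinear_mapI:
  assumes "\<And>w. Vector_Spaces.linear sV sU (\<lambda>v. b v w)" "\<And>v. Vector_Spaces.linear sW sU (b v)"
  shows "bilinear_map sV sW sU b"
  using assms unfolding bilinear_map_def by auto

lemma
  assumes "bilinear_map sV sW sU b"
  shows bilinear_left: "Vector_Spaces.linear sV sU (\<lambda>v. b v w)"
    and bilinear_right: "Vector_Spaces.linear sW sU (b v)"
  using assms unfolding bilinear_map_def by auto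

lemma
  assumes "vector_space sV" "vector_space sW"
  shows linear_tens_left: "Vector_Spaces.linear sV fscale (\<lambda>v. tens sV sW v w)"
    and linear_tens_right: "Vector_Spaces.linear sW fscale (tens sV sW v)"
  using tens_bilinear[OF assms] unfolding bilinear_map_def by auto

lemma linear_fun_add_diff:
  assumes "Vector_Spaces.linear s1 s2 f" "Vector_Spaces.linear s1 s2 g"
  shows "Vector_Spaces.linear s1 s2 (\<lambda>x. f x + g x)" "Vector_Spaces.linear s1 s2 (\<lambda>x. f x - g x)"
proof -
  interpret VP: vector_space_pair s1 s2
    by (intro vector_space_pair.intro linear_vs[OF assms(1)])
  show "Vector_Spaces.linear s1 s2 (\<lambda>x. f x + g x)" "Vector_Spaces.linear s1 s2 (\<lambda>x. f x - g x)"
    by (rule VP.linear_compose_add VP.linear_compose_sub; fact assms)+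
qed

text \<open>The contraction \<open>id \<otimes> l\<close>. With \<open>l\<close> dual to a basis
  vector of the right factor, it extracts the coefficient of that vector.\<close>

definition slice ::
  "('f::field \<Rightarrow> 'v::ab_group_add \<Rightarrow> 'v) \<Rightarrow> ('f \<Rightarrow> 'w::ab_group_add \<Rightarrow> 'w)
    \<Rightarrow> ('w \<Rightarrow> 'f) \<Rightarrow> ('f, 'v, 'w) tensor \<Rightarrow> 'v" where
  "slice sV sW l = tlift sV sW sV (\<lambda>v w. sV (l w) v)"

lemma
  assumes V: "vector_space sV" and l: "Vector_Spaces.linear sW (*) l"
  shows slice_linear: "Vector_Spaces.linear fscale sV (slice sV sW l)"
    and slice_tens: "slice sV sW l (tens sV sW v w) = sV (l w) v"
proof -
  interpret V: vector_space sV by fact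
  interpret l: Vector_Spaces.linear sW "(*)" l by fact
  note W = linear_vs(1)[OF l]
  have "bilinear_map sV sW sV (\<lambda>v w. sV (l w) v)"
    by (rule bilinear_mapI)
      (auto simp: Vector_Spaces.linear_iff V W l.add l.scale V.scale_left_distrib V.scale_right_distrib mult.commute)
  note * = V W V this
  show "Vector_Spaces.linear fscale sV (slice sV sW l)"
    "slice sV sW l (tens sV sW v w) = sV (l w) v"
    unfolding slice_def by (rule tlift_linear[OF *] tlift_tens[OF *])+
qed

lemma dual_functional:
  assumes "vector_space (sW :: 'f::field \<Rightarrow> 'w::ab_group_add \<Rightarrow> 'w)" "\<not> module.dependent sW B" "b \<in> B"
  obtains l where "Vector_Spaces.linear sW (*) l" "\<And>b'. b' \<in> B \<Longrightarrow> l b' = (if b' = b then 1 else 0)"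
proof -
  interpret vector_space_pair sW "(*) :: 'f \<Rightarrow> 'f \<Rightarrow> 'f"
    by (intro vector_space_pair.intro assms vector_space_mult)
  show ?thesis
    using that[of "construct B (\<lambda>b'. if b' = b then 1 else 0)"] linear_construct[OF assms(2)]
      construct_basis[OF assms(2)] by auto
qed

lemma tensor_decomposition:
  fixes sV :: "'f::field \<Rightarrow> 'v::ab_group_add \<Rightarrow> 'v" and sW :: "'f \<Rightarrow> 'w::ab_group_add \<Rightarrow> 'w"
  assumes V: "vector_space sV" and W: "vector_space sW" and sub: "module.subspace sV V"
    and t: "t \<in> tensor_space sV sW V UNIV"
  obtains B w where "finite B" "\<not> module.dependent sW B" "\<And>b. w b \<in> V"
    "t = (\<Sum>b\<in>B. tens sV sW (w b) b)"
proof -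
  interpret V: vector_space sV by fact
  interpret W: vector_space sW by fact
  obtain Z where Z: "W.independent Z" "UNIV \<subseteq> W.span Z"
    using W.maximal_independent_subset[of UNIV] by blast
  \<comment> \<open>All index sets are taken from one fixed basis \<open>Z\<close>, so their unions
    stay independent during the induction.\<close>
  let ?P = "\<lambda>t. \<exists>B w. finite B \<and> B \<subseteq> Z \<and> (\<forall>b. w b \<in> V) \<and> t = (\<Sum>b\<in>B. tens sV sW (w b) b)"
  note tl = linear_tens_left[OF V W] and tr = linear_tens_right[OF V W]
  have ext: "(\<Sum>b\<in>B. tens sV sW (w b) b) = (\<Sum>b\<in>B'. tens sV sW (if b \<in> B then w b else 0) b)"
    if "finite B'" "B \<subseteq> B'" for w B B'
  proof -
    have "tens sV sW 0 b = 0" for b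
      by (rule module_hom.zero[OF module_hom_linearI[OF tl]])
    thus ?thesis using that by (intro sum.mono_neutral_cong_left) auto
  qed
  have "?P t" using t unfolding tensor_space_def
  proof (induction rule: fs.span_induct_alt)
    case base
    show ?case by (rule exI[of _ "{}"]) (use V.subspace_0[OF sub] in auto)
  next
    case (step c x y)
    then obtain B w where y: "finite B" "B \<subseteq> Z" "\<And>b. w b \<in> V" "y = (\<Sum>b\<in>B. tens sV sW (w b) b)"
      by blast
    obtain v a where x: "v \<in> V" "x = tens sV sW v a" using step by blast
    have "a \<in> W.span Z" using Z by auto
    then obtain B1 r where a: "finite B1" "B1 \<subseteq> Z" "a = (\<Sum>b\<in>B1. sW (r b) b)"
      unfolding W.span_explicit by blast
    interpret tr: Vector_Spaces.linear sW fscale "tens sV sW (sV c v)" by (rule tr)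
    let ?w = "\<lambda>b. (if b \<in> B1 then sV (r b) (sV c v) else 0) + (if b \<in> B then w b else 0)"
    have "fscale c x = tens sV sW (sV c v) a"
      unfolding x tens_scale_left[OF V W] ..
    also have "\<dots> = (\<Sum>b\<in>B1. fscale (r b) (tens sV sW (sV c v) b))"
      unfolding a(3) tr.sum tr.scale ..
    also have "\<dots> = (\<Sum>b\<in>B1. tens sV sW (sV (r b) (sV c v)) b)"
      unfolding tens_scale_left[OF V W, where v = "sV c v"] ..
    also have "\<dots> = (\<Sum>b\<in>B1 \<union> B. tens sV sW (if b \<in> B1 then sV (r b) (sV c v) else 0) b)"
      by (rule ext) (use a y in auto)
    finally have "fscale c x + y = (\<Sum>b\<in>B1 \<union> B. tens sV sW (?w b) b)"
      unfolding y(4) ext[of "B1 \<union> B" B w, OF finite_UnI[OF a(1) y(1)] Un_upper2]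
      by (simp only: tens_add_left[OF V W] sum.distrib)
    moreover have "?w b \<in> V" for b
      by (intro V.subspace_add[OF sub]) (use V.subspace_0[OF sub] V.subspace_scale[OF sub] x y in auto)
    ultimately show ?case using a y by (intro exI[of _ "B1 \<union> B"] exI[of _ ?w]) auto
  qed
  then obtain B w where *: "finite B" "B \<subseteq> Z" "\<forall>b. w b \<in> V" "t = (\<Sum>b\<in>B. tens sV sW (w b) b)"
    by blast
  show ?thesis using that[of B w] * W.independent_mono[OF Z(1) *(2)] by blast
qed

context
  fixes sV :: "'f::field \<Rightarrow> 'v::ab_group_add \<Rightarrow> 'v" and sW :: "'f \<Rightarrow> 'w::ab_group_add \<Rightarrow> 'w"
  assumes V: "vector_space sV" and W: "vector_space sW"
begin

lemma slice_in:
  assumes "Vector_Spaces.linear sW (*) l" "module.subspace sV V" "t \<in> tensor_space sV sW V U"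
  shows "slice sV sW l t \<in> V"
proof -
  interpret V: vector_space sV by (rule V)
  show ?thesis
    by (rule tensor_space_map[OF slice_linear[OF V assms(1)] assms(2) _ assms(3)])
      (simp add: slice_tens[OF V assms(1)] V.subspace_scale[OF assms(2)])
qed

lemma tensor_space_coefficients:
  assumes sub: "module.subspace sV V" and t: "t \<in> tensor_space sV sW V UNIV"
  obtains B w where "finite B" "t = (\<Sum>b\<in>B. tens sV sW (w b) b)"
    "\<And>b. b \<in> B \<Longrightarrow> \<exists>l. Vector_Spaces.linear sW (*) l \<and> w b = slice sV sW l t"
proof -
  interpret V: vector_space sV by (rule V)
  obtain B w where B: "finite B" "\<not> module.dependent sW B" "\<And>b. w b \<in> V"
    "t = (\<Sum>b\<in>B. tens sV sW (w b) b)"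
    using tensor_decomposition[OF V W sub t] by blast
  show ?thesis
  proof (rule that[OF B(1,4)])
    fix b assume b: "b \<in> B"
    obtain l where l: "Vector_Spaces.linear sW (*) l"
      "\<And>b'. b' \<in> B \<Longrightarrow> l b' = (if b' = b then 1 else 0)"
      using dual_functional[OF W B(2) b] by blast
    interpret s: Vector_Spaces.linear fscale sV "slice sV sW l" by (rule slice_linear[OF V l(1)])
    have "slice sV sW l t = (\<Sum>b'\<in>B. sV (l b') (w b'))"
      unfolding B(4) s.sum slice_tens[OF V l(1)] ..
    also have "\<dots> = (\<Sum>b'\<in>B. if b' = b then w b' else 0)"
      by (rule sum.cong) (auto simp: l(2))
    also have "\<dots> = w b" using B(1) b by simp
    finally show "\<exists>l. Vector_Spaces.linear sW (*) l \<and> w b = slice sV sW l t" using l by metis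
  qed
qed

text \<open>The coefficients of \<open>t\<close> with respect to independent vectors on the right
  are themselves slices. This criterion does the work of exactness of the tensor product.\<close>

lemma tensor_in_slices:
  assumes "module.subspace sV V" "module.subspace sV I" and t: "t \<in> tensor_space sV sW V UNIV"
    and sl: "\<And>l. Vector_Spaces.linear sW (*) l \<Longrightarrow> slice sV sW l t \<in> I"
  shows "t \<in> tensor_space sV sW I UNIV"
proof -
  obtain B w where B: "finite B" "t = (\<Sum>b\<in>B. tens sV sW (w b) b)"
    "\<And>b. b \<in> B \<Longrightarrow> \<exists>l. Vector_Spaces.linear sW (*) l \<and> w b = slice sV sW l t"
    using tensor_space_coefficients[OF assms(1,3)] by blast
  have "w b \<in> I" if "b \<in> B" for b using B(3)[OF that] sl by auto
  hence "(\<Sum>b\<in>B. tens sV sW (w b) b) \<in> tensor_space sV sW I UNIV"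
    by (intro fs.subspace_sum[OF subspace_tensor_space] tens_in) auto
  thus ?thesis using B by simp
qed

lemma tensor_space_zero:
  assumes "t \<in> tensor_space sV sW {0} U" shows "t = 0"
proof -
  have z: "tens sV sW 0 b = 0" for b
    by (rule module_hom.zero[OF module_hom_linearI[OF linear_tens_left[OF V W]]])
  have "{tens sV sW v w |v w. v \<in> {0} \<and> w \<in> U} \<subseteq> {0}" by (auto simp: z)
  hence "fs.span {tens sV sW v w |v w. v \<in> {0} \<and> w \<in> U} \<subseteq> {0}"
    by (rule fs.span_minimal) simp
  thus ?thesis using assms unfolding tensor_space_def by blast
qed

end

section \<open>Linear maps applied to the left tensor factor\<close>

lemma slice_tmap:
  assumes f: "Vector_Spaces.linear sV sX f" and g: "Vector_Spaces.linear sW sY g"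
    and l: "Vector_Spaces.linear sY (*) l" and t: "t \<in> tensor_space sV sW V U"
  shows "slice sX sY l (tmap sV sW sX sY f g t) = f (slice sV sW (\<lambda>w. l (g w)) t)"
proof (rule tensor_eqI[OF _ _ _ t])
  interpret f: Vector_Spaces.linear sV sX f by fact
  note vs = linear_vs[OF f] linear_vs[OF g] and lg = linear_compose'[OF g l]
  show "Vector_Spaces.linear fscale sX (\<lambda>t. slice sX sY l (tmap sV sW sX sY f g t))"
    by (rule linear_compose'[OF tmap_linear[OF f g] slice_linear[OF vs(2) l]])
  show "Vector_Spaces.linear fscale sX (\<lambda>t. f (slice sV sW (\<lambda>w. l (g w)) t))"
    by (rule linear_compose'[OF slice_linear[OF vs(1) lg] f])
  show "slice sX sY l (tmap sV sW sX sY f g (tens sV sW v w)) =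
      f (slice sV sW (\<lambda>w. l (g w)) (tens sV sW v w))" for v w
    unfolding tmap_tens[OF f g] slice_tens[OF vs(2) l] slice_tens[OF vs(1) lg] f.scale ..
qed

lemma linear_preimage_subspace:
  assumes "Vector_Spaces.linear sV sX f" "module.subspace sV V" "module.subspace sX I"
  shows "module.subspace sV {v \<in> V. f v \<in> I}"
proof -
  interpret f: Vector_Spaces.linear sV sX f by fact
  show ?thesis
    using assms(2,3) unfolding f.vs1.subspace_def f.vs2.subspace_def
    by (auto simp: f.add f.scale f.zero)
qed

text \<open>Slices commute with \<open>f\<close>, so \<open>f\<close> sends every slice of
  \<open>t\<close> into \<open>I\<close>. For \<open>I = {0}\<close> this says that the kernel of
  \<open>f \<otimes> id\<close> is the kernel of \<open>f\<close> tensored with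
  \<open>W\<close>.\<close>

lemma tensor_preimage:
  assumes f: "Vector_Spaces.linear sV sX f" and W: "vector_space sW"
    and V: "module.subspace sV V" and I: "module.subspace sX I"
    and t: "t \<in> tensor_space sV sW V UNIV" and ft: "tmap sV sW sX sW f id t \<in> tensor_space sX sW I UNIV"
  shows "t \<in> tensor_space sV sW {v \<in> V. f v \<in> I} UNIV"
proof (rule tensor_in_slices[OF _ W V linear_preimage_subspace[OF f V I] t])
  note vs = linear_vs[OF f]
  show "vector_space sV" by (rule vs)
  fix l :: "'d \<Rightarrow> 'a" assume l: "Vector_Spaces.linear sW (*) l"
  have "f (slice sV sW l t) = slice sX sW l (tmap sV sW sX sW f id t)"
    using slice_tmap[OF f linear_id'[OF W] l t] by simp
  also have "\<dots> \<in> I" by (rule slice_in[OF vs(2) W l I ft])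
  finally show "slice sV sW l t \<in> {v \<in> V. f v \<in> I}" using slice_in[OF vs(1) W l V t] by simp
qed

lemma tmap_eq_0:
  assumes f: "Vector_Spaces.linear sV sX f" "inj_on f V" and W: "vector_space sW"
    and V: "module.subspace sV V"
    and t: "t \<in> tensor_space sV sW V UNIV" and ft: "tmap sV sW sX sW f id t = 0"
  shows "t = 0"
proof -
  interpret f: Vector_Spaces.linear sV sX f by fact
  have "tmap sV sW sX sW f id t \<in> tensor_space sX sW {0} UNIV"
    unfolding ft by (rule fs.subspace_0[OF subspace_tensor_space])
  from tensor_preimage[OF f(1) W V _ t this]
  have "t \<in> tensor_space sV sW {v \<in> V. f v \<in> {0}} UNIV" by simp
  moreover have "{v \<in> V. f v \<in> {0}} = {0}"
    using f(2) f.vs1.subspace_0[OF V] f.zero by (auto simp: inj_on_def)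
  ultimately show ?thesis using tensor_space_zero[OF linear_vs(1)[OF f(1)] W] by simp
qed

lemma tmap_inj_on:
  assumes f: "Vector_Spaces.linear sV sX f" "inj_on f V" and W: "vector_space sW"
    and V: "module.subspace sV V"
  shows "inj_on (tmap sV sW sX sW f id) (tensor_space sV sW V UNIV)"
proof (rule inj_onI)
  fix t u assume tu: "t \<in> tensor_space sV sW V UNIV" "u \<in> tensor_space sV sW V UNIV"
    "tmap sV sW sX sW f id t = tmap sV sW sX sW f id u"
  interpret T: Vector_Spaces.linear fscale fscale "tmap sV sW sX sW f id"
    by (rule tmap_linear[OF f(1) linear_id'[OF W]])
  have "t - u = 0"
    by (rule tmap_eq_0[OF f W V fs.subspace_diff[OF subspace_tensor_space tu(1,2)]])
      (simp only: T.diff tu diff_self)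
  thus "t = u" by simp
qed

lemma tmap_surj_on:
  assumes f: "Vector_Spaces.linear sV sX f" and W: "vector_space sW"
    and t: "t \<in> tensor_space sX sW (f ` V) U"
  shows "\<exists>z\<in>tensor_space sV sW V U. tmap sV sW sX sW f id z = t"
proof -
  interpret T: Vector_Spaces.linear fscale fscale "tmap sV sW sX sW f id"
    by (rule tmap_linear[OF f linear_id'[OF W]])
  have T_tens: "tens sX sW (f v) w = tmap sV sW sX sW f id (tens sV sW v w)" for v w
    by (simp add: tmap_tens[OF f linear_id'[OF W]])
  have "{tens sX sW v w |v w. v \<in> f ` V \<and> w \<in> U} \<subseteq>
      tmap sV sW sX sW f id ` tensor_space sV sW V U"
    by (auto simp: T_tens intro!: imageI tens_in)
  moreover have "fs.subspace (tmap sV sW sX sW f id ` tensor_space sV sW V U)"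
    by (rule T.subspace_image[OF subspace_tensor_space])
  ultimately have "tensor_space sX sW (f ` V) U \<subseteq> tmap sV sW sX sW f id ` tensor_space sV sW V U"
    unfolding tensor_space_def[of sX] by (rule fs.span_minimal)
  thus ?thesis using t by auto
qed

lemma tensor_space_finite:
  assumes "t \<in> tensor_space sV sW V U"
  obtains X where "finite X" "X \<subseteq> V" "t \<in> tensor_space sV sW X U"
proof -
  have "\<exists>X. finite X \<and> X \<subseteq> V \<and> t \<in> tensor_space sV sW X U"
    using assms unfolding tensor_space_def[of _ _ V]
  proof (induction rule: fs.span_induct_alt)
    case base
    show ?case using fs.subspace_0[OF subspace_tensor_space] by blast
  next
    case (step c x y)
    then obtain X v w where *: "finite X" "X \<subseteq> V" "y \<in> tensor_space sV sW X U"
      "x = tens sV sW v w" "v \<in> V" "w \<in> U" by blast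
    have "y \<in> tensor_space sV sW (insert v X) U" "x \<in> tensor_space sV sW (insert v X) U"
      using * by (auto intro: tens_in subsetD[OF tensor_space_mono[OF subset_insertI]])
    hence "fscale c x + y \<in> tensor_space sV sW (insert v X) U"
      by (intro fs.subspace_add[OF subspace_tensor_space] fs.subspace_scale[OF subspace_tensor_space])
    moreover have "finite (insert v X)" "insert v X \<subseteq> V" using * by auto
    ultimately show ?case by blast
  qed
  thus ?thesis using that by blast
qed

section \<open>Sweedler calculus\<close>

text \<open>
  \<open>sweedler A sU b a\<close> is \<open>\<Sum> b a\<^sub>1 a\<^sub>2\<close> in Sweedler notation.
\<close>

definition sweedler ::
  "('f::field, 'a::comm_ring_1) hopf \<Rightarrow> ('f \<Rightarrow> 'u::ab_group_add \<Rightarrow> 'u) \<Rightarrow> ('a \<Rightarrow> 'a \<Rightarrow> 'u) \<Rightarrow> 'a \<Rightarrow> 'u"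
where
  "sweedler A sU b a = tlift (fsmul A) (fsmul A) sU b (comult A a)"

lemma linear_scale:
  assumes "Vector_Spaces.linear s1 s2 f"
  shows "Vector_Spaces.linear s1 s2 (\<lambda>x. s2 c (f x))"
proof -
  interpret VP: vector_space_pair s1 s2
    by (intro vector_space_pair.intro linear_vs[OF assms(1)])
  show ?thesis by (rule VP.module_hom_scale[OF assms])
qed

lemma linear_scale_left:
  assumes "vector_space sU" "Vector_Spaces.linear sX (*) e"
  shows "Vector_Spaces.linear sX sU (\<lambda>x. sU (e x) u)"
proof -
  interpret U: vector_space sU by fact
  interpret e: Vector_Spaces.linear sX "(*)" e by fact
  show ?thesis
    by (simp add: Vector_Spaces.linear_iff assms(1) linear_vs(1)[OF assms(2)] e.add e.scale U.scale_left_distrib)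
qed

text \<open>Outside the tensor product the values of \<open>tlift\<close> come from an arbitrary
  choice and need not vary linearly with the parameter, hence the assumption on
  \<open>t\<close>.\<close>

lemma tlift_linear_param:
  assumes V: "vector_space sV" and W: "vector_space sW" and X: "vector_space sX"
    and b: "\<And>x. bilinear_map sV sW sU (\<beta> x)"
    and l: "\<And>v w. Vector_Spaces.linear sX sU (\<lambda>x. \<beta> x v w)"
    and t: "t \<in> tensor_space sV sW V' W'"
  shows "Vector_Spaces.linear sX sU (\<lambda>x. tlift sV sW sU (\<beta> x) t)"
proof -
  have U: "vector_space sU" by (rule linear_vs(2)[OF l])
  note L = tlift_linear[OF V W U b] and M = tlift_tens[OF V W U b]
  have "tlift sV sW sU (\<beta> (x + y)) t = tlift sV sW sU (\<beta> x) t + tlift sV sW sU (\<beta> y) t" for x y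
    by (rule tensor_eqI[OF L linear_fun_add_diff(1)[OF L L] _ t])
      (use l in \<open>simp add: M Vector_Spaces.linear_iff\<close>)
  moreover have "tlift sV sW sU (\<beta> (sX c x)) t = sU c (tlift sV sW sU (\<beta> x) t)" for c x
    by (rule tensor_eqI[OF L linear_scale[OF L] _ t]) (use l in \<open>simp add: M Vector_Spaces.linear_iff\<close>)
  ultimately show ?thesis by (simp add: Vector_Spaces.linear_iff X U)
qed

context affine_group
begin

abbreviation "sw \<equiv> sweedler A"
abbreviation "\<epsilon> \<equiv> counit A"
abbreviation "S \<equiv> antipode A"

lemma linear_self: "Vector_Spaces.linear sA sA (\<lambda>x. x)"
  using linear_idA unfolding id_def .

lemma sw_linear:
  assumes "bilinear_map sA sA sU b"
  shows "Vector_Spaces.linear sA sU (sw sU b)"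
  unfolding sweedler_def
  by (rule linear_compose'[OF comult_linear tlift_linear[OF vector_space_A vector_space_A
        linear_vs(2)[OF bilinear_left[OF assms]] assms]])

lemma sw_linear_param:
  assumes "\<And>x. bilinear_map sA sA sU (\<beta> x)" "\<And>u v. Vector_Spaces.linear sX sU (\<lambda>x. \<beta> x u v)"
  shows "Vector_Spaces.linear sX sU (\<lambda>x. sw sU (\<beta> x) a)"
  unfolding sweedler_def
  by (rule tlift_linear_param[OF vector_space_A vector_space_A linear_vs(1)[OF assms(2)] assms comult_in])

lemma sw_linear_compose:
  assumes "bilinear_map sA sA sU b" "Vector_Spaces.linear sX sA g"
  shows "Vector_Spaces.linear sX sU (\<lambda>x. sw sU b (g x))"
  by (rule linear_compose'[OF assms(2) sw_linear[OF assms(1)]])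

lemma
  assumes f: "Vector_Spaces.linear sX sA f"
  shows linear_mult_right: "Vector_Spaces.linear sX sA (\<lambda>x. f x * c)"
    and linear_mult_left: "Vector_Spaces.linear sX sA (\<lambda>x. c * f x)"
proof -
  interpret f: Vector_Spaces.linear sX sA f by fact
  show "Vector_Spaces.linear sX sA (\<lambda>x. f x * c)"
    using linear_vs[OF f] by (simp add: Vector_Spaces.linear_iff f.add f.scale distrib_right fsmul_mult)
  thus "Vector_Spaces.linear sX sA (\<lambda>x. c * f x)" by (simp add: mult.commute)
qed

lemma sw_apply:
  assumes b: "bilinear_map sA sA sU b" and f: "Vector_Spaces.linear sU sZ f"
  shows "f (sw sU b a) = sw sZ (\<lambda>x y. f (b x y)) a"
proof -
  have b': "bilinear_map sA sA sZ (\<lambda>x y. f (b x y))"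
    by (rule bilinear_mapI)
      (rule linear_compose'[OF bilinear_left[OF b] f] linear_compose'[OF bilinear_right[OF b] f])+
  note vs = vector_space_A vector_space_A linear_vs[OF f]
  show ?thesis unfolding sweedler_def
    by (rule tensor_eqI[OF linear_compose'[OF tlift_linear[OF vs(1,2,3) b] f]
          tlift_linear[OF vs(1,2,4) b'] _ comult_in])
      (simp add: tlift_tens[OF vs(1,2,3) b] tlift_tens[OF vs(1,2,4) b'])
qed

lemma sw_mult:
  assumes b: "bilinear_map sA sA sU b"
  shows "sw sU b (a * c) = sw sU (\<lambda>x y. sw sU (\<lambda>u v. b (x * u) (y * v)) c) a"
proof -
  have U: "vector_space sU" by (rule linear_vs(2)[OF bilinear_left[OF b]])
  note vs = vector_space_A vector_space_A
  let ?t = "\<lambda>a b c d. tens sA sA (a * c) (b * d)"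
  let ?b = "\<lambda>x y u v. b (x * u) (y * v)"
  note ml = linear_compose'[OF linear_mult_right[OF linear_self]]
    linear_compose'[OF linear_mult_left[OF linear_self]]
  have bb: "bilinear_map sA sA sU (?b x y)" "bilinear_map sA sA sU (\<lambda>x y. ?b x y u v)" for x y u v
    by (rule bilinear_mapI; rule ml[OF bilinear_left[OF b]] ml[OF bilinear_right[OF b]])+
  have tt: "bilinear_map sA sA fscale (?t x y)" "bilinear_map sA sA fscale (\<lambda>x y. ?t x y u v)" for x y u v
    by (rule bilinear_mapI; rule ml[OF linear_tens_left[OF vs]] ml[OF linear_tens_right[OF vs]])+
  have tt2: "bilinear_map sA sA fscale (\<lambda>x y. tlift sA sA fscale (?t x y) t)"
    if "t \<in> tensor_space sA sA UNIV UNIV" for t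
    using bilinear_left[OF tt(2)] bilinear_right[OF tt(2)]
    by (intro bilinear_mapI tlift_linear_param[OF vs vector_space_A tt(1) _ that]) auto
  have bb2: "bilinear_map sA sA sU (\<lambda>x y. tlift sA sA sU (?b x y) t)"
    if "t \<in> tensor_space sA sA UNIV UNIV" for t
    using bilinear_left[OF bb(2)] bilinear_right[OF bb(2)]
    by (intro bilinear_mapI tlift_linear_param[OF vs vector_space_A bb(1) _ that]) auto
  have 1: "tlift sA sA sU b (tlift sA sA fscale (?t x y) t) = tlift sA sA sU (?b x y) t"
    if t: "t \<in> tensor_space sA sA UNIV UNIV" for x y t
    by (rule tensor_eqI[OF linear_compose'[OF tlift_linear[OF vs fscale_vs tt(1)] tlift_linear[OF vs U b]]
          tlift_linear[OF vs U bb(1)] _ t])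
      (simp only: tlift_tens[OF vs fscale_vs tt(1)] tlift_tens[OF vs U b] tlift_tens[OF vs U bb(1)])
  have "tlift sA sA sU b (tlift sA sA fscale (\<lambda>x y. tlift sA sA fscale (?t x y) (comult A c)) t) =
      tlift sA sA sU (\<lambda>x y. tlift sA sA sU (?b x y) (comult A c)) t"
    if t: "t \<in> tensor_space sA sA UNIV UNIV" for t
    by (rule tensor_eqI[OF linear_compose'[OF tlift_linear[OF vs fscale_vs tt2[OF comult_in]] tlift_linear[OF vs U b]]
          tlift_linear[OF vs U bb2[OF comult_in]] _ t])
      (simp only: tlift_tens[OF vs fscale_vs tt2[OF comult_in]] 1[OF comult_in]
        tlift_tens[OF vs U bb2[OF comult_in]])
  from this[OF comult_in] show ?thesis unfolding sweedler_def comult_mult tensor_mult_def .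
qed

lemma sw_one:
  assumes b: "bilinear_map sA sA sU b" shows "sw sU b 1 = b 1 1"
  unfolding sweedler_def comult_one
  by (rule tlift_tens[OF vector_space_A vector_space_A linear_vs(2)[OF bilinear_left[OF b]] b])

lemma
  assumes g: "Vector_Spaces.linear sA sU g"
  shows sw_counit_left: "sw sU (\<lambda>x y. sU (\<epsilon> x) (g y)) a = g a"
    and sw_counit_right: "sw sU (\<lambda>x y. sU (\<epsilon> y) (g x)) a = g a"
proof -
  interpret g: Vector_Spaces.linear sA sU g by fact
  have b: "bilinear_map sA sA sA (\<lambda>x y. sA (\<epsilon> x) y)" "bilinear_map sA sA sA (\<lambda>x y. sA (\<epsilon> y) x)"
    using linear_scale[OF linear_idA] linear_scale_left[OF vector_space_A counit_linear]
    by (auto intro!: bilinear_mapI)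
  show "sw sU (\<lambda>x y. sU (\<epsilon> x) (g y)) a = g a"
    using sw_apply[OF b(1) g, of a] counit_left[of a] unfolding sweedler_def g.scale by simp
  show "sw sU (\<lambda>x y. sU (\<epsilon> y) (g x)) a = g a"
    using sw_apply[OF b(2) g, of a] counit_right[of a] unfolding sweedler_def g.scale tensor_counit_def
    by simp
qed

lemmas linear_S_compose = linear_compose'[OF _ antipode_linear]

lemma
  assumes g: "Vector_Spaces.linear sA sU g"
  shows sw_antipode_left: "sw sU (\<lambda>x y. g (S x * y)) a = sU (\<epsilon> a) (g 1)"
    and sw_antipode_right: "sw sU (\<lambda>x y. g (x * S y)) a = sU (\<epsilon> a) (g 1)"
proof -
  interpret g: Vector_Spaces.linear sA sU g by fact
  have b: "bilinear_map sA sA sA (\<lambda>x y. S x * y)" "bilinear_map sA sA sA (\<lambda>x y. x * S y)"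
    using linear_mult_right[OF antipode_linear] linear_mult_left[OF antipode_linear]
      linear_mult_right[OF linear_idA] linear_mult_left[OF linear_idA]
    by (auto intro!: bilinear_mapI)
  show "sw sU (\<lambda>x y. g (S x * y)) a = sU (\<epsilon> a) (g 1)"
    using sw_apply[OF b(1) g, of a] antipode_left[of a] unfolding sweedler_def by (simp add: g.scale)
  show "sw sU (\<lambda>x y. g (x * S y)) a = sU (\<epsilon> a) (g 1)"
    using sw_apply[OF b(2) g, of a] antipode_right[of a] unfolding sweedler_def by (simp add: g.scale)
qed

text \<open>One linear map \<open>\<Lambda>\<close> on threefold tensors evaluates both sides; it is
  applied to the two sides of \<open>coassoc\<close>.\<close>

lemma sw_coassoc:
  assumes l: "\<And>y z. Vector_Spaces.linear sA sU (\<lambda>x. \<beta> x y z)"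
    "\<And>x z. Vector_Spaces.linear sA sU (\<lambda>y. \<beta> x y z)"
    "\<And>x y. Vector_Spaces.linear sA sU (\<lambda>z. \<beta> x y z)"
  shows "sw sU (\<lambda>w z. sw sU (\<lambda>x y. \<beta> x y z) w) a = sw sU (\<lambda>x w. sw sU (\<lambda>y z. \<beta> x y z) w) a"
proof -
  have U: "vector_space sU" by (rule linear_vs(2)[OF l(1)])
  note vs = vector_space_A vector_space_A
  have b1: "bilinear_map sA sA sU (\<lambda>x y. \<beta> x y z)" and b2: "bilinear_map sA sA sU (\<lambda>y z. \<beta> x y z)" for x z
    using l by (auto intro!: bilinear_mapI)
  let ?g = "\<lambda>t z. tlift sA sA sU (\<lambda>x y. \<beta> x y z) t"
  let ?AA = "tensor_space sA sA UNIV UNIV"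
  have zl: "Vector_Spaces.linear sA sU (\<lambda>z. ?g t z)" if "t \<in> ?AA" for t
    by (rule tlift_linear_param[OF vs vector_space_A b1 l(3) that])
  note gl = tlift_linear[OF vs U b1]
  \<comment> \<open>\<open>?g t\<close> is linear only for \<open>t\<close> in the tensor product, hence the projection \<open>r\<close>.\<close>
  interpret FF: vector_space_pair fscale fscale by (intro vector_space_pair.intro fscale_vs)
  obtain r :: "('f, 'a, 'a) tensor \<Rightarrow> _" where r: "range r \<subseteq> ?AA" "Vector_Spaces.linear fscale fscale r"
    "\<And>t. t \<in> ?AA \<Longrightarrow> r t = t"
    using FF.linear_exists_left_inverse_on[OF linear_id'[OF fscale_vs] subspace_tensor_space[of sA sA UNIV UNIV]]
    by auto
  have bil: "bilinear_map fscale sA sU (\<lambda>t z. ?g (r t) z)"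
    using r(1) by (intro bilinear_mapI linear_compose'[OF r(2) gl] zl) auto
  define \<Lambda> where "\<Lambda> = tlift fscale sA sU (\<lambda>t z. ?g (r t) z)"
  note \<Lambda> = tlift_linear[OF fscale_vs vector_space_A U bil, folded \<Lambda>_def]
    tlift_tens[OF fscale_vs vector_space_A U bil, folded \<Lambda>_def]
  have bL: "bilinear_map sA sA sU (\<lambda>w z. ?g (comult A w) z)"
    by (intro bilinear_mapI linear_compose'[OF comult_linear gl] zl comult_in)
  have L: "\<Lambda> (T sA fscale (comult A) t) = tlift sA sA sU (\<lambda>w z. ?g (comult A w) z) t" if "t \<in> ?AA" for t
    by (rule tensor_eqI[OF linear_compose'[OF T_linear[OF comult_linear] \<Lambda>(1)]
          tlift_linear[OF vs U bL] _ that])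
      (simp only: T_tens[OF comult_linear] \<Lambda>(2) tlift_tens[OF vs U bL] r(3)[OF comult_in])
  have lt: "Vector_Spaces.linear sA fscale (tens sA sA x)" for x by (rule linear_tens1[OF vector_space_A])
  have R1: "\<Lambda> (T sA fscale (tens sA sA x) t) = tlift sA sA sU (\<beta> x) t" if "t \<in> ?AA" for x t
    by (rule tensor_eqI[OF linear_compose'[OF T_linear[OF lt] \<Lambda>(1)] tlift_linear[OF vs U b2] _ that])
      (simp only: T_tens[OF lt] \<Lambda>(2) tlift_tens[OF vs U b1] tlift_tens[OF vs U b2] r(3) tens_in UNIV_I)
  have bR: "bilinear_map sA sA sU (\<lambda>x w. tlift sA sA sU (\<beta> x) (comult A w))"
    by (intro bilinear_mapI linear_compose'[OF comult_linear tlift_linear[OF vs U b2]]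
        tlift_linear_param[OF vs vector_space_A b2 l(1) comult_in])
  have R: "\<Lambda> (C sA t) = tlift sA sA sU (\<lambda>x w. tlift sA sA sU (\<beta> x) (comult A w)) t" if "t \<in> ?AA" for t
    by (rule tensor_eqI[OF linear_compose'[OF C_linear[OF vector_space_A] \<Lambda>(1)]
          tlift_linear[OF vs U bR] _ that])
      (simp only: C_tens[OF vector_space_A] R1[OF comult_in] tlift_tens[OF vs U bR])
  show ?thesis unfolding sweedler_def
    using L[OF comult_in, of a] R[OF comult_in, of a] unfolding coassoc by simp
qed

section \<open>Identities for the antipode\<close>

lemma S_one: "S 1 = 1"
proof -
  interpret A: vector_space sA by (rule vector_space_A)
  have "bilinear_map sA sA sA (\<lambda>x y. S x * y)"
    by (intro bilinear_mapI linear_mult_right linear_mult_left antipode_linear linear_self)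
  from sw_one[OF this] sw_antipode_left[OF linear_self, of 1] show ?thesis
    by (simp add: counit_one)
qed

lemma counit_S: "\<epsilon> (S a) = \<epsilon> a"
proof -
  interpret S: Vector_Spaces.linear sA "(*)" "\<lambda>x. \<epsilon> (S x)"
    by (rule linear_compose'[OF antipode_linear counit_linear])
  show ?thesis
    using sw_antipode_left[OF counit_linear, of a] sw_counit_right[OF S.linear_axioms, of a]
    by (simp add: counit_mult counit_one mult.commute)
qed

text \<open>Both sides are equal to \<open>\<Sum> S (b\<^sub>1 y\<^sub>1) b\<^sub>2 y\<^sub>2 S b\<^sub>3\<close>.\<close>

lemma sw_antipode_mult: "sw sA (\<lambda>u v. S (b * u) * v) y = sA (\<epsilon> y) (S b)"
proof -
  interpret A: vector_space sA by (rule vector_space_A)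
  note lin = linear_mult_right linear_mult_left linear_S_compose antipode_linear linear_self bilinear_mapI
    sw_linear_param sw_linear
  let ?D = "\<lambda>b. sw sA (\<lambda>u v. S (b * u) * v) y"
  let ?F = "\<lambda>p q r. sw sA (\<lambda>u v. S (p * u) * (q * v) * S r) y"
  have "sw sA (\<lambda>x r. sw sA (\<lambda>p q. ?F p q r) x) b = sw sA (\<lambda>x r. sA (\<epsilon> x) (sA (\<epsilon> y) (S r))) b"
  proof -
    have "sw sA (\<lambda>p q. ?F p q r) x = sA (\<epsilon> x) (sA (\<epsilon> y) (S r))" for x r
    proof -
      \<comment> \<open>Comultiplication is multiplicative, so the sums over \<open>x\<close> and
        \<open>y\<close> merge into one over \<open>x * y\<close>, which the antipode law
        collapses.\<close>
      have "sw sA (\<lambda>p q. ?F p q r) x = sw sA (\<lambda>p q. S p * q * S r) (x * y)"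
        by (rule sw_mult[symmetric]) (intro lin)
      also have "\<dots> = sA (\<epsilon> (x * y)) (1 * S r)"
        by (rule sw_antipode_left[where g = "\<lambda>z. z * S r"]) (intro lin)
      finally show ?thesis by (simp add: counit_mult)
    qed
    thus ?thesis by simp
  qed
  also have "\<dots> = sA (\<epsilon> y) (S b)"
    by (rule sw_counit_left) (intro lin linear_scale)
  finally have 1: "sw sA (\<lambda>x r. sw sA (\<lambda>p q. ?F p q r) x) b = sA (\<epsilon> y) (S b)" .
  have "sw sA (\<lambda>x r. sw sA (\<lambda>p q. ?F p q r) x) b = sw sA (\<lambda>p x. sw sA (\<lambda>q r. ?F p q r) x) b"
    by (rule sw_coassoc) (intro lin)+
  also have "\<dots> = sw sA (\<lambda>p x. sA (\<epsilon> x) (?D p)) b"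
  proof -
    \<comment> \<open>The factor \<open>q * S r\<close> does not involve the components of
      \<open>y\<close> and leaves the inner sum; in the new bracketing it meets the antipode
      law.\<close>
    have F: "?F p q r = ?D p * (q * S r)" for p q r
    proof -
      have "?D p * (q * S r) = sw sA (\<lambda>u v. S (p * u) * v * (q * S r)) y"
        by (rule sw_apply[where f = "\<lambda>z. z * (q * S r)"]) (intro lin)+
      thus ?thesis by (simp add: ac_simps)
    qed
    have "sw sA (\<lambda>q r. ?F p q r) x = sA (\<epsilon> x) (?D p * 1)" for p x
      unfolding F by (rule sw_antipode_right) (intro lin)
    thus ?thesis by simp
  qed
  also have "\<dots> = ?D b" by (rule sw_counit_right) (intro lin)
  finally show ?thesis unfolding 1 by simp
qed

text \<open>
  Writing \<open>S(y\<^sub>1)\<^sub>1 \<otimes> S(y\<^sub>1)\<^sub>2\<close> for the comultiplication of \<open>S y\<^sub>1\<close>, the identity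
  \<open>\<Sum> S(y\<^sub>1)\<^sub>1 y\<^sub>2 \<otimes> S(y\<^sub>1)\<^sub>2 = 1 \<otimes> S y\<close>; both sides are equal to
  \<open>\<Sum> S(y\<^sub>1)\<^sub>1 y\<^sub>2 \<otimes> S(y\<^sub>1)\<^sub>2 y\<^sub>3 S y\<^sub>4\<close>.
\<close>

lemma sw_antipode_comult:
  assumes b: "bilinear_map sA sA sU \<beta>"
  shows "sw sU (\<lambda>x r. sw sU (\<lambda>u v. \<beta> (u * r) v) (S x)) y = \<beta> 1 (S y)"
proof -
  have U: "vector_space sU" by (rule linear_vs(2)[OF bilinear_left[OF b]])
  interpret U: vector_space sU by fact
  note lin = linear_mult_right linear_mult_left linear_S_compose antipode_linear linear_self bilinear_mapI
    sw_linear_param sw_linear sw_linear_compose[OF _ antipode_linear]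
    linear_compose'[OF _ bilinear_left[OF b]] linear_compose'[OF _ bilinear_right[OF b]]
  let ?F = "\<lambda>x p q s. sw sU (\<lambda>u v. \<beta> (u * p) (v * (q * S s))) (S x)"
  let ?G = "\<lambda>x p. sw sU (\<lambda>u v. \<beta> (u * p) v) (S x)"

  let ?Z = "sw sU (\<lambda>w s. sw sU (\<lambda>x z. sw sU (\<lambda>p q. ?F x p q s) z) w) y"
  have "?Z = sw sU (\<lambda>w s. sU (\<epsilon> w) (\<beta> 1 (S s))) y"
  proof -
    have "sw sU (\<lambda>x z. sw sU (\<lambda>p q. ?F x p q s) z) w = sU (\<epsilon> w) (\<beta> 1 (S s))" for w s
    proof -
      let ?b = "\<lambda>p q. \<beta> p (q * S s)"
      have b': "bilinear_map sA sA sU ?b" by (intro lin)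
      have "sw sU (\<lambda>x z. sw sU ?b (z * S x)) w = sU (\<epsilon> w) (sw sU ?b 1)"
        using sw_antipode_left[OF sw_linear[OF b'], of w] by (simp add: mult.commute)
      moreover have "sw sU ?b (z * S x) = sw sU (\<lambda>p q. ?F x p q s) z" for x z
        unfolding sw_mult[OF b'] by (simp add: ac_simps)
      ultimately show ?thesis unfolding sw_one[OF b'] by simp
    qed
    thus ?thesis by simp
  qed
  also have "\<dots> = \<beta> 1 (S y)" by (rule sw_counit_left) (intro lin)
  finally have 1: "?Z = \<beta> 1 (S y)" .
  have "?Z = sw sU (\<lambda>x w. sw sU (\<lambda>z s. sw sU (\<lambda>p q. ?F x p q s) z) w) y"
    by (rule sw_coassoc) (intro lin)+
  also have "\<dots> = sw sU (\<lambda>x w. sw sU (\<lambda>p z. sw sU (\<lambda>q s. ?F x p q s) z) w) y"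
  proof -
    have "sw sU (\<lambda>z s. sw sU (\<lambda>p q. ?F x p q s) z) w = sw sU (\<lambda>p z. sw sU (\<lambda>q s. ?F x p q s) z) w" for x w
      by (rule sw_coassoc) (intro lin)+
    thus ?thesis by simp
  qed
  also have "\<dots> = sw sU (\<lambda>x w. sw sU (\<lambda>p z. sU (\<epsilon> z) (?G x p)) w) y"
  proof -
    have "sw sU (\<lambda>q s. ?F x p q s) z = sU (\<epsilon> z) (sw sU (\<lambda>u v. \<beta> (u * p) (v * 1)) (S x))" for x p z
      by (rule sw_antipode_right[where g = "\<lambda>c. sw sU (\<lambda>u v. \<beta> (u * p) (v * c)) (S x)"]) (intro lin)
    thus ?thesis by simp
  qed
  also have "\<dots> = sw sU ?G y"
  proof -
    have "sw sU (\<lambda>p z. sU (\<epsilon> z) (?G x p)) w = ?G x w" for x w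
      by (rule sw_counit_right) (intro lin)
    thus ?thesis by simp
  qed
  finally show ?thesis unfolding 1 ..
qed

lemma sw_hom:
  assumes hom: "group_hom X A \<phi>" and X: "affine_group X"
    and b: "bilinear_map (fsmul X) (fsmul X) sU b"
  shows "sweedler X sU b (\<phi> a) = sw sU (\<lambda>x y. b (\<phi> x) (\<phi> y)) a"
proof -
  interpret X: affine_group X by fact
  have l: "Vector_Spaces.linear sA X.sA \<phi>" and c: "comult X (\<phi> a) = tmap sA sA X.sA X.sA \<phi> \<phi> (comult A a)"
    using hom unfolding group_hom_def by auto
  have U: "vector_space sU" by (rule linear_vs(2)[OF bilinear_left[OF b]])
  have b': "bilinear_map sA sA sU (\<lambda>x y. b (\<phi> x) (\<phi> y))"
    by (intro bilinear_mapI linear_compose'[OF l bilinear_left[OF b]] linear_compose'[OF l bilinear_right[OF b]])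
  note L = tlift_linear[OF X.vector_space_A X.vector_space_A U b] tlift_tens[OF X.vector_space_A X.vector_space_A U b]
  note L' = tlift_linear[OF vector_space_A vector_space_A U b'] tlift_tens[OF vector_space_A vector_space_A U b']
  show ?thesis unfolding sweedler_def c
    by (rule tensor_eqI[OF linear_compose'[OF tmap_linear[OF l l] L(1)] L'(1) _ comult_in])
      (simp only: tmap_tens[OF l l] L(2) L'(2))
qed

end

section \<open>Functions on a semidirect product\<close>

lemma
  assumes "group_hom X Y \<phi>"
  shows group_hom_linear: "Vector_Spaces.linear (fsmul Y) (fsmul X) \<phi>"
    and group_hom_one: "\<phi> 1 = 1"
    and group_hom_mult: "\<phi> (a * b) = \<phi> a * \<phi> b"
    and group_hom_counit: "counit X (\<phi> a) = counit Y a"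
    and group_hom_comult: "comult X (\<phi> a) = tmap (fsmul Y) (fsmul Y) (fsmul X) (fsmul X) \<phi> \<phi> (comult Y a)"
  using assms unfolding group_hom_def by auto

lemma module_mult: "module ((*) :: 'a::comm_ring_1 \<Rightarrow> 'a \<Rightarrow> 'a)"
  by unfold_locales (auto simp: algebra_simps)

locale semidirect = G: affine_group G + K: affine_group K + H: affine_group H
  for G :: "('f::field, 'g::comm_ring_1) hopf" and K :: "('f, 'k::comm_ring_1) hopf"
    and H :: "('f, 'h::comm_ring_1) hopf" +
  fixes i :: "'g \<Rightarrow> 'k" and s :: "'g \<Rightarrow> 'h" and p :: "'h \<Rightarrow> 'g"
  assumes semidirect: "semidirect_product G K H i s p"
begin

lemma
  shows hom_i: "group_hom K G i" and hom_p: "group_hom G H p" and hom_s: "group_hom H G s"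
    and surj_i: "surj i" and ker_i: "{x. i x = 0} = module.span (*) (p ` {y. counit H y = 0})"
    and s_p: "s (p y) = y"
  using semidirect unfolding semidirect_product_def is_group_kernel_def by (auto dest: fun_cong)

text \<open>
  The functions on \<open>G\<close> which are invariant under left translation by \<open>H\<close>, i.e. the functions
  on \<open>H \<bsol> G \<cong> K\<close>: the representation of \<open>G\<close> which restricts to the regular representation of \<open>K\<close>.
\<close>

definition H_invariant :: "'g set" where
  "H_invariant = {f. tmap G.sA G.sA H.sA G.sA s id (comult G f) = tens H.sA G.sA 1 f}"

text \<open>
  Pullback along \<open>g \<mapsto> s (p g)\<^sup>-\<^sup>1 g\<close>, the projection from \<open>G\<close> to \<open>K\<close> along the cosets of \<open>H\<close>.
\<close>

definition retract :: "'g \<Rightarrow> 'g" where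
  "retract = sweedler G G.sA (\<lambda>x z. p (antipode H (s x)) * z)"

lemmas li = group_hom_linear[OF hom_i] and lp = group_hom_linear[OF hom_p]
  and ls = group_hom_linear[OF hom_s]

lemma linear_pS: "Vector_Spaces.linear H.sA G.sA (\<lambda>y. p (antipode H y))"
  by (rule linear_compose'[OF H.antipode_linear lp])

lemmas linear_pSs = linear_compose'[OF ls linear_pS]

lemma retract_bilinear: "bilinear_map G.sA G.sA G.sA (\<lambda>x z. p (antipode H (s x)) * z)"
  by (intro bilinear_mapI G.linear_mult_right G.linear_mult_left G.linear_self linear_pSs)

lemma retract_linear: "Vector_Spaces.linear G.sA G.sA retract"
  unfolding retract_def by (rule G.sw_linear[OF retract_bilinear])

text \<open>Replacing \<open>g\<close> by \<open>h g\<close> turns \<open>s (p g)^-1 g\<close> into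
  \<open>s (p g)^-1 h^-1 h g\<close>, where \<open>h\<close> cancels. On coordinate rings this
  cancellation is \<open>H.sw_antipode_comult\<close>.\<close>

lemma retract_in: "retract f \<in> H_invariant"
proof -
  let ?q = "\<lambda>x. p (antipode H (s x))"
  let ?t = "\<lambda>u v. tens H.sA G.sA (s u) v"
  note tl = linear_tens_left[OF H.vector_space_A G.vector_space_A]
  note tr = linear_tens_right[OF H.vector_space_A G.vector_space_A]
  note lin = bilinear_mapI G.linear_mult_right G.linear_mult_left G.linear_self
    H.linear_mult_right H.linear_mult_left H.linear_self linear_pSs lp ls
    linear_compose'[OF _ tl] linear_compose'[OF _ tr] linear_compose'[OF _ ls] linear_compose'[OF _ lp]
    G.sw_linear_param H.sw_linear_param H.sw_linear
    H.sw_linear_compose[OF _ H.linear_S_compose[OF ls]] H.sw_linear_compose[OF _ H.antipode_linear]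
  have bt: "bilinear_map G.sA G.sA fscale ?t" by (intro lin)
  have T: "tmap G.sA G.sA H.sA G.sA s id (comult G f) = G.sw fscale ?t f" for f
    unfolding tmap_def sweedler_def by simp
  let ?F = "\<lambda>x z z'. H.sw fscale (\<lambda>u v. tens H.sA G.sA (u * s z) (p v * z')) (antipode H (s x))"
  have "G.sw fscale ?t (retract f) = G.sw fscale (\<lambda>x w. G.sw fscale ?t (w * ?q x)) f"
    unfolding retract_def G.sw_apply[OF retract_bilinear G.sw_linear[OF bt]] by (simp add: mult.commute)
  also have "\<dots> = G.sw fscale (\<lambda>x w. G.sw fscale (\<lambda>z z'. ?F x z z') w) f"
  proof -
    have "G.sw fscale (\<lambda>u v. ?t (z * u) (z' * v)) (?q x) = ?F x z z'" for x z z'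
    proof -
      have "G.sw fscale (\<lambda>u v. ?t (z * u) (z' * v)) (?q x) =
          H.sw fscale (\<lambda>u v. ?t (z * p u) (z' * p v)) (antipode H (s x))"
        by (rule H.sw_hom[OF hom_p G.affine_group_axioms]) (intro lin)
      thus ?thesis by (simp add: group_hom_mult[OF hom_s] s_p mult.commute)
    qed
    thus ?thesis unfolding G.sw_mult[OF bt] by simp
  qed
  also have "\<dots> = G.sw fscale (\<lambda>w z'. G.sw fscale (\<lambda>x z. ?F x z z') w) f"
    by (rule G.sw_coassoc[symmetric]) (intro lin)+
  also have "\<dots> = G.sw fscale (\<lambda>w z'. tens H.sA G.sA 1 (?q w * z')) f"
  proof -
    have "G.sw fscale (\<lambda>x z. ?F x z z') w = tens H.sA G.sA 1 (?q w * z')" for w z'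
    proof -
      let ?b = "\<lambda>u v. tens H.sA G.sA u (p v * z')"
      have b: "bilinear_map H.sA H.sA fscale ?b" by (intro lin)
      have "H.sw fscale (\<lambda>x r. H.sw fscale (\<lambda>u v. ?b (u * r) v) (antipode H x)) (s w) =
          G.sw fscale (\<lambda>x r. H.sw fscale (\<lambda>u v. ?b (u * s r) v) (antipode H (s x))) w"
        by (rule G.sw_hom[OF hom_s H.affine_group_axioms]) (intro lin)
      thus ?thesis unfolding H.sw_antipode_comult[OF b] by simp
    qed
    thus ?thesis by simp
  qed
  also have "\<dots> = tens H.sA G.sA 1 (retract f)"
    unfolding retract_def by (rule G.sw_apply[OF retract_bilinear tr, symmetric])
  finally show ?thesis unfolding H_invariant_def T by simp
qed

text \<open>The factor \<open>s (p g)^-1\<close> multiplies from the left by an element of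
  \<open>H\<close>, which an invariant function does not see.\<close>

lemma retract_H_invariant:
  assumes f: "f \<in> H_invariant" shows "retract f = f"
proof -
  let ?b = "\<lambda>y z. p (antipode H y) * z"
  have b: "bilinear_map H.sA G.sA G.sA ?b"
    by (intro bilinear_mapI G.linear_mult_right G.linear_mult_left G.linear_self linear_pS)
  note vsH = H.vector_space_A G.vector_space_A G.vector_space_A
    and vsG = G.vector_space_A G.vector_space_A G.vector_space_A
  note sid = ls G.linear_idA
  have "tlift H.sA G.sA G.sA ?b (tmap G.sA G.sA H.sA G.sA s id t) =
      tlift G.sA G.sA G.sA (\<lambda>x z. ?b (s x) z) t" if t: "t \<in> tensor_space G.sA G.sA UNIV UNIV" for t
    by (rule tensor_eqI[OF linear_compose'[OF tmap_linear[OF sid] tlift_linear[OF vsH b]]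
        tlift_linear[OF vsG retract_bilinear] _ t])
      (simp only: tmap_tens[OF sid] tlift_tens[OF vsH b] tlift_tens[OF vsG retract_bilinear] id_apply)
  from this[OF G.comult_in, of f] have "retract f = tlift H.sA G.sA G.sA ?b (tens H.sA G.sA 1 f)"
    using f unfolding retract_def sweedler_def H_invariant_def by simp
  also have "\<dots> = f"
    unfolding tlift_tens[OF vsH b] by (simp add: H.S_one group_hom_one[OF hom_p])
  finally show ?thesis .
qed

text \<open>The composite of \<open>K\<close>, \<open>G\<close> and \<open>H\<close> is trivial:
  \<open>y\<close> minus the constant \<open>counit H y\<close> lies in the augmentation ideal, and
  the image of that ideal under \<open>p\<close> is killed by \<open>i\<close>.\<close>

lemma i_p: "i (p y) = K.sA (counit H y) 1"
proof -
  interpret H: vector_space H.sA by (rule H.vector_space_A)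
  interpret ip: Vector_Spaces.linear H.sA K.sA "\<lambda>y. i (p y)" by (rule linear_compose'[OF lp li])
  interpret e: Vector_Spaces.linear H.sA "(*)" "counit H" by (rule H.counit_linear)
  let ?z = "y - H.sA (counit H y) 1"
  have "counit H ?z = 0" by (simp add: e.diff e.scale H.counit_one)
  hence "p ?z \<in> module.span (*) (p ` {y. counit H y = 0})"
    by (intro module.span_base[OF module_mult]) simp
  hence "i (p ?z) = 0" unfolding ker_i[symmetric] by simp
  thus ?thesis
    unfolding ip.diff ip.scale by (simp add: group_hom_one[OF hom_p] group_hom_one[OF hom_i])
qed

text \<open>On \<open>K\<close> the projection to \<open>H\<close> is trivial, so the map
  \<open>g \<mapsto> s (p g)^-1 g\<close> fixes \<open>K\<close>.\<close>

lemma i_retract: "i (retract f) = i f"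
proof -
  interpret K: vector_space K.sA by (rule K.vector_space_A)
  have "i (retract f) = G.sw K.sA (\<lambda>x z. K.sA (counit G x) (i z)) f"
    unfolding retract_def G.sw_apply[OF retract_bilinear li]
    by (simp add: group_hom_mult[OF hom_i] i_p H.counit_S group_hom_counit[OF hom_s]
        K.fsmul_mult[symmetric])
  also have "\<dots> = i f" by (rule G.sw_counit_left[OF li])
  finally show ?thesis .
qed

text \<open>The element \<open>s (p g)^-1 g\<close> lies over the unit of \<open>H\<close>, so a
  function pulled back from \<open>H\<close> takes the constant value \<open>counit H y\<close>
  there. \<open>H.sw_antipode_mult\<close> performs this collapse next to the other factor
  \<open>a\<close>.\<close>

lemma retract_mult_p: "retract (a * p y) = G.sA (counit H y) (retract a)"
proof -
  let ?B = "\<lambda>x z. p (antipode H (s x)) * z"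
  note lin = bilinear_mapI G.linear_mult_right G.linear_mult_left G.linear_self H.linear_self
    H.linear_mult_right H.linear_mult_left linear_pSs lp ls linear_compose'[OF _ linear_pS]
    linear_compose'[OF _ lp] linear_compose'[OF _ ls] H.antipode_linear H.linear_S_compose
  have "G.sw G.sA (\<lambda>u v. ?B (x * u) (z * v)) (p y) = G.sA (counit H y) (?B x z)" for x z
  proof -
    interpret p: Vector_Spaces.linear H.sA G.sA p by (rule lp)
    have "G.sw G.sA (\<lambda>u v. ?B (x * u) (z * v)) (p y) = H.sw G.sA (\<lambda>u v. ?B (x * p u) (z * p v)) y"
      by (rule H.sw_hom[OF hom_p G.affine_group_axioms]) (intro lin)
    also have "\<dots> = H.sw G.sA (\<lambda>u v. p (antipode H (s x * u) * v) * z) y"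
      by (simp add: group_hom_mult[OF hom_s] group_hom_mult[OF hom_p] s_p ac_simps)
    also have "\<dots> = p (H.sw H.sA (\<lambda>u v. antipode H (s x * u) * v) y) * z"
      by (rule H.sw_apply[where f = "\<lambda>w. p w * z", symmetric]) (intro lin)+
    finally show ?thesis unfolding H.sw_antipode_mult p.scale by (simp add: G.fsmul_mult)
  qed
  hence "retract (a * p y) = G.sw G.sA (\<lambda>x z. G.sA (counit H y) (?B x z)) a"
    unfolding retract_def G.sw_mult[OF retract_bilinear] by simp
  also have "\<dots> = G.sA (counit H y) (retract a)"
    unfolding retract_def
    by (rule G.sw_apply[OF retract_bilinear linear_scale[OF G.linear_self], symmetric])
  finally show ?thesis .
qed

lemma retract_kernel:
  assumes "i f = 0" shows "retract f = 0"
proof -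
  interpret G: vector_space G.sA by (rule G.vector_space_A)
  interpret m: module "(*) :: 'g \<Rightarrow> 'g \<Rightarrow> 'g" by (rule module_mult)
  interpret r: Vector_Spaces.linear G.sA G.sA retract by (rule retract_linear)
  have "f \<in> m.span (p ` {y. counit H y = 0})" using assms ker_i by auto
  thus ?thesis
    by (induction rule: m.span_induct_alt) (auto simp: r.zero r.add retract_mult_p)
qed

text \<open>An invariant function is its own retract, and by \<open>retract_kernel\<close> the
  retract depends only on the restriction to \<open>K\<close>.\<close>

lemma inj_on_i: "inj_on i H_invariant"
proof (rule inj_onI)
  fix f g assume fg: "f \<in> H_invariant" "g \<in> H_invariant" "i f = i g"
  interpret r: Vector_Spaces.linear G.sA G.sA retract by (rule retract_linear)
  interpret i: Vector_Spaces.linear G.sA K.sA i by (rule li)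
  have "retract (f - g) = 0" by (rule retract_kernel) (simp add: i.diff fg)
  thus "f = g" using fg by (simp add: r.diff retract_H_invariant)
qed

lemma i_H_invariant: "i ` H_invariant = UNIV"
  using retract_in i_retract surj_i by (metis image_eqI surjD UNIV_eq_I)

text \<open>Left translation by \<open>H\<close> commutes with right translation by
  \<open>G\<close>, which is coassociativity. As \<open>H_invariant\<close> is the kernel of the
  linear map \<open>?d\<close>, \<open>tensor_preimage\<close> turns the vanishing of
  \<open>?d \<otimes> id\<close> on \<open>comult G f\<close> into the second claim.\<close>

lemma
  shows subspace_H_invariant: "module.subspace G.sA H_invariant"
    and comult_H_invariant: "f \<in> H_invariant \<Longrightarrow> comult G f \<in> G.E G.sA H_invariant"
proof -
  interpret GV: vector_space G.sA by (rule G.vector_space_A)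
  let ?s = "G.T G.sA H.sA s" and ?t = "tens H.sA G.sA 1"
  let ?d = "\<lambda>f. ?s (comult G f) - ?t f"
  note tr = linear_tens_right[OF H.vector_space_A G.vector_space_A]
  note l1 = linear_compose'[OF G.comult_linear G.T_linear[OF ls]]
  have d: "Vector_Spaces.linear G.sA fscale ?d" by (rule linear_fun_add_diff(2)[OF l1 tr])
  have L: "H_invariant = {f \<in> UNIV. ?d f \<in> {0}}" unfolding H_invariant_def by auto
  note U = GV.subspace_UNIV
  have Z: "fs.subspace {0}" by simp
  show "module.subspace G.sA H_invariant"
    unfolding L by (rule linear_preimage_subspace[OF d U Z])
  assume f: "f \<in> H_invariant"
  have *: "G.T G.sA fscale ?d t = G.T fscale fscale ?s (G.T G.sA fscale (comult G) t) - G.T G.sA fscale ?t t"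
    if t: "t \<in> G.E G.sA UNIV" for t
    by (rule tensor_eqI[OF G.T_linear[OF d] linear_fun_add_diff(2)[OF linear_compose'[OF
              G.T_linear[OF G.comult_linear] G.T_linear[OF G.T_linear[OF ls]]] G.T_linear[OF tr]] _ t])
      (simp only: G.T_tens[OF d] G.T_tens[OF G.comult_linear] G.T_tens[OF G.T_linear[OF ls]] G.T_tens[OF tr]
        module_hom.diff[OF module_hom_linearI[OF linear_tens_left[OF vector_space_fscale G.vector_space_A]]])
  have "G.T G.sA fscale ?d (comult G f) = G.C H.sA (?s (comult G f)) - G.T G.sA fscale ?t (comult G f)"
    unfolding *[OF G.comult_in] G.coassoc G.C_T[OF ls G.comult_in] ..
  also have "\<dots> = 0"
    using f unfolding H_invariant_def by (simp add: G.C_tens[OF H.vector_space_A])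
  finally have "G.T G.sA fscale ?d (comult G f) \<in> G.E fscale {0}"
    using fs.subspace_0[OF subspace_tensor_space] by simp
  from tensor_preimage[OF d G.vector_space_A U Z G.comult_in this]
  show "comult G f \<in> G.E G.sA H_invariant" unfolding L .
qed

end

section \<open>Invariants and cocycles\<close>

context affine_group
begin

lemma tens_1_eq_iff:
  assumes "vector_space sV" shows "tens sV sA v 1 = tens sV sA w 1 \<longleftrightarrow> v = w"
proof -
  interpret V: vector_space sV by fact
  have "h sV (tens sV sA v 1) = v" for v unfolding h_tens[OF assms] counit_one by (rule V.scale_one)
  thus ?thesis by metis
qed

lemma tens_1_0:
  assumes "vector_space sV" shows "tens sV sA 0 1 = 0"
  by (rule module_hom.zero[OF module_hom_linearI[OF linear_tens_left[OF assms vector_space_A]]])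

lemma tens_1_diff:
  assumes "vector_space sV" shows "tens sV sA (v - w) a = tens sV sA v a - tens sV sA w a"
  by (rule module_hom.diff[OF module_hom_linearI[OF linear_tens_left[OF assms vector_space_A]]])

lemma C_tens_1: "vector_space sV \<Longrightarrow> C sV (tens sV sA v 1) = tens fscale sA (tens sV sA v 1) 1"
  by (simp add: C_tens comult_one T_tens linear_tens1)

text \<open>Contracting the middle factor of the coaction with the counit gives back
  \<open>t\<close> by \<open>T_h_C\<close>. For invariant \<open>t\<close> the coaction is
  \<open>t \<otimes> 1\<close>, and the same contraction yields a tensor of the form
  \<open>v \<otimes> 1\<close>.\<close>

lemma invariants_cofree:
  assumes "vector_space (smul V)" "module.subspace (smul V) (vec V)"
  shows "invariants A (cofree A V) = (\<lambda>v. tens (smul V) sA v 1) ` vec V"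
proof (intro equalityI subsetI)
  fix t assume "t \<in> invariants A (cofree A V)"
  hence t: "t \<in> E (smul V) (vec V)" "C (smul V) t = tens fscale sA t 1"
    unfolding invariants_def cofree_simps by auto
  have "t = tens (smul V) sA (h (smul V) t) 1"
    using T_h_C[OF assms(1) t(1)] unfolding t(2) T_tens[OF h_linear[OF assms(1)]] by simp
  thus "t \<in> (\<lambda>v. tens (smul V) sA v 1) ` vec V" using h_in[OF assms t(1)] by blast
next
  fix t assume "t \<in> (\<lambda>v. tens (smul V) sA v 1) ` vec V"
  thus "t \<in> invariants A (cofree A V)"
    unfolding invariants_def cofree_simps by (auto simp: C_tens_1[OF assms(1)] intro: tens_in)
qed

end

text \<open>Inhomogeneous 1-cocycles: with \<open>t\<close> read as a map \<open>c\<close> from the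
  group to \<open>V\<close>, the equation is that of a crossed homomorphism,
  \<open>c (g h) = c g + g (c h)\<close>.\<close>

definition cocycles ::
  "('f::field, 'a::comm_ring_1) hopf \<Rightarrow> ('f, 'v::ab_group_add, 'a) comod \<Rightarrow> ('f, 'v, 'a) tensor set" where
  "cocycles A V = {t \<in> tensor_space (smul V) (fsmul A) (vec V) UNIV.
     tensor_comult A (smul V) t =
     tens fscale (fsmul A) t 1 + tmap (smul V) (fsmul A) fscale (fsmul A) (coact V) id t}"

text \<open>The crossed homomorphism \<open>g \<mapsto> v - g v\<close>, with the sign that
  \<open>res_d0\<close> produces from \<open>v \<otimes> 1\<close>.\<close>

definition coboundary ::
  "('f::field, 'a::comm_ring_1) hopf \<Rightarrow> ('f, 'v::ab_group_add, 'a) comod \<Rightarrow> 'v \<Rightarrow> ('f, 'v, 'a) tensor" where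
  "coboundary A V v = tens (smul V) (fsmul A) v 1 - coact V v"

context representation
begin

lemma res_d0_tens_1: "res_d0 A V (tens (smul V) sA v 1) = tens fscale sA (coboundary A V v) 1"
  unfolding res_d0_def cofree_simps coboundary_def C_tens_1[OF vector_space_V] T_tens[OF coact_linear]
    tens_1_diff[OF fscale_vs] ..

lemma R0_Gamma_eq: "R0_Gamma A V = (\<lambda>v. tens (smul V) sA v 1) ` invariants A V"
proof -
  have "res_d0 A V (tens (smul V) sA v 1) = 0 \<longleftrightarrow> coact V v = tens (smul V) sA v 1" for v
    using tens_1_eq_iff[OF fscale_vs, of "coboundary A V v" 0]
    unfolding res_d0_tens_1 tens_1_0[OF fscale_vs] coboundary_def right_minus_eq by metis
  thus ?thesis
    unfolding R0_Gamma_def invariants_cofree[OF vector_space_V subspace_vec]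
    unfolding invariants_def by blast
qed

lemma coboundary_rel_eq:
  "coboundary_rel A V = {(x, y). \<exists>v\<in>vec V. x - y = tens fscale sA (coboundary A V v) 1}"
  unfolding coboundary_rel_def invariants_cofree[OF vector_space_V subspace_vec] image_image
    res_d0_tens_1 image_iff ..

lemma coboundary_0: "coboundary A V 0 = 0"
  unfolding coboundary_def
  unfolding tens_1_0[OF vector_space_V] module_hom.zero[OF module_hom_linearI[OF coact_linear]]
  by (rule diff_self)

text \<open>Passing from homogeneous to inhomogeneous cochains: the invariants are the tensors
  \<open>t \<otimes> 1\<close>, and cancelling the last factor \<open>1\<close> in the equation
  \<open>res_d1 = 0\<close> leaves the crossed homomorphism equation.\<close>

lemma cocycles_eq:
  "{t \<in> invariants A (cofree A (cofree A V)). res_d1 A V t = 0} = (\<lambda>t. tens fscale sA t 1) ` cocycles A V"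
proof -
  have inv: "invariants A (cofree A (cofree A V)) = (\<lambda>t. tens fscale sA t 1) ` E (smul V) (vec V)"
    using invariants_cofree[of "cofree A V", unfolded cofree_simps, OF fscale_vs subspace_tensor_space] .
  have "res_d1 A V (tens fscale sA t 1) = 0 \<longleftrightarrow>
      C (smul V) t = tens fscale sA t 1 + T (smul V) fscale (coact V) t" for t
  proof -
    have "res_d1 A V (tens fscale sA t 1) =
        tens fscale sA (tens fscale sA t 1) 1 - tens fscale sA (C (smul V) t) 1
        + tens fscale sA (T (smul V) fscale (coact V) t) 1"
      unfolding res_d1_def cofree_simps C_tens_1[OF fscale_vs] T_tens[OF C_linear[OF vector_space_V]]
        T_tens[OF T_linear[OF coact_linear]] ..
    also have "\<dots> = tens fscale sA (tens fscale sA t 1 + T (smul V) fscale (coact V) t) 1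
        - tens fscale sA (C (smul V) t) 1"
      unfolding tens_add_left[OF fscale_vs vector_space_A] by (rule diff_add_eq)
    finally have "res_d1 A V (tens fscale sA t 1) =
        tens fscale sA (tens fscale sA t 1 + T (smul V) fscale (coact V) t) 1
        - tens fscale sA (C (smul V) t) 1" .
    hence "res_d1 A V (tens fscale sA t 1) = 0 \<longleftrightarrow>
        tens fscale sA t 1 + T (smul V) fscale (coact V) t = C (smul V) t"
      by (simp only: right_minus_eq tens_1_eq_iff[OF fscale_vs])
    thus ?thesis by (rule trans[OF _ eq_commute])
  qed
  thus ?thesis unfolding inv cocycles_def by blast
qed

end

section \<open>Restriction of representations\<close>

lemma
  assumes X: "affine_group X" and Y: "affine_group Y" and \<phi>: "group_hom X Y \<phi>" and V: "vector_space sV"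
    and t: "t \<in> tensor_space sV (fsmul Y) V UNIV"
  shows comult_restrict: "tensor_comult X sV (tmap sV (fsmul Y) sV (fsmul X) id \<phi> t) =
      tmap fscale (fsmul Y) fscale (fsmul X) (tmap sV (fsmul Y) sV (fsmul X) id \<phi>) \<phi> (tensor_comult Y sV t)"
    and counit_restrict:
      "tensor_counit X sV (tmap sV (fsmul Y) sV (fsmul X) id \<phi> t) = tensor_counit Y sV t"
proof -
  interpret X: affine_group X by fact
  interpret Y: affine_group Y by fact
  note l\<phi> = group_hom_linear[OF \<phi>]
  note \<Phi> = tmap_linear[OF linear_id'[OF V] l\<phi>] tmap_tens[OF linear_id'[OF V] l\<phi>]
  note tX = X.linear_tens1[OF V] and tY = Y.linear_tens1[OF V]
  show "tensor_comult X sV (tmap sV (fsmul Y) sV (fsmul X) id \<phi> t) =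
      tmap fscale (fsmul Y) fscale (fsmul X) (tmap sV (fsmul Y) sV (fsmul X) id \<phi>) \<phi> (tensor_comult Y sV t)"
  proof (rule tensor_eqI[OF linear_compose'[OF \<Phi>(1) X.C_linear[OF V]]
        linear_compose'[OF Y.C_linear[OF V] tmap_linear[OF \<Phi>(1) l\<phi>]] _ t])
    fix v a
    show "X.C sV (tmap sV Y.sA sV X.sA id \<phi> (tens sV Y.sA v a)) =
      tmap fscale Y.sA fscale X.sA (tmap sV Y.sA sV X.sA id \<phi>) \<phi> (Y.C sV (tens sV Y.sA v a))"
      unfolding \<Phi>(2) X.C_tens[OF V] Y.C_tens[OF V] group_hom_comult[OF \<phi>]
        tmap_tmap[OF l\<phi> l\<phi> tX X.linear_idA Y.comult_in] tmap_tmap[OF tY Y.linear_idA \<Phi>(1) l\<phi> Y.comult_in]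
        id_apply ..
  qed
  show "tensor_counit X sV (tmap sV (fsmul Y) sV (fsmul X) id \<phi> t) = tensor_counit Y sV t"
    by (rule tensor_eqI[OF linear_compose'[OF \<Phi>(1) X.h_linear[OF V]] Y.h_linear[OF V] _ t])
      (simp add: \<Phi>(2) X.h_tens[OF V] Y.h_tens[OF V] group_hom_counit[OF \<phi>])
qed

lemma restrict_rep_simps:
  "vec (restrict_rep X Y \<phi> V) = vec V" "smul (restrict_rep X Y \<phi> V) = smul V"
  "coact (restrict_rep X Y \<phi> V) v = tmap (smul V) (fsmul Y) (smul V) (fsmul X) id \<phi> (coact V v)"
  by (simp_all add: restrict_rep_def)

lemma representation_restrict:
  assumes X: "affine_group X" and \<phi>: "group_hom X Y \<phi>" and V: "representation Y V"
  shows "representation X (restrict_rep X Y \<phi> V)"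
proof -
  interpret X: affine_group X by fact
  interpret V: representation Y V by fact
  note l\<phi> = group_hom_linear[OF \<phi>] and lid = linear_id'[OF V.vector_space_V]
  let ?\<Phi> = "tmap (smul V) V.sA (smul V) X.sA id \<phi>"
  note \<Phi> = tmap_linear[OF lid l\<phi>]
  note lc = linear_compose'[OF V.coact_linear \<Phi>]
  have cf: "coact (restrict_rep X Y \<phi> V) = (\<lambda>v. ?\<Phi> (coact V v))"
    by (simp add: fun_eq_iff restrict_rep_simps)
  show ?thesis
  proof (intro representation.intro representation_axioms.intro X; unfold restrict_rep_simps(1,2) cf)
    show "vector_space (smul V)" "module.subspace (smul V) (vec V)"
      by (fact V.vector_space_V V.subspace_vec)+
    show "Vector_Spaces.linear (smul V) fscale (\<lambda>v. ?\<Phi> (coact V v))" by (rule lc)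
    fix v assume v: "v \<in> vec V"
    show "?\<Phi> (coact V v) \<in> X.E (smul V) (vec V)"
      by (rule tmap_in[OF lid l\<phi> _ _ V.coact_in[OF v]]) auto
    show "X.h (smul V) (?\<Phi> (coact V v)) = v"
      unfolding counit_restrict[OF X V.affine_group_axioms \<phi> V.vector_space_V V.coact_in[OF v]]
      by (rule V.coact_counit[OF v])
    show "X.T (smul V) fscale (\<lambda>v. ?\<Phi> (coact V v)) (?\<Phi> (coact V v)) = X.C (smul V) (?\<Phi> (coact V v))"
      unfolding comult_restrict[OF X V.affine_group_axioms \<phi> V.vector_space_V V.coact_in[OF v]]
        V.coact_coassoc[OF v, symmetric] tmap_tmap[OF V.coact_linear V.linear_idA \<Phi> l\<phi> V.coact_in[OF v]]
        tmap_tmap[OF lid l\<phi> lc X.linear_idA V.coact_in[OF v]]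
      by simp
  qed
qed

lemma diff_eq_swap: "a - b = c \<Longrightarrow> b = a - (c :: 'a::ab_group_add)"
  by auto

text \<open>
  In the next two lemmas \<open>W\<close> is \<open>V\<close> restricted along \<open>\<phi>\<close>; it may differ from \<open>restrict_rep X Y \<phi> V\<close>
  in the values of the coaction outside of \<open>vec V\<close>.
\<close>

lemma R0_map_surj:
  assumes V: "representation Y V" and W: "representation X W" and \<phi>: "group_hom X Y \<phi>"
    and WV: "smul W = smul V"
    and surj: "R0_Gamma X W \<subseteq> R0_map X Y \<phi> V ` R0_Gamma Y V"
  shows "invariants X W \<subseteq> invariants Y V"
proof
  interpret V: representation Y V by fact
  interpret W: representation X W by fact
  note lid = linear_id'[OF V.vector_space_V]
  fix v assume "v \<in> invariants X W"
  hence "tens (smul V) W.sA v 1 \<in> R0_map X Y \<phi> V ` R0_Gamma Y V"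
    using surj unfolding W.R0_Gamma_eq WV by auto
  then obtain w where w: "w \<in> invariants Y V"
    "tens (smul V) W.sA v 1 = R0_map X Y \<phi> V (tens (smul V) V.sA w 1)"
    unfolding V.R0_Gamma_eq by auto
  have "tens (smul V) W.sA v 1 = tens (smul V) W.sA w 1"
    unfolding w(2) R0_map_def res_map0_def tmap_tens[OF lid group_hom_linear[OF \<phi>]]
    by (simp add: group_hom_one[OF \<phi>])
  thus "v \<in> invariants Y V" using w W.tens_1_eq_iff[OF V.vector_space_V] by simp
qed

lemma R1_map_surj:
  assumes V: "representation Y V" and W: "representation X W" and \<phi>: "group_hom X Y \<phi>"
    and WV: "vec W = vec V" "smul W = smul V"
      "\<And>v. v \<in> vec V \<Longrightarrow> coact W v = tmap (smul V) (fsmul Y) (smul V) (fsmul X) id \<phi> (coact V v)"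
    and surj: "R1_Gamma X W \<subseteq> R1_map X Y \<phi> V ` R1_Gamma Y V"
    and z: "z \<in> cocycles X W"
  shows "\<exists>z'\<in>cocycles Y V. \<exists>v\<in>vec V.
    z = tmap (smul V) (fsmul Y) (smul V) (fsmul X) id \<phi> z' + coboundary X W v"
proof -
  interpret V: representation Y V by fact
  interpret W: representation X W by fact
  interpret R: representation X "restrict_rep X Y \<phi> V"
    by (rule representation_restrict[OF W.affine_group_axioms \<phi> V])
  note lid = linear_id'[OF V.vector_space_V] and l\<phi> = group_hom_linear[OF \<phi>]
  let ?\<Phi> = "tmap (smul V) V.sA (smul V) W.sA id \<phi>"
  let ?t = "\<lambda>t. tens fscale W.sA t 1" and ?u = "\<lambda>t. tens fscale V.sA t 1"
  have cb: "coboundary X (restrict_rep X Y \<phi> V) v = coboundary X W v" if "v \<in> vec V" for v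
    unfolding coboundary_def restrict_rep_simps WV(2) WV(3)[OF that] ..
  have rel: "coboundary_rel X (restrict_rep X Y \<phi> V) = coboundary_rel X W"
    unfolding R.coboundary_rel_eq W.coboundary_rel_eq restrict_rep_simps(1) WV(1)
    using cb by force
  have map1: "res_map1 X Y \<phi> V (?u t) = ?t (?\<Phi> t)" for t
    unfolding res_map1_def res_map0_def tmap_tens[OF tmap_linear[OF lid l\<phi>] l\<phi>]
    by (simp add: group_hom_one[OF \<phi>])
  have "coboundary_rel X W `` {?t z} \<in> R1_Gamma X W"
    unfolding R1_Gamma_def W.cocycles_eq using z by (blast intro: quotientI)
  then obtain c where c: "c \<in> R1_Gamma Y V" "coboundary_rel X W `` {?t z} = R1_map X Y \<phi> V c"
    using surj by auto
  obtain y where y: "y \<in> cocycles Y V" "c = coboundary_rel Y V `` {?u y}"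
    using c(1) unfolding R1_Gamma_def V.cocycles_eq quotient_def by auto
  interpret VV: vector_space "smul V" by (rule V.vector_space_V)
  \<comment> \<open>The coboundary of \<open>0\<close> shows that \<open>?t z\<close> belongs to its
    own class. It is therefore related to the image of some \<open>x\<close> in \<open>c\<close>,
    and \<open>x\<close> in turn to the representative \<open>y\<close>.\<close>
  have "0 \<in> vec W" unfolding WV(1) by (rule VV.subspace_0[OF V.subspace_vec])
  moreover have "?t z - ?t z = ?t (coboundary X W 0)"
    unfolding W.coboundary_0 W.tens_1_0[OF vector_space_fscale] by (rule diff_self)
  ultimately have "?t z \<in> coboundary_rel X W `` {?t z}"
    unfolding W.coboundary_rel_eq by blast
  hence "?t z \<in> coboundary_rel X W `` (res_map1 X Y \<phi> V ` c)"
    unfolding c(2) R1_map_def rel .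
  then obtain x v where x: "x \<in> c" and v: "v \<in> vec V" "res_map1 X Y \<phi> V x - ?t z = ?t (coboundary X W v)"
    unfolding W.coboundary_rel_eq WV(1) by auto
  obtain w where w: "w \<in> vec V" "?u y - x = ?u (coboundary Y V w)"
    using x unfolding y(2) V.coboundary_rel_eq by auto
  note vs = vector_space_fscale
  interpret \<Phi>: Vector_Spaces.linear fscale fscale ?\<Phi> by (rule tmap_linear[OF lid l\<phi>])
  have "x = ?u y - ?u (coboundary Y V w)" by (rule diff_eq_swap[OF w(2)])
  hence x': "x = ?u (y - coboundary Y V w)" unfolding V.tens_1_diff[OF vs] .
  have "?t z = ?t (?\<Phi> (y - coboundary Y V w)) - ?t (coboundary X W v)"
    by (rule diff_eq_swap[OF v(2)[unfolded x' map1]])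
  hence "z = ?\<Phi> (y - coboundary Y V w) - coboundary X W v"
    unfolding W.tens_1_diff[OF vs, symmetric] W.tens_1_eq_iff[OF vs] .
  also have "?\<Phi> (coboundary Y V w) = coboundary X W w"
    unfolding coboundary_def \<Phi>.diff tmap_tens[OF lid l\<phi>] WV(2) WV(3)[OF w(1)]
    by (simp add: group_hom_one[OF \<phi>])
  hence "?\<Phi> (y - coboundary Y V w) - coboundary X W v = ?\<Phi> y + - (coboundary X W w + coboundary X W v)"
    unfolding \<Phi>.diff diff_diff_eq by (simp only: diff_conv_add_uminus)
  \<comment> \<open>The two corrections, one from replacing \<open>x\<close> by \<open>y\<close> and
    one from comparing images, combine into the coboundary of a single vector.\<close>
  also have "- (coboundary X W w + coboundary X W v) = coboundary X W (- (w + v))"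
  proof -
    have l: "Vector_Spaces.linear (smul W) fscale (coboundary X W)"
      unfolding coboundary_def
      by (rule linear_fun_add_diff(2)[OF linear_tens_left[OF W.vector_space_V W.vector_space_A] W.coact_linear])
    show ?thesis
      unfolding module_hom.neg[OF module_hom_linearI[OF l]] module_hom.add[OF module_hom_linearI[OF l]] ..
  qed
  finally have "z = ?\<Phi> y + coboundary X W (- (w + v))" .
  moreover have "- (w + v) \<in> vec V"
    by (intro VV.subspace_neg VV.subspace_add V.subspace_vec v(1) w(1))
  ultimately show ?thesis using y(1) by blast
qed

section \<open>Local finiteness\<close>

lemma (in representation) representation_subspace:
  assumes "module.subspace (smul V) U" "U \<subseteq> vec V" "\<And>u. u \<in> U \<Longrightarrow> coact V u \<in> E (smul V) U"
  shows "representation A (V\<lparr>vec := U\<rparr>)"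
  by (intro representation.intro representation_axioms.intro affine_group_axioms)
    (use assms vector_space_V coact_linear coact_coassoc coact_counit in auto)

text \<open>The span of all slices of the coactions of the elements of \<open>X\<close> is a subrepresentation.\<close>

lemma (in representation) locally_finite:
  assumes X: "finite X" "X \<subseteq> vec V"
  obtains U where "module.subspace (smul V) U" "U \<subseteq> vec V" "X \<subseteq> U"
    "\<exists>B. finite B \<and> module.span (smul V) B = U" "\<And>u. u \<in> U \<Longrightarrow> coact V u \<in> E (smul V) U"
proof -
  note sV = vector_space_V
  interpret V: vector_space "smul V" by (rule sV)
  let ?sl = "slice (smul V) sA"
  define Z where "Z = {?sl l (coact V x) | l x. Vector_Spaces.linear sA (*) l \<and> x \<in> X}"
  have XV: "x \<in> vec V" if "x \<in> X" for x using that X by auto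
  let ?P = "\<lambda>x (B, w). finite B \<and> coact V x = (\<Sum>b\<in>B. tens (smul V) sA (w b) b) \<and>
      (\<forall>b\<in>B. \<exists>l. Vector_Spaces.linear sA (*) l \<and> w b = ?sl l (coact V x))"
  have "\<forall>x\<in>X. \<exists>c. ?P x c"
  proof
    fix x assume "x \<in> X"
    then obtain B w where "finite B" "coact V x = (\<Sum>b\<in>B. tens (smul V) sA (w b) b)"
      "\<And>b. b \<in> B \<Longrightarrow> \<exists>l. Vector_Spaces.linear sA (*) l \<and> w b = ?sl l (coact V x)"
      using tensor_space_coefficients[OF sV vector_space_A subspace_vec coact_in[OF XV]] by blast
    thus "\<exists>c. ?P x c" by (intro exI[of _ "(B, w)"]) blast
  qed
  from bchoice[OF this] obtain c where c: "\<forall>x\<in>X. ?P x (c x)" by blast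
  define B w where "B x = fst (c x)" and "w x = snd (c x)" for x
  have B: "finite (B x)" "coact V x = (\<Sum>b\<in>B x. tens (smul V) sA (w x b) b)"
    "\<And>b. b \<in> B x \<Longrightarrow> \<exists>l. Vector_Spaces.linear sA (*) l \<and> w x b = ?sl l (coact V x)" if "x \<in> X" for x
    using c[rule_format, OF that] unfolding B_def w_def case_prod_beta by blast+
  \<comment> \<open>Finite generation: every slice of \<open>coact V x\<close> is a combination of
    the finitely many coefficients \<open>w x b\<close>, which are slices themselves.\<close>
  let ?W = "\<Union>x\<in>X. w x ` B x"
  have "?W \<subseteq> Z" using B(3) unfolding Z_def by fast
  moreover have "Z \<subseteq> V.span ?W"
  proof
    fix z assume "z \<in> Z"
    then obtain l x where z: "Vector_Spaces.linear sA (*) l" "x \<in> X" "z = ?sl l (coact V x)"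
      unfolding Z_def by auto
    interpret sl: Vector_Spaces.linear fscale "smul V" "?sl l" by (rule slice_linear[OF sV z(1)])
    have "z = (\<Sum>b\<in>B x. smul V (l b) (w x b))"
      unfolding z(3) B(2)[OF z(2)] sl.sum slice_tens[OF sV z(1)] ..
    also have "\<dots> \<in> V.span ?W"
      using z(2) by (intro V.span_sum V.span_scale V.span_base) auto
    finally show "z \<in> V.span ?W" .
  qed
  ultimately have span: "V.span ?W = V.span Z"
    by (intro subset_antisym V.span_mono V.span_minimal V.subspace_span)
  \<comment> \<open>Slicing after comultiplication amounts to applying
    \<open>slice l \<circ> \<Delta>\<close> to the last factor. With coassociativity, every slice of
    the coaction of a slice is again a slice of an original coaction.\<close>
  have slC: "slice fscale sA l (C (smul V) t) = tmap (smul V) sA (smul V) sA id (\<lambda>a. slice sA sA l (comult A a)) t"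
    if l: "Vector_Spaces.linear sA (*) l" and t: "t \<in> E (smul V) (vec V)" for l t
  proof (rule tensor_eqI[OF _ _ _ t])
    note lL = linear_compose'[OF comult_linear slice_linear[OF vector_space_A l]]
    note lid = linear_id'[OF sV]
    show "Vector_Spaces.linear fscale fscale (\<lambda>t. slice fscale sA l (C (smul V) t))"
      by (rule linear_compose'[OF C_linear[OF sV] slice_linear[OF fscale_vs l]])
    show "Vector_Spaces.linear fscale fscale (tmap (smul V) sA (smul V) sA id (\<lambda>a. slice sA sA l (comult A a)))"
      by (rule tmap_linear[OF lid lL])
    show "slice fscale sA l (C (smul V) (tens (smul V) sA v a)) =
        tmap (smul V) sA (smul V) sA id (\<lambda>a. slice sA sA l (comult A a)) (tens (smul V) sA v a)" for v a
      unfolding C_tens[OF sV] tmap_tens[OF lid lL]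
        slice_tmap[OF linear_tens1[OF sV] linear_idA l comult_in] by simp
  qed
  show ?thesis
  proof (rule that[of "V.span Z"])
    show "V.subspace (V.span Z)" by (rule V.subspace_span)
    show "V.span Z \<subseteq> vec V"
      unfolding Z_def using slice_in[OF sV vector_space_A _ subspace_vec coact_in[OF XV]]
      by (intro V.span_minimal[OF _ subspace_vec]) blast
    \<comment> \<open>Slicing with the counit returns \<open>x\<close>.\<close>
    have "x \<in> Z" if x: "x \<in> X" for x
    proof -
      have "x = ?sl (counit A) (coact V x)"
        using coact_counit[OF XV[OF x], symmetric] unfolding slice_def tensor_counit_def .
      thus ?thesis unfolding Z_def using x counit_linear by blast
    qed
    thus "X \<subseteq> V.span Z" using V.span_base by blast
    have "finite ?W" using X(1) B(1) by blast
    thus "\<exists>B. finite B \<and> V.span B = V.span Z" using span by blast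
    have Zst: "coact V z \<in> E (smul V) (V.span Z)" if "z \<in> Z" for z
    proof -
      obtain l x where z: "Vector_Spaces.linear sA (*) l" "x \<in> X" "z = ?sl l (coact V x)"
        using \<open>z \<in> Z\<close> unfolding Z_def by auto
      note cx = coact_in[OF XV[OF z(2)]]
      have "coact V z = slice fscale sA l (T (smul V) fscale (coact V) (coact V x))"
        unfolding z(3) using slice_tmap[OF coact_linear linear_idA z(1) cx] by simp
      also have "\<dots> = tmap (smul V) sA (smul V) sA id (\<lambda>a. slice sA sA l (comult A a)) (coact V x)"
        unfolding coact_coassoc[OF XV[OF z(2)]] by (rule slC[OF z(1) cx])
      also have "\<dots> \<in> E (smul V) (V.span Z)"
      proof (rule tensor_in_slices[OF sV vector_space_A subspace_vec V.subspace_span])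
        note lL = linear_compose'[OF comult_linear slice_linear[OF vector_space_A z(1)]]
        note lid = linear_id'[OF sV]
        show "tmap (smul V) sA (smul V) sA id (\<lambda>a. slice sA sA l (comult A a)) (coact V x) \<in> E (smul V) (vec V)"
          by (rule tmap_in[OF lid lL _ _ cx]) auto
        fix m :: "'a \<Rightarrow> 'f" assume m: "Vector_Spaces.linear sA (*) m"
        have "?sl (\<lambda>a. m (slice sA sA l (comult A a))) (coact V x) \<in> Z"
          unfolding Z_def using linear_compose'[OF lL m] z(2) by blast
        thus "?sl m (tmap (smul V) sA (smul V) sA id (\<lambda>a. slice sA sA l (comult A a)) (coact V x)) \<in> V.span Z"
          unfolding slice_tmap[OF lid lL m cx] id_apply by (rule V.span_base)
      qed
      finally show ?thesis .
    qed
    fix u assume "u \<in> V.span Z"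
    thus "coact V u \<in> E (smul V) (V.span Z)"
    proof (induction rule: V.span_induct_alt)
      case base
      show ?case unfolding module_hom.zero[OF module_hom_linearI[OF coact_linear]]
        by (rule fs.subspace_0[OF subspace_tensor_space])
    next
      case (step c x y)
      show ?case
        unfolding module_hom.add[OF module_hom_linearI[OF coact_linear]]
          module_hom.scale[OF module_hom_linearI[OF coact_linear]]
        by (intro fs.subspace_add[OF subspace_tensor_space] fs.subspace_scale[OF subspace_tensor_space] Zst step)
    qed
  qed
qed

section \<open>Moving finite-dimensional representations into \<open>Rep\<close>\<close>

lemma finite_dimensional_embedding:
  fixes sV :: "'f::field \<Rightarrow> 'v::ab_group_add \<Rightarrow> 'v"
  assumes V: "vector_space sV" and B: "finite B"
  obtains e where "Vector_Spaces.linear sV fscale (e :: 'v \<Rightarrow> nat \<Rightarrow> 'f)" "inj_on e (module.span sV B)"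
proof -
  interpret V: vector_space sV by fact
  obtain D where D: "D \<subseteq> B" "V.independent D" "B \<subseteq> V.span D"
    using V.maximal_independent_subset[of B] by blast
  have fD: "finite D" using D(1) B finite_subset by blast
  obtain \<beta> where \<beta>: "bij_betw \<beta> {0..<card D} D" using ex_bij_betw_nat_finite[OF fD] by blast
  have "\<exists>l. Vector_Spaces.linear sV (*) l \<and> (\<forall>b'\<in>D. l b' = (if b' = b then 1 else 0))" if "b \<in> D" for b
    using dual_functional[OF V D(2) that] by metis
  then obtain l where l: "\<And>b. b \<in> D \<Longrightarrow> Vector_Spaces.linear sV (*) (l b)"
    "\<And>b b'. b \<in> D \<Longrightarrow> b' \<in> D \<Longrightarrow> l b b' = (if b' = b then 1 else 0)" by metis
  define e where "e v k = (if k < card D then l (\<beta> k) v else 0)" for v k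
  have \<beta>D: "\<beta> k \<in> D" if "k < card D" for k using \<beta> that by (auto simp: bij_betw_def)
  show ?thesis
  proof (rule that[of e])
    show le: "Vector_Spaces.linear sV fscale e"
      using l(1)[OF \<beta>D] V vector_space_fscale
      by (auto simp: Vector_Spaces.linear_iff e_def fun_eq_iff fscale_def)
    interpret e: Vector_Spaces.linear sV fscale e by (rule le)
    have "v = 0" if v: "v \<in> V.span D" "e v = 0" for v
    proof -
      obtain u where u: "v = (\<Sum>b\<in>D. sV (u b) b)" using v(1) unfolding V.span_finite[OF fD] by auto
      have "u b = 0" if b: "b \<in> D" for b
      proof -
        interpret lb: Vector_Spaces.linear sV "(*)" "l b" by (rule l(1)[OF b])
        have "l b v = (\<Sum>b'\<in>D. if b' = b then u b' else 0)"
          unfolding u lb.sum lb.scale by (rule sum.cong) (auto simp: l(2)[OF b])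
        hence lu: "l b v = u b" using fD b by simp
        have "b \<in> \<beta> ` {0..<card D}" using \<beta> b unfolding bij_betw_def by blast
        then obtain k where k: "k < card D" "b = \<beta> k" by auto
        have "e v k = 0" using v(2) by simp
        thus ?thesis using k lu by (simp add: e_def)
      qed
      thus ?thesis unfolding u by simp
    qed
    moreover have "V.span B \<subseteq> V.span D" using D(3) by (intro V.span_minimal) auto
    ultimately show "inj_on e (V.span B)"
      unfolding e.inj_on_iff_eq_0[OF V.subspace_span] by blast
  qed
qed

text \<open>Members of \<open>Rep\<close> live on sequences, while the subrepresentations arising
  here live on coordinate rings; coordinates in a finite basis carry the structure across.\<close>

lemma transport_to_Rep:
  fixes A :: "('f::field, 'a::comm_ring_1) hopf" and V :: "('f, 'v::ab_group_add, 'a) comod"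
  assumes V: "representation A V" and fd: "finite_dimensional V"
  obtains W j where "W \<in> Rep A" "rep_hom A W V j" "inj_on j (vec W)" "j ` vec W = vec V"
proof -
  interpret representation A V by fact
  note sV = vector_space_V
  interpret V: vector_space "smul V" by (rule sV)
  obtain B where B: "finite B" "V.span B = vec V" using fd unfolding finite_dimensional_def by blast
  obtain e :: "'v \<Rightarrow> nat \<Rightarrow> 'f" where e: "Vector_Spaces.linear (smul V) fscale e" "inj_on e (vec V)"
    using finite_dimensional_embedding[OF sV B(1)] unfolding B(2) by blast
  interpret VP: vector_space_pair "smul V" "fscale :: 'f \<Rightarrow> (nat \<Rightarrow> 'f) \<Rightarrow> _"
    by (intro vector_space_pair.intro sV vector_space_fscale)
  obtain J where J: "range J \<subseteq> vec V" "Vector_Spaces.linear fscale (smul V) J"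
    "\<And>v. v \<in> vec V \<Longrightarrow> J (e v) = v"
    using VP.linear_exists_left_inverse_on[OF e(1) subspace_vec e(2)] by blast
  interpret e: Vector_Spaces.linear "smul V" fscale e by (rule e(1))
  \<comment> \<open>Precomposing with the linear map \<open>J\<close> makes the new coaction total
    and linear; on the image of \<open>vec V\<close> it merely undoes \<open>e\<close>.\<close>
  define W where "W = \<lparr> vec = e ` vec V, smul = fscale,
    coact = (\<lambda>x. T (smul V) fscale e (coact V (J x))) \<rparr>"
  have W: "vec W = e ` vec V" "smul W = fscale" "coact W = (\<lambda>x. T (smul V) fscale e (coact V (J x)))"
    by (simp_all add: W_def)
  note Te = T_linear[OF e(1)]
  have lc: "Vector_Spaces.linear fscale fscale (\<lambda>x. T (smul V) fscale e (coact V (J x)))"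
    by (rule linear_compose'[OF linear_compose'[OF J(2) coact_linear] Te])
  have rW: "representation A W"
  proof (intro representation.intro representation_axioms.intro affine_group_axioms; unfold W)
    show "vector_space (fscale :: 'f \<Rightarrow> (nat \<Rightarrow> 'f) \<Rightarrow> _)" by (rule fscale_vs)
    show "fs.subspace (e ` vec V)" by (rule e.subspace_image[OF subspace_vec])
    show "Vector_Spaces.linear fscale fscale (\<lambda>x. T (smul V) fscale e (coact V (J x)))" by (rule lc)
    fix x assume "x \<in> e ` vec V"
    then obtain v where v: "v \<in> vec V" "x = e v" by auto
    have c: "T (smul V) fscale e (coact V (J x)) = T (smul V) fscale e (coact V v)"
      unfolding v(2) J(3)[OF v(1)] ..
    show "T (smul V) fscale e (coact V (J x)) \<in> E fscale (e ` vec V)"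
      unfolding c by (rule T_in[OF e(1) _ coact_in[OF v(1)]]) simp
    show "h fscale (T (smul V) fscale e (coact V (J x))) = x"
      unfolding c h_T[OF e(1) coact_in[OF v(1)]] coact_counit[OF v(1)] by (rule v(2)[symmetric])
    have "T fscale fscale (\<lambda>x. T (smul V) fscale e (coact V (J x))) (T (smul V) fscale e (coact V v)) =
        T (smul V) fscale (\<lambda>v. T (smul V) fscale e (coact V (J (e v)))) (coact V v)"
      by (rule T_T[OF e(1) lc coact_in[OF v(1)]])
    also have "\<dots> = T (smul V) fscale (\<lambda>v. T (smul V) fscale e (coact V v)) (coact V v)"
      by (rule tmap_cong[OF linear_compose'[OF e(1) lc] linear_compose'[OF coact_linear Te] linear_idA
            _ coact_in[OF v(1)]]) (simp add: J(3))
    also have "\<dots> = T fscale fscale (T (smul V) fscale e) (C (smul V) (coact V v))"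
      unfolding coact_coassoc[OF v(1), symmetric] by (rule T_T[OF coact_linear Te coact_in[OF v(1)], symmetric])
    also have "\<dots> = C fscale (T (smul V) fscale e (coact V v))"
      by (rule C_T[OF e(1) coact_in[OF v(1)], symmetric])
    finally show "T fscale fscale (\<lambda>x. T (smul V) fscale e (coact V (J x))) (T (smul V) fscale e (coact V (J x))) =
        C fscale (T (smul V) fscale e (coact V (J x)))" unfolding c .
  qed
  show ?thesis
  proof (rule that[of W J])
    have "fs.span (e ` B) = e ` vec V" unfolding e.span_image B(2) ..
    hence "finite_dimensional W" unfolding finite_dimensional_def W using B(1) by blast
    thus "W \<in> Rep A" using rW unfolding Rep_def by blast
    show "J ` vec W = vec V" unfolding W image_image using J(3) by simp
    show "inj_on J (vec W)" unfolding W by (rule inj_onI) (auto simp: J(3))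
    show "rep_hom A W V J" unfolding rep_hom_def W
    proof (intro conjI J(2) ballI)
      show "J ` e ` vec V \<subseteq> vec V" using J(1) by auto
      fix x assume "x \<in> e ` vec V"
      then obtain v where v: "v \<in> vec V" "x = e v" by auto
      have "T fscale (smul V) J (T (smul V) fscale e (coact V v)) = T (smul V) (smul V) (\<lambda>v. J (e v)) (coact V v)"
        by (rule T_T[OF e(1) J(2) coact_in[OF v(1)]])
      also have "\<dots> = T (smul V) (smul V) id (coact V v)"
        by (rule tmap_cong[OF linear_compose'[OF e(1) J(2)] linear_id'[OF sV] linear_idA _ coact_in[OF v(1)]])
          (simp add: J(3))
      also have "\<dots> = coact V v" by (rule tmap_id[OF sV vector_space_A coact_in[OF v(1)]])
      finally show "coact V (J x) = T fscale (smul V) J (T (smul V) fscale e (coact V (J x)))"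
        unfolding v(2) J(3)[OF v(1)] ..
    qed
  qed
qed

lemma (in representation) finite_subset_Rep:
  assumes "finite X" "X \<subseteq> vec V"
  obtains W j where "W \<in> Rep A" "rep_hom A W V j" "inj_on j (vec W)" "X \<subseteq> j ` vec W"
proof -
  obtain U where U: "module.subspace (smul V) U" "U \<subseteq> vec V" "X \<subseteq> U"
    "\<exists>B. finite B \<and> module.span (smul V) B = U" "\<And>u. u \<in> U \<Longrightarrow> coact V u \<in> E (smul V) U"
    using locally_finite[OF assms] by metis
  let ?U = "V\<lparr>vec := U\<rparr>"
  have "representation A ?U" "finite_dimensional ?U"
    using representation_subspace[OF U(1,2,5)] U(4) by (auto simp: finite_dimensional_def)
  then obtain W j where W: "W \<in> Rep A" "rep_hom A W ?U j" "inj_on j (vec W)" "j ` vec W = vec ?U"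
    by (rule transport_to_Rep)
  show ?thesis
    by (rule that[OF W(1) _ W(3)]) (use W U in \<open>auto simp: rep_hom_def\<close>)
qed

section \<open>Pro-unipotent groups\<close>

lemma diff_telescope: "a - c = (a - b) + (b - (c :: 'a::ab_group_add))"
  by simp

text \<open>
  By induction on the extension, a map from \<open>V\<close> which is equivariant modulo \<open>I\<close> has values in \<open>I\<close>
  if \<open>M / I\<close> has no invariants; this formulation makes the quotient representation \<open>M / I\<close> superfluous.
\<close>

lemma iterated_extension_maps_into:
  fixes A :: "('f::field, 'a::comm_ring_1) hopf" and M :: "('f, 'm::ab_group_add, 'a) comod"
  assumes A: "affine_group A" and V: "iterated_extension_of_trivial A V"
    and M: "representation A M" and I: "module.subspace (smul M) I"
    and key: "\<And>m. m \<in> vec M \<Longrightarrow>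
      coact M m - tens (smul M) (fsmul A) m 1 \<in> tensor_space (smul M) (fsmul A) I UNIV \<Longrightarrow> m \<in> I"
    and f: "Vector_Spaces.linear (smul V) (smul M) f" "f ` vec V \<subseteq> vec M"
      "\<And>v. v \<in> vec V \<Longrightarrow> coact M (f v) - tmap (smul V) (fsmul A) (smul M) (fsmul A) f id (coact V v)
        \<in> tensor_space (smul M) (fsmul A) I UNIV"
  shows "f ` vec V \<subseteq> I"
proof -
  interpret M: representation A M by fact
  interpret MV: vector_space "smul M" by (rule M.vector_space_V)
  show ?thesis using V f
  proof (induction arbitrary: f rule: iterated_extension_of_trivial.induct)
    case (trivial V)
    show ?case
    proof (rule image_subsetI)
      fix v assume v: "v \<in> vec V"
      hence c: "coact V v = tens (smul V) (fsmul A) v 1"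
        using trivial(2) unfolding invariants_def by blast
      have "f v \<in> vec M" using trivial(4) v by blast
      thus "f v \<in> I" using trivial(5)[OF v] unfolding c M.T_tens[OF trivial(3)] by (rule key)
    qed
  next
    case (extension V U W \<iota> g)
    interpret V: representation A V using extension(1) by (simp add: Rep_def)
    have "W \<in> Rep A" "U \<in> Rep A"
      using extension(3,4) by (auto elim: iterated_extension_of_trivial.cases)
    then interpret W: representation A W + U: representation A U by (simp_all add: Rep_def)
    note f = extension(7-9)
    note ex = extension(2)[unfolded short_exact_def rep_hom_def]
    have \<iota>: "Vector_Spaces.linear (smul U) (smul V) \<iota>" "\<iota> ` vec U = {v \<in> vec V. g v = 0}"
      "\<And>u. u \<in> vec U \<Longrightarrow> coact V (\<iota> u) = M.T (smul U) (smul V) \<iota> (coact U u)"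
      using ex by blast+
    have g: "Vector_Spaces.linear (smul V) (smul W) g" "g ` vec V = vec W"
      "\<And>v. v \<in> vec V \<Longrightarrow> coact W (g v) = M.T (smul V) (smul W) g (coact V v)"
      using ex by blast+
    interpret VV: vector_space "smul V" by (rule V.vector_space_V)
    interpret WW: vector_space "smul W" by (rule W.vector_space_V)
    interpret f: Vector_Spaces.linear "smul V" "smul M" f by (rule f(1))
    interpret g: Vector_Spaces.linear "smul V" "smul W" g by (rule g(1))
    have "(\<lambda>u. f (\<iota> u)) ` vec U \<subseteq> I"
    proof (rule extension(5)[OF linear_compose'[OF \<iota>(1) f(1)]])
      have \<iota>V: "\<iota> u \<in> vec V" if "u \<in> vec U" for u
        using imageI[OF that, of \<iota>] unfolding \<iota>(2) by simp
      show "(\<lambda>u. f (\<iota> u)) ` vec U \<subseteq> vec M" using f(2) \<iota>V by blast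
      fix u assume u: "u \<in> vec U"
      from f(3)[OF \<iota>V[OF u]]
      show "coact M (f (\<iota> u)) - M.T (smul U) (smul M) (\<lambda>u. f (\<iota> u)) (coact U u) \<in> M.E (smul M) I"
        unfolding \<iota>(3)[OF u] M.T_T[OF \<iota>(1) f(1) U.coact_in[OF u]] .
    qed
    moreover have "v \<in> \<iota> ` vec U" if "v \<in> vec V" "g v = 0" for v unfolding \<iota>(2) using that by simp
    ultimately have ker: "f v \<in> I" if "v \<in> vec V" "g v = 0" for v using that by blast
    interpret VW: vector_space_pair "smul V" "smul W"
      by (intro vector_space_pair.intro V.vector_space_V W.vector_space_V)
    \<comment> \<open>A linear section of \<open>g\<close>, in general not equivariant.\<close>
    obtain \<sigma> where \<sigma>: "range \<sigma> \<subseteq> vec V" "Vector_Spaces.linear (smul W) (smul V) \<sigma>"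
      "\<And>w. w \<in> vec W \<Longrightarrow> g (\<sigma> w) = w"
      using VW.linear_exists_right_inverse_on[OF g(1) V.subspace_vec] unfolding g(2) by blast
    have \<sigma>V: "\<sigma> w \<in> vec V" for w using \<sigma>(1) by blast
    have sec: "(\<lambda>w. f (\<sigma> w)) ` vec W \<subseteq> I"
    proof (rule extension(6)[OF linear_compose'[OF \<sigma>(2) f(1)]])
      show "(\<lambda>w. f (\<sigma> w)) ` vec W \<subseteq> vec M" using f(2) \<sigma>V by blast
      fix w assume w: "w \<in> vec W"
      note cw = W.coact_in[OF w] and c\<sigma> = V.coact_in[OF \<sigma>V, of w]
      \<comment> \<open>\<open>d\<close> is the failure of \<open>\<sigma>\<close> to be equivariant
        at \<open>w\<close>. It is killed by \<open>g\<close>, hence is a tensor over the kernel of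
        \<open>g\<close>, which \<open>f\<close> maps into \<open>I\<close>. So
        \<open>f \<circ> \<sigma>\<close> is still equivariant modulo \<open>I\<close>, and the
        induction hypothesis for \<open>W\<close> applies.\<close>
      define d where "d = coact V (\<sigma> w) - M.T (smul W) (smul V) \<sigma> (coact W w)"
      interpret Tg: Vector_Spaces.linear fscale fscale "M.T (smul V) (smul W) g" by (rule M.T_linear[OF g(1)])
      interpret Tf: Vector_Spaces.linear fscale fscale "M.T (smul V) (smul M) f" by (rule M.T_linear[OF f(1)])
      have dV: "d \<in> M.E (smul V) (vec V)" unfolding d_def
        by (rule fs.subspace_diff[OF subspace_tensor_space c\<sigma> M.T_in[OF \<sigma>(2) \<sigma>V cw]])
      have "M.T (smul W) (smul W) (\<lambda>w. g (\<sigma> w)) (coact W w) = M.T (smul W) (smul W) id (coact W w)"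
        by (rule tmap_cong[OF linear_compose'[OF \<sigma>(2) g(1)] linear_id'[OF W.vector_space_V] M.linear_idA _ cw])
          (simp add: \<sigma>(3))
      hence "M.T (smul V) (smul W) g d = 0"
        unfolding d_def Tg.diff M.T_T[OF \<sigma>(2) g(1) cw] g(3)[OF \<sigma>V, symmetric] \<sigma>(3)[OF w]
        by (simp only: tmap_id[OF W.vector_space_V M.vector_space_A cw] diff_self)
      hence "M.T (smul V) (smul W) g d \<in> M.E (smul W) {0}"
        using fs.subspace_0[OF subspace_tensor_space] by (simp only:)
      from tensor_preimage[OF g(1) M.vector_space_A V.subspace_vec WW.subspace_single_0 dV this]
      have "M.T (smul V) (smul M) f d \<in> M.E (smul M) I"
        by (rule M.T_in[OF f(1), rotated]) (simp add: ker)
      moreover have "coact M (f (\<sigma> w)) - M.T (smul W) (smul M) (\<lambda>w. f (\<sigma> w)) (coact W w) =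
          (coact M (f (\<sigma> w)) - M.T (smul V) (smul M) f (coact V (\<sigma> w))) + M.T (smul V) (smul M) f d"
        unfolding d_def Tf.diff M.T_T[OF \<sigma>(2) f(1) cw] by (rule diff_telescope)
      ultimately show "coact M (f (\<sigma> w)) - M.T (smul W) (smul M) (\<lambda>w. f (\<sigma> w)) (coact W w) \<in> M.E (smul M) I"
        using fs.subspace_add[OF subspace_tensor_space f(3)[OF \<sigma>V, of w]] by (simp only:)
    qed
    show ?case
    proof (rule image_subsetI)
      fix v assume v: "v \<in> vec V"
      hence gv: "g v \<in> vec W" using g(2) by blast
      have "v - \<sigma> (g v) \<in> vec V" by (intro VV.subspace_diff V.subspace_vec v \<sigma>V)
      hence "f (v - \<sigma> (g v)) \<in> I" by (rule ker) (simp add: g.diff \<sigma>(3)[OF gv])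
      moreover have "f (\<sigma> (g v)) \<in> I" using sec gv by blast
      ultimately have "f (v - \<sigma> (g v)) + f (\<sigma> (g v)) \<in> I" by (rule MV.subspace_add[OF I])
      thus "f v \<in> I" by (simp add: f.diff)
    qed
  qed
qed

text \<open>\<open>key\<close> says that \<open>M / I\<close> has no nonzero invariants. Every
  \<open>m\<close> lies in a finite-dimensional subrepresentation, which is an iterated extension of
  trivial ones. The uses are the kernel of \<open>\<phi>\<close> with \<open>I = {0}\<close>, and
  \<open>O(P)\<close> with \<open>I\<close> the range of \<open>\<phi>\<close>.\<close>

lemma pro_unipotent_exhausted:
  assumes A: "pro_unipotent A" and M: "representation A M"
    and I: "module.subspace (smul M) I"
    and key: "\<And>m. m \<in> vec M \<Longrightarrow>
      coact M m - tens (smul M) (fsmul A) m 1 \<in> tensor_space (smul M) (fsmul A) I UNIV \<Longrightarrow> m \<in> I"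
  shows "vec M \<subseteq> I"
proof
  interpret representation A M by fact
  fix m assume "m \<in> vec M"
  hence m: "finite {m}" "{m} \<subseteq> vec M" by auto
  obtain W j where W: "W \<in> Rep A" "rep_hom A W M j" "inj_on j (vec W)" "{m} \<subseteq> j ` vec W"
    by (rule finite_subset_Rep[OF m])
  have "j ` vec W \<subseteq> I"
  proof (rule iterated_extension_maps_into[OF affine_group_axioms _ M I key])
    show "iterated_extension_of_trivial A W" using A W(1) unfolding pro_unipotent_def by blast
    show "Vector_Spaces.linear (smul W) (smul M) j" "j ` vec W \<subseteq> vec M"
      using W(2) unfolding rep_hom_def by blast+
    fix v assume "v \<in> vec W"
    hence c: "coact M (j v) = T (smul W) (smul M) j (coact W v)" using W(2) unfolding rep_hom_def by blast
    show "coact M (j v) - T (smul W) (smul M) j (coact W v) \<in> E (smul M) I"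
      unfolding c diff_self by (rule fs.subspace_0[OF subspace_tensor_space])
  qed
  thus "m \<in> I" using W(4) by blast
qed

section \<open>The regular representation\<close>

definition regular :: "('f::field, 'a::comm_ring_1) hopf \<Rightarrow> ('f, 'a, 'a) comod" where
  "regular A = \<lparr> vec = UNIV, smul = fsmul A, coact = comult A \<rparr>"

lemma regular_simps: "vec (regular A) = UNIV" "smul (regular A) = fsmul A" "coact (regular A) = comult A"
  by (simp_all add: regular_def)

context affine_group
begin

lemma representation_regular: "representation A (regular A)"
proof -
  interpret A: vector_space sA by (rule vector_space_A)
  show ?thesis
    by (intro representation.intro representation_axioms.intro affine_group_axioms; unfold regular_simps)
      (rule vector_space_A A.subspace_UNIV comult_linear comult_in coassoc counit_right)+
qed

lemma
  shows counit_tensor_linear: "Vector_Spaces.linear fscale sA (tlift sA sA sA (\<lambda>x y. sA (\<epsilon> x) y))"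
    and counit_tensor_tens: "tlift sA sA sA (\<lambda>x y. sA (\<epsilon> x) y) (tens sA sA a b) = sA (\<epsilon> a) b"
proof -
  have b: "bilinear_map sA sA sA (\<lambda>x y. sA (\<epsilon> x) y)"
    by (intro bilinear_mapI linear_scale[OF linear_self] linear_scale_left[OF vector_space_A counit_linear])
  note * = vector_space_A vector_space_A vector_space_A b
  show "Vector_Spaces.linear fscale sA (tlift sA sA sA (\<lambda>x y. sA (\<epsilon> x) y))"
    "tlift sA sA sA (\<lambda>x y. sA (\<epsilon> x) y) (tens sA sA a b) = sA (\<epsilon> a) b"
    by (rule tlift_linear[OF *] tlift_tens[OF *])+
qed

text \<open>Evaluating the left factor at the identity turns \<open>comult A x\<close> into
  \<open>x\<close> and \<open>x \<otimes> 1\<close> into a constant.\<close>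

lemma regular_invariant:
  assumes "comult A x = tens sA sA x 1" shows "x = sA (\<epsilon> x) 1"
  using counit_left[of x] unfolding assms counit_tensor_tens by (rule sym)

text \<open>The regular representation has no first cohomology: the inhomogeneous cocycle \<open>y\<close> is the
  coboundary of its contraction with the counit in the left-hand factor.\<close>

lemma regular_cocycle:
  assumes y: "y \<in> E sA UNIV" and c: "C sA y = tens fscale sA y 1 + T sA fscale (comult A) y"
  obtains x where "y = comult A x - tens sA sA x 1"
proof -
  interpret A: vector_space sA by (rule vector_space_A)
  let ?e = "tlift sA sA sA (\<lambda>x y. sA (\<epsilon> x) y)"
  note e = counit_tensor_linear and et = counit_tensor_tens and Te = T_linear[OF counit_tensor_linear]
  interpret Te: Vector_Spaces.linear fscale fscale "T fscale sA ?e" by (rule Te)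
  interpret \<Delta>: Vector_Spaces.linear sA fscale "comult A" by (rule comult_linear)
  have "T sA sA (\<lambda>x. sA r x) t = fscale r t" if t: "t \<in> E sA UNIV" for r t
    by (rule tensor_eqI[OF T_linear[OF linear_scale[OF linear_self]]
          linear_scale[OF linear_id'[OF fscale_vs, unfolded id_def]] _ t])
      (simp only: T_tens[OF linear_scale[OF linear_self]] tens_scale_left[OF vector_space_A vector_space_A])
  note scale = this[OF comult_in]
  \<comment> \<open>The contraction \<open>?e\<close> sends the three terms of the cocycle equation
    to \<open>comult A (?e y)\<close>, \<open>?e y \<otimes> 1\<close> and \<open>y\<close>.\<close>
  have "T fscale sA ?e (C sA y) = comult A (?e y)"
  proof (rule tensor_eqI[OF linear_compose'[OF C_linear[OF vector_space_A] Te]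
        linear_compose'[OF e comult_linear] _ y])
    show "T fscale sA ?e (C sA (tens sA sA a b)) = comult A (?e (tens sA sA a b))" for a b
      unfolding C_tens[OF vector_space_A] T_T[OF linear_tens1[OF vector_space_A] e comult_in]
        et \<Delta>.scale by (rule scale)
  qed
  moreover have "T sA sA (\<lambda>a. ?e (comult A a)) y = y"
    unfolding counit_left using tmap_id[OF vector_space_A vector_space_A y] unfolding id_def .
  hence "T fscale sA ?e (C sA y) = tens sA sA (?e y) 1 + y"
    unfolding c Te.add T_tens[OF e] T_T[OF comult_linear e y] by (simp only:)
  ultimately have "comult A (?e y) = tens sA sA (?e y) 1 + y" by (simp only:)
  hence "y = comult A (?e y) - tens sA sA (?e y) 1" by (simp only: add_diff_cancel_left')
  thus ?thesis by (rule that)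
qed

text \<open>Naturality of both sides of the cocycle equation. It pushes cocycles of \<open>V\<close>
  into the regular representation; for injective \<open>j\<close> it also recognises a cocycle of
  \<open>V\<close> by its image.\<close>

lemma equivariant_cocycle:
  assumes V: "representation A V" and j: "Vector_Spaces.linear (smul V) sA j"
    and eq: "\<And>v. v \<in> vec V \<Longrightarrow> comult A (j v) = T (smul V) sA j (coact V v)"
    and z: "z \<in> E (smul V) (vec V)"
  shows "T fscale fscale (T (smul V) sA j) (C (smul V) z) = C sA (T (smul V) sA j z)"
    and "T fscale fscale (T (smul V) sA j) (tens fscale sA z 1 + T (smul V) fscale (coact V) z) =
      tens fscale sA (T (smul V) sA j z) 1 + T sA fscale (comult A) (T (smul V) sA j z)"
proof -
  interpret V: representation A V by fact
  note Tj = T_linear[OF j]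
  show "T fscale fscale (T (smul V) sA j) (C (smul V) z) = C sA (T (smul V) sA j z)"
    by (rule C_T[OF j z, symmetric])
  have "T fscale fscale (T (smul V) sA j) (T (smul V) fscale (coact V) z) =
      T (smul V) fscale (\<lambda>v. T (smul V) sA j (coact V v)) z"
    by (rule T_T[OF V.coact_linear Tj z])
  also have "\<dots> = T (smul V) fscale (\<lambda>v. comult A (j v)) z"
    by (rule tmap_cong[OF linear_compose'[OF V.coact_linear Tj] linear_compose'[OF j comult_linear]
          linear_idA eq[symmetric] z])
  also have "\<dots> = T sA fscale (comult A) (T (smul V) sA j z)"
    by (rule T_T[OF j comult_linear z, symmetric])
  finally show "T fscale fscale (T (smul V) sA j) (tens fscale sA z 1 + T (smul V) fscale (coact V) z) =
      tens fscale sA (T (smul V) sA j z) 1 + T sA fscale (comult A) (T (smul V) sA j z)"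
    unfolding module_hom.add[OF module_hom_linearI[OF T_linear[OF Tj]]] T_tens[OF Tj] by (simp only:)
qed

end

section \<open>The comparison theorem\<close>

lemma group_hom_compose:
  assumes f: "group_hom X Y f" and g: "group_hom Y Z g" and Z: "affine_group Z"
  shows "group_hom X Z (f \<circ> g)"
proof -
  interpret Z: affine_group Z by fact
  note lf = group_hom_linear[OF f] and lg = group_hom_linear[OF g]
  have "comult X (f (g a)) = tmap Z.sA Z.sA (fsmul X) (fsmul X) (\<lambda>x. f (g x)) (\<lambda>x. f (g x)) (comult Z a)" for a
    unfolding group_hom_comult[OF f] group_hom_comult[OF g] by (rule tmap_tmap[OF lg lg lf lf Z.comult_in])
  thus ?thesis
    unfolding group_hom_def o_def
    using linear_compose'[OF lg lf] f g by (simp add: group_hom_def)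
qed

lemma bij_group_hom_iso:
  assumes \<phi>: "group_hom X Y \<phi>" and Y: "affine_group Y" and bij: "bij \<phi>"
  shows "group_iso X Y \<phi>"
proof -
  interpret Y: affine_group Y by fact
  let ?\<psi> = "inv \<phi>"
  note l = group_hom_linear[OF \<phi>]
  note inv = surj_f_inv_f[OF bij_is_surj[OF bij]] inv_f_f[OF bij_is_inj[OF bij]]
  have lpsi: "Vector_Spaces.linear (fsmul X) (fsmul Y) ?\<psi>"
  proof -
    interpret l: Vector_Spaces.linear "fsmul Y" "fsmul X" \<phi> by (rule l)
    have "?\<psi> (a + b) = ?\<psi> a + ?\<psi> b" "?\<psi> (fsmul X c a) = fsmul Y c (?\<psi> a)" for a b c
      by (rule injD[OF bij_is_inj[OF bij]]; simp add: inv l.add l.scale)+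
    thus ?thesis using linear_vs[OF l] by (simp add: Vector_Spaces.linear_iff)
  qed
  have "comult Y (?\<psi> a) = tmap (fsmul X) (fsmul X) Y.sA Y.sA ?\<psi> ?\<psi> (comult X a)" for a
  proof -
    have "tmap (fsmul X) (fsmul X) Y.sA Y.sA ?\<psi> ?\<psi> (comult X (\<phi> (?\<psi> a))) =
        tmap Y.sA Y.sA Y.sA Y.sA (\<lambda>x. ?\<psi> (\<phi> x)) (\<lambda>x. ?\<psi> (\<phi> x)) (comult Y (?\<psi> a))"
      unfolding group_hom_comult[OF \<phi>] by (rule tmap_tmap[OF l l lpsi lpsi Y.comult_in])
    also have "\<dots> = comult Y (?\<psi> a)"
      unfolding inv(2) using tmap_id[OF Y.vector_space_A Y.vector_space_A Y.comult_in] unfolding id_def .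
    finally show ?thesis unfolding inv(1) by (rule sym)
  qed
  moreover have "?\<psi> 1 = 1" using inv(2)[of 1] unfolding group_hom_one[OF \<phi>] .
  moreover have "?\<psi> (a * b) = ?\<psi> a * ?\<psi> b" for a b
    by (rule injD[OF bij_is_inj[OF bij]]) (simp add: inv group_hom_mult[OF \<phi>])
  moreover have "counit Y (?\<psi> a) = counit X a" for a
    using group_hom_counit[OF \<phi>, of "?\<psi> a"] unfolding inv(1) by (rule sym)
  ultimately have "group_hom Y X ?\<psi>" unfolding group_hom_def using lpsi by blast
  thus ?thesis unfolding group_iso_def using \<phi> bij
    by (auto intro!: exI[of _ ?\<psi>] simp: bij_def inj_iff surj_iff)
qed

text \<open>The bridge from the hypotheses to \<open>O(K)\<close>: the functions in \<open>X\<close>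
  are lifted to \<open>H\<close>-invariant functions on \<open>G\<close>, whose finite-dimensional
  \<open>G\<close>-span restricts back injectively to \<open>K\<close>.\<close>

lemma (in semidirect) Rep_in_regular:
  fixes X :: "'k set"
  assumes "finite X"
  obtains V j where "V \<in> Rep G" "Vector_Spaces.linear (smul V) K.sA j" "inj_on j (vec V)" "X \<subseteq> j ` vec V"
    "\<And>v. v \<in> vec V \<Longrightarrow> comult K (j v) = K.T (smul V) K.sA j (coact (restrict_rep K G i V) v)"
proof -
  interpret R: representation G "regular G" by (rule G.representation_regular)
  let ?L = "regular G\<lparr>vec := H_invariant\<rparr>"
  have L: "representation G ?L"
    by (rule R.representation_subspace)
      (simp_all add: regular_simps subspace_H_invariant comult_H_invariant)
  interpret L: representation G ?L by (rule L)
  have Ls: "vec ?L = H_invariant" "smul ?L = G.sA" "coact ?L = comult G" by (simp_all add: regular_simps)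
  have "X \<subseteq> i ` H_invariant" unfolding i_H_invariant by simp
  then obtain X' where X': "X' \<subseteq> H_invariant" "finite X'" "X = i ` X'"
    using finite_subset_image[OF assms] by blast
  have "X' \<subseteq> vec ?L" using X'(1) by simp
  from L.finite_subset_Rep[OF X'(2) this]
  obtain V j where V: "V \<in> Rep G" "rep_hom G V ?L j" "inj_on j (vec V)" "X' \<subseteq> j ` vec V" .
  interpret V: representation G V using V(1) by (simp add: Rep_def)
  have j: "Vector_Spaces.linear (smul V) G.sA j" "j ` vec V \<subseteq> H_invariant"
    "\<And>v. v \<in> vec V \<Longrightarrow> comult G (j v) = G.T (smul V) G.sA j (coact V v)"
    using V(2) unfolding rep_hom_def Ls by blast+
  note lij = linear_compose'[OF j(1) li] and lid = linear_id'[OF V.vector_space_V]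
  show ?thesis
  proof (rule that[OF V(1) lij])
    show "inj_on (\<lambda>v. i (j v)) (vec V)"
      using comp_inj_on[OF V(3) inj_on_subset[OF inj_on_i j(2)]] unfolding o_def .
    show "X \<subseteq> (\<lambda>v. i (j v)) ` vec V" using X'(3) V(4) by blast
    fix v assume v: "v \<in> vec V"
    note cv = V.coact_in[OF v]
    have "comult K (i (j v)) = tmap (smul V) G.sA K.sA K.sA (\<lambda>x. i (j x)) (\<lambda>x. i (id x)) (coact V v)"
      unfolding group_hom_comult[OF hom_i] j(3)[OF v] by (rule tmap_tmap[OF j(1) G.linear_idA li li cv])
    also have "\<dots> = K.T (smul V) K.sA (\<lambda>x. i (j x)) (coact (restrict_rep K G i V) v)"
      unfolding restrict_rep_simps tmap_tmap[OF lid li lij K.linear_idA cv] id_apply ..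
    finally show "comult K (i (j v)) = K.T (smul V) K.sA (\<lambda>x. i (j x)) (coact (restrict_rep K G i V) v)" .
  qed
qed

text \<open>The hypotheses on derived functors in elementary form: \<open>invariants_eq\<close> is
  extracted from degree 0, and \<open>cocycle_lift\<close> from surjectivity in degree 1, where a
  cocycle of \<open>P\<close> comes from one of \<open>K\<close> up to a coboundary.\<close>

locale comparison = semidirect G K H i s p + P: affine_group P
  for G :: "('f::field, 'g::comm_ring_1) hopf" and K :: "('f, 'k::comm_ring_1) hopf"
    and H :: "('f, 'h::comm_ring_1) hopf" and i s p and P :: "('f, 'p::comm_ring_1) hopf" +
  fixes \<phi> :: "'k \<Rightarrow> 'p"
  assumes hom_\<phi>: "group_hom P K \<phi>" and unipotent: "pro_unipotent P"
    and invariants_eq: "V \<in> Rep G \<Longrightarrow>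
      invariants P (restrict_rep P G (\<phi> \<circ> i) V) \<subseteq> invariants K (restrict_rep K G i V)"
    and cocycle_lift: "V \<in> Rep G \<Longrightarrow> z \<in> cocycles P (restrict_rep P G (\<phi> \<circ> i) V) \<Longrightarrow>
      \<exists>z'\<in>cocycles K (restrict_rep K G i V). \<exists>v\<in>vec V.
        z = tmap (smul V) (fsmul K) (smul V) (fsmul P) id \<phi> z'
            + coboundary P (restrict_rep P G (\<phi> \<circ> i) V) v"
begin

lemmas l\<phi> = group_hom_linear[OF hom_\<phi>]

abbreviation "KP \<equiv> restrict_rep P K \<phi> (regular K)"

lemma representation_KP: "representation P KP"
  by (rule representation_restrict[OF P.affine_group_axioms hom_\<phi> K.representation_regular])

text \<open>This is the \<open>P\<close>-equivariance of \<open>\<phi>\<close> as a map from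
  \<open>KP\<close> to the regular representation of \<open>P\<close>.\<close>

lemma comult_\<phi>: "comult P (\<phi> x) = P.T K.sA P.sA \<phi> (coact KP x)"
proof -
  have "P.T K.sA P.sA \<phi> (coact KP x) = tmap K.sA K.sA P.sA P.sA (\<lambda>x. \<phi> (id x)) (\<lambda>x. id (\<phi> x)) (comult K x)"
    unfolding restrict_rep_simps regular_simps
    by (rule tmap_tmap[OF linear_id'[OF K.vector_space_A] l\<phi> l\<phi> P.linear_idA K.comult_in])
  thus ?thesis unfolding group_hom_comult[OF hom_\<phi>] by simp
qed

lemma restrict_equivariant:
  assumes V: "representation G V" and j: "Vector_Spaces.linear (smul V) K.sA j" and v: "v \<in> vec V"
    and eq: "comult K (j v) = K.T (smul V) K.sA j (coact (restrict_rep K G i V) v)"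
  shows "coact KP (j v) = P.T (smul V) K.sA j (coact (restrict_rep P G (\<phi> \<circ> i) V) v)"
proof -
  interpret V: representation G V by fact
  note lid = linear_id'[OF V.vector_space_V] and cv = V.coact_in[OF v] and lidK = linear_id'[OF K.vector_space_A]
  have l: "Vector_Spaces.linear G.sA P.sA (\<phi> \<circ> i)" unfolding o_def by (rule linear_compose'[OF li l\<phi>])
  show ?thesis
    unfolding restrict_rep_simps regular_simps eq tmap_tmap[OF lid li j K.linear_idA cv]
      tmap_tmap[OF lid l j P.linear_idA cv]
      tmap_tmap[OF linear_compose'[OF lid j] linear_compose'[OF li K.linear_idA] lidK l\<phi> cv]
    by (simp only: id_apply o_apply)
qed

lemma KP_invariant:
  assumes x: "coact KP x = tens K.sA P.sA x 1"
  obtains c where "x = K.sA c 1"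
proof -
  obtain V j where V: "V \<in> Rep G" and j: "Vector_Spaces.linear (smul V) K.sA j" "inj_on j (vec V)"
    "{x} \<subseteq> j ` vec V"
    "\<And>v. v \<in> vec V \<Longrightarrow> comult K (j v) = K.T (smul V) K.sA j (coact (restrict_rep K G i V) v)"
    using Rep_in_regular[of "{x}"] by blast
  obtain v where v: "v \<in> vec V" "x = j v" using j(3) by blast
  have rV: "representation G V" using V by (simp add: Rep_def)
  interpret V: representation G V by (rule rV)
  let ?R = "restrict_rep P G (\<phi> \<circ> i) V"
  interpret R: representation P ?R
    by (rule representation_restrict[OF P.affine_group_axioms
          group_hom_compose[OF hom_\<phi> hom_i G.affine_group_axioms] rV])
  \<comment> \<open>Injectivity of \<open>j \<otimes> id\<close> pulls the invariance of
    \<open>x\<close> back to \<open>v\<close>, where \<open>invariants_eq\<close> applies.\<close>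
  have "P.T (smul V) K.sA j (coact ?R v) = P.T (smul V) K.sA j (tens (smul V) P.sA v 1)"
    using x unfolding v(2) restrict_equivariant[OF rV j(1) v(1) j(4)[OF v(1)]] P.T_tens[OF j(1)] .
  moreover note inj_onD[OF tmap_inj_on[OF j(1,2) P.vector_space_A V.subspace_vec], OF this]
  ultimately have "coact ?R v = tens (smul V) P.sA v 1"
    using R.coact_in[of v] v(1) tens_in[OF v(1) UNIV_I] unfolding restrict_rep_simps(1,2) by blast
  hence "v \<in> invariants P ?R" using v(1) unfolding invariants_def restrict_rep_simps(1,2) by blast
  hence "coact (restrict_rep K G i V) v = tens (smul V) K.sA v 1"
    using invariants_eq[OF V] unfolding invariants_def restrict_rep_simps(1,2) by blast
  hence "comult K x = tens K.sA K.sA x 1" unfolding v(2) j(4)[OF v(1)] by (simp only: K.T_tens[OF j(1)])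
  from K.regular_invariant[OF this] show ?thesis by (rule that)
qed

text \<open>By equivariance the kernel of \<open>\<phi>\<close> is stable under \<open>P\<close>. An
  invariant in it is a constant by \<open>KP_invariant\<close>, and \<open>\<phi>\<close> preserves
  constants, so it is zero.\<close>

lemma inj_\<phi>: "inj \<phi>"
proof -
  interpret \<phi>: Vector_Spaces.linear K.sA P.sA \<phi> by (rule l\<phi>)
  interpret KP: representation P KP by (rule representation_KP)
  interpret e: Vector_Spaces.linear P.sA "(*)" "counit P" by (rule P.counit_linear)
  let ?N = "{x \<in> UNIV. \<phi> x \<in> {0}}"
  note U = \<phi>.vs1.subspace_UNIV and Z = \<phi>.vs2.subspace_single_0
  have N: "module.subspace K.sA ?N" by (rule linear_preimage_subspace[OF l\<phi> U Z])
  let ?M = "KP\<lparr>vec := ?N\<rparr>"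
  have "representation P ?M"
  proof (rule KP.representation_subspace)
    show "module.subspace (smul KP) ?N" unfolding restrict_rep_simps regular_simps by (rule N)
    show "?N \<subseteq> vec KP" unfolding restrict_rep_simps regular_simps by simp
    fix x assume "x \<in> ?N"
    hence "P.T K.sA P.sA \<phi> (coact KP x) = 0"
      unfolding comult_\<phi>[symmetric] using module_hom.zero[OF module_hom_linearI[OF P.comult_linear]] by simp
    hence "P.T K.sA P.sA \<phi> (coact KP x) \<in> P.E P.sA {0}"
      using fs.subspace_0[OF subspace_tensor_space] by (simp only:)
    moreover have "coact KP x \<in> P.E K.sA UNIV"
      using KP.coact_in[of x] unfolding restrict_rep_simps(1,2) regular_simps by blast
    ultimately have "coact KP x \<in> P.E K.sA ?N"
      by (intro tensor_preimage[OF l\<phi> P.vector_space_A U Z])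
    thus "coact KP x \<in> P.E (smul KP) ?N" unfolding restrict_rep_simps(1,2) regular_simps .
  qed
  moreover have "module.subspace (smul ?M) {0}"
    by (simp add: restrict_rep_simps regular_simps \<phi>.vs1.subspace_single_0)
  ultimately have "vec ?M \<subseteq> {0}"
  proof (rule pro_unipotent_exhausted[OF unipotent])
    fix x assume "x \<in> vec ?M" "coact ?M x - tens (smul ?M) P.sA x 1 \<in> P.E (smul ?M) {0}"
    hence x: "\<phi> x = 0" "coact KP x - tens K.sA P.sA x 1 \<in> P.E K.sA {0}"
      by (simp_all add: restrict_rep_simps regular_simps)
    from tensor_space_zero[OF K.vector_space_A P.vector_space_A x(2)]
    have "coact KP x = tens K.sA P.sA x 1" by (simp only: right_minus_eq)
    then obtain c where c: "x = K.sA c 1" by (rule KP_invariant)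
    have "P.sA c 1 = 0" using x(1) unfolding c \<phi>.scale group_hom_one[OF hom_\<phi>] .
    hence "c = 0" using e.scale[of c 1] e.zero by (simp add: P.counit_one)
    thus "x \<in> {0}" unfolding c by simp
  qed
  hence "x = 0" if "\<phi> x = 0" for x using that by auto
  thus ?thesis unfolding \<phi>.inj_iff_eq_0 by blast
qed

text \<open>The connecting homomorphism by hand. The tensor \<open>t\<close> below is a cocycle of
  \<open>P\<close> with values in the range of \<open>\<phi>\<close>, a copy of \<open>O(K)\<close>.
  It lifts to \<open>K\<close> up to a coboundary, and there it is a coboundary by
  \<open>K.regular_cocycle\<close>; so \<open>q\<close> differs from an element of the range by an
  invariant of \<open>O(P)\<close>, which is a constant.\<close>

lemma range_\<phi>_closed:
  assumes q: "comult P q - tens P.sA P.sA q 1 \<in> P.E P.sA (range \<phi>)"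
  shows "q \<in> range \<phi>"
proof -
  define t where "t = comult P q - tens P.sA P.sA q 1"
  obtain X where X: "finite X" "X \<subseteq> range \<phi>" "t \<in> P.E P.sA X"
    using tensor_space_finite[OF q] unfolding t_def by blast
  obtain X0 where X0: "finite X0" "X = \<phi> ` X0" using finite_subset_image[OF X(1,2)] by blast
  obtain V j where V: "V \<in> Rep G" and j: "Vector_Spaces.linear (smul V) K.sA j" "inj_on j (vec V)"
    "X0 \<subseteq> j ` vec V"
    "\<And>v. v \<in> vec V \<Longrightarrow> comult K (j v) = K.T (smul V) K.sA j (coact (restrict_rep K G i V) v)"
    using Rep_in_regular[OF X0(1)] by blast
  have rV: "representation G V" using V by (simp add: Rep_def)
  interpret V: representation G V by (rule rV)
  let ?R = "restrict_rep P G (\<phi> \<circ> i) V" and ?Q = "restrict_rep K G i V"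
  have R: "representation P ?R"
    by (rule representation_restrict[OF P.affine_group_axioms
          group_hom_compose[OF hom_\<phi> hom_i G.affine_group_axioms] rV])
  have Q: "representation K ?Q" by (rule representation_restrict[OF K.affine_group_axioms hom_i rV])
  interpret R: representation P ?R by (rule R)
  interpret Q: representation K ?Q by (rule Q)
  note rs = restrict_rep_simps(1,2)
  define k where "k v = \<phi> (j v)" for v
  have k: "Vector_Spaces.linear (smul V) P.sA k" unfolding k_def by (rule linear_compose'[OF j(1) l\<phi>])
  have kinj: "inj_on k (vec V)"
    using comp_inj_on[OF j(2) inj_on_subset[OF inj_\<phi> subset_UNIV]] unfolding o_def k_def .
  have keq: "comult P (k v) = P.T (smul V) P.sA k (coact ?R v)" if v: "v \<in> vec V" for v
    unfolding k_def comult_\<phi> restrict_equivariant[OF rV j(1) v j(4)[OF v]]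
    by (rule P.T_T[OF j(1) l\<phi> R.coact_in[of v, unfolded rs, OF v]])
  interpret Tk: Vector_Spaces.linear fscale fscale "P.T (smul V) P.sA k" by (rule P.T_linear[OF k])
  interpret \<Delta>: Vector_Spaces.linear P.sA fscale "comult P" by (rule P.comult_linear)
  have "X \<subseteq> k ` vec V" unfolding X0(2) k_def using j(3) by blast
  hence "t \<in> P.E P.sA (k ` vec V)" using X(3) tensor_space_mono by blast
  then obtain z where z: "z \<in> P.E (smul V) (vec V)" "P.T (smul V) P.sA k z = t"
    using tmap_surj_on[OF k P.vector_space_A] by blast
  \<comment> \<open>In \<open>O(P)\<close> the cocycle equation holds because \<open>t\<close> is,
    up to sign, the coboundary of \<open>q\<close>.\<close>
  have Ct: "P.C P.sA t = tens fscale P.sA t 1 + P.T P.sA fscale (comult P) t"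
    unfolding t_def module_hom.diff[OF module_hom_linearI[OF P.C_linear[OF P.vector_space_A]]]
      module_hom.diff[OF module_hom_linearI[OF P.T_linear[OF P.comult_linear]]]
      P.tens_1_diff[OF vector_space_fscale] P.coassoc P.C_tens_1[OF P.vector_space_A]
      P.T_tens[OF P.comult_linear] by (simp only: add.commute diff_telescope[symmetric])
  \<comment> \<open>The equation for \<open>t\<close> descends to \<open>z\<close> because
    \<open>k\<close> remains injective after tensoring twice with \<open>O(P)\<close>.\<close>
  have "z \<in> cocycles P ?R"
  proof -
    let ?u = "tens fscale P.sA z 1 + P.T (smul V) fscale (coact ?R) z"
    note eqc = P.equivariant_cocycle[OF R, unfolded rs, OF k keq z(1)]
    have "P.T fscale fscale (P.T (smul V) P.sA k) (P.C (smul V) z) =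
        P.T fscale fscale (P.T (smul V) P.sA k) ?u"
      by (rule trans[OF eqc(1) trans[OF Ct[folded z(2)] eqc(2)[symmetric]]])
    moreover have "P.C (smul V) z \<in> P.E fscale (P.E (smul V) (vec V))"
      by (rule P.C_in[OF V.vector_space_V z(1)])
    moreover have "?u \<in> P.E fscale (P.E (smul V) (vec V))"
      by (intro fs.subspace_add[OF subspace_tensor_space] tens_in z(1) UNIV_I
          P.T_in[OF R.coact_linear[unfolded rs] R.coact_in[unfolded rs] z(1)])
    ultimately have "P.C (smul V) z = ?u"
      by (rule inj_onD[OF tmap_inj_on[OF P.T_linear[OF k]
              tmap_inj_on[OF k kinj P.vector_space_A V.subspace_vec] P.vector_space_A subspace_tensor_space]])
    thus ?thesis unfolding cocycles_def rs using z(1) by blast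
  qed
  then obtain z' v where z': "z' \<in> cocycles K ?Q" and v: "v \<in> vec V"
    and zz: "z = tmap (smul V) K.sA (smul V) P.sA id \<phi> z' + coboundary P ?R v"
    using cocycle_lift[OF V] by blast
  have z'V: "z' \<in> K.E (smul V) (vec V)"
    and z'C: "K.C (smul V) z' = tens fscale K.sA z' 1 + K.T (smul V) fscale (coact ?Q) z'"
    using z' unfolding cocycles_def rs by blast+
  let ?y = "K.T (smul V) K.sA j z'"
  note eqK = K.equivariant_cocycle[OF Q, unfolded rs, OF j(1,4) z'V]
  have yC: "K.C K.sA ?y = tens fscale K.sA ?y 1 + K.T K.sA fscale (comult K) ?y"
    by (rule trans[OF eqK(1)[symmetric] trans[OF arg_cong[OF z'C] eqK(2)]])
  have "?y \<in> K.E K.sA UNIV" by (rule K.T_in[OF j(1) UNIV_I z'V])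
  from K.regular_cocycle[OF this yC] obtain x where x: "?y = comult K x - tens K.sA K.sA x 1" .
  note lid = linear_id'[OF V.vector_space_V]
  have "P.T (smul V) P.sA k (tmap (smul V) K.sA (smul V) P.sA id \<phi> z') =
      tmap (smul V) K.sA P.sA P.sA (\<lambda>v. k (id v)) (\<lambda>a. id (\<phi> a)) z'"
    by (rule tmap_tmap[OF lid l\<phi> k P.linear_idA z'V])
  also have "\<dots> = tmap K.sA K.sA P.sA P.sA \<phi> \<phi> ?y"
    unfolding tmap_tmap[OF j(1) K.linear_idA l\<phi> l\<phi> z'V] id_apply k_def ..
  also have "\<dots> = comult P (\<phi> x) - tens P.sA P.sA (\<phi> x) 1"
    unfolding x module_hom.diff[OF module_hom_linearI[OF tmap_linear[OF l\<phi> l\<phi>]]]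
      group_hom_comult[OF hom_\<phi>] tmap_tens[OF l\<phi> l\<phi>] group_hom_one[OF hom_\<phi>] ..
  finally have 1: "P.T (smul V) P.sA k (tmap (smul V) K.sA (smul V) P.sA id \<phi> z') =
      comult P (\<phi> x) - tens P.sA P.sA (\<phi> x) 1" .
  have 2: "P.T (smul V) P.sA k (coboundary P ?R v) = tens P.sA P.sA (k v) 1 - comult P (k v)"
    unfolding coboundary_def rs Tk.diff P.T_tens[OF k] keq[OF v] ..
  have t: "t = (comult P (\<phi> x) - tens P.sA P.sA (\<phi> x) 1) + (tens P.sA P.sA (k v) 1 - comult P (k v))"
    unfolding z(2)[symmetric] zz Tk.add 1 2 ..
  \<comment> \<open>By the formula for \<open>t\<close>, this correction of \<open>q\<close> has
    coaction \<open>?r \<otimes> 1\<close>.\<close>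
  let ?r = "q - \<phi> x + k v"
  have ar: "a - b + c = a' - b' + c'" if "a - a' = (b - b') + (c' - c)" for a a' b b' c c' :: "'q::ab_group_add"
    using that by (simp add: algebra_simps)
  have "comult P ?r = tens P.sA P.sA ?r 1"
    using t unfolding t_def \<Delta>.add \<Delta>.diff P.tens_1_diff[OF P.vector_space_A]
      tens_add_left[OF P.vector_space_A P.vector_space_A] by (rule ar)
  from P.regular_invariant[OF this] obtain c where c: "?r = P.sA c 1" by blast
  interpret \<phi>: Vector_Spaces.linear K.sA P.sA \<phi> by (rule l\<phi>)
  have "q = P.sA c 1 + \<phi> x - k v" using c by (simp add: algebra_simps)
  also have "\<dots> = \<phi> (K.sA c 1 + x - j v)"
    unfolding k_def \<phi>.diff \<phi>.add \<phi>.scale group_hom_one[OF hom_\<phi>] ..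
  finally show ?thesis by blast
qed

lemma surj_\<phi>: "surj \<phi>"
proof -
  interpret \<phi>: Vector_Spaces.linear K.sA P.sA \<phi> by (rule l\<phi>)
  have I: "module.subspace P.sA (range \<phi>)" by (rule \<phi>.subspace_image[OF \<phi>.vs1.subspace_UNIV])
  have "vec (regular P) \<subseteq> range \<phi>"
    by (rule pro_unipotent_exhausted[OF unipotent P.representation_regular]; unfold regular_simps)
      (rule I, erule range_\<phi>_closed)
  thus ?thesis unfolding regular_simps by blast
qed

lemma iso: "group_iso P K \<phi>"
  by (rule bij_group_hom_iso[OF hom_\<phi> K.affine_group_axioms bijI[OF inj_\<phi> surj_\<phi>]])

end

theorem theorem1p13:
  fixes G :: "('f::field, 'g::comm_ring_1) hopf"
    and K :: "('f, 'k::comm_ring_1) hopf"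
    and H :: "('f, 'h::comm_ring_1) hopf"
    and P :: "('f, 'p::comm_ring_1) hopf"
    and i :: "'g \<Rightarrow> 'k" and s :: "'g \<Rightarrow> 'h" and p :: "'h \<Rightarrow> 'g" and \<phi> :: "'k \<Rightarrow> 'p"
  assumes "affine_group G" "affine_group K" "affine_group H" "affine_group P"
    and "semidirect_product G K H i s p"
    and "group_hom P K \<phi>"
    and "pro_unipotent P"
    and "\<And>V. V \<in> Rep G \<Longrightarrow>
      bij_betw (R0_map P K \<phi> (restrict_rep K G i V))
        (R0_Gamma K (restrict_rep K G i V)) (R0_Gamma P (restrict_rep P G (\<phi> \<circ> i) V))"
    and "\<And>V. V \<in> Rep G \<Longrightarrow>
      bij_betw (R1_map P K \<phi> (restrict_rep K G i V))
        (R1_Gamma K (restrict_rep K G i V)) (R1_Gamma P (restrict_rep P G (\<phi> \<circ> i) V))"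
  shows "group_iso P K \<phi>"
proof -
  interpret semidirect G K H i s p
    using assms(1-3,5) by (simp add: semidirect_def semidirect_axioms_def)
  interpret P: affine_group P by fact
  note \<phi> = \<open>group_hom P K \<phi>\<close>
  have Q: "representation K (restrict_rep K G i V)" if "V \<in> Rep G" for V
    using that by (intro representation_restrict[OF K.affine_group_axioms hom_i]) (simp add: Rep_def)
  have R: "representation P (restrict_rep P G (\<phi> \<circ> i) V)" if "V \<in> Rep G" for V
    using that
    by (intro representation_restrict[OF P.affine_group_axioms
          group_hom_compose[OF \<phi> hom_i G.affine_group_axioms]]) (simp add: Rep_def)
  \<comment> \<open>Restricting in two steps is compared with restricting in one only on
    \<open>vec V\<close>, since composites of \<open>tmap\<close> are controlled only on the tensor
    product.\<close>
  have coact: "coact (restrict_rep P G (\<phi> \<circ> i) V) v =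
      tmap (smul V) K.sA (smul V) P.sA id \<phi> (coact (restrict_rep K G i V) v)"
    if "V \<in> Rep G" "v \<in> vec V" for V v
  proof -
    interpret V: representation G V using that by (simp add: Rep_def)
    note lid = linear_id'[OF V.vector_space_V]
    show ?thesis
      unfolding restrict_rep_simps
        tmap_tmap[OF lid li lid group_hom_linear[OF \<phi>] V.coact_in[OF that(2)]]
      by (simp only: o_def id_def)
  qed
  have "comparison G K H i s p P \<phi>"
  proof (intro comparison.intro comparison_axioms.intro semidirect_axioms P.affine_group_axioms assms(6,7))
    fix V :: "('f, nat \<Rightarrow> 'f, 'g) comod" assume V: "V \<in> Rep G"
    show "invariants P (restrict_rep P G (\<phi> \<circ> i) V) \<subseteq> invariants K (restrict_rep K G i V)"
      by (rule R0_map_surj[OF Q[OF V] R[OF V] \<phi>])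
        (simp_all only: restrict_rep_simps(2) bij_betw_imp_surj_on[OF assms(8)[OF V]] subset_refl)
    fix z assume z: "z \<in> cocycles P (restrict_rep P G (\<phi> \<circ> i) V)"
    show "\<exists>z'\<in>cocycles K (restrict_rep K G i V). \<exists>v\<in>vec V.
        z = tmap (smul V) (fsmul K) (smul V) (fsmul P) id \<phi> z'
            + coboundary P (restrict_rep P G (\<phi> \<circ> i) V) v"
      by (rule R1_map_surj[OF Q[OF V] R[OF V] \<phi> _ _ _ _ z, unfolded restrict_rep_simps(1,2)])
        (simp_all only: coact[OF V] bij_betw_imp_surj_on[OF assms(9)[OF V]] subset_refl)
  qed
  then interpret comparison G K H i s p P \<phi> .
  show ?thesis by (rule iso)
qed

end
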